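(* (i) For every complex number $s$ with $\Re s>1$ that is not an odd integer, $$\zeta_h(s) = \frac{(2\pi)^{s-1}}{2\,\Gamma(s-1)\cos\left(\frac{\pi}{2}s\right)}\int_0^{\pi/2}\zeta\left(2-s,\frac{2}{\pi}x\right)\log(\tan x)\,\mathrm{d}x,$$ and for every positive integer $n$, $$\zeta_h(2n+1) = \frac{(-1)^n 2^{2n}\pi^{2n-1}}{(2n-1)!}\int_0^{\pi/2}\zeta'\left(1-2n,\frac{2}{\pi}x\right)\log(\tan x)\,\mathrm{d}x.$$ (ii) The function $$G(z) := \int_0^{\pi/2}\zeta\left(z,\frac{2}{\pi}x\right)\log(\tan x)\,\mathrm{d}x,$$ defined for $\Re z<1$, can be continued analytically to the half-plane $\Re z\geq 1$, except at the poles $z = 2n-1$ ($n = 1,2,3,\dots$), by $$G(z) = -\frac{\pi}{2}\frac{1}{(1-z)^2} + \frac{\pi}{2}\frac{\log\left(\frac{\pi}{2}\right)}{1-z} + \frac{\pi}{2}\sum_{k=1}^\infty\left(1-\frac{1}{2^{2k-1}}\right)\frac{\zeta(2k)}{k(2k+1-z)} - \frac{1}{\pi}\frac{1}{\Gamma(z)}\int_0^\infty w(y)\,e^{-y}y^{z-1}\,\mathrm{d}y,$$ where $$w(y) := \sum_{n=1}^\infty \frac{h_n}{n^2+\left(\frac{y}{2\pi}\right)^2}.$$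
   Context: For a positive integer $n$, $h_n := \sum_{k=1}^n \frac{1}{2k-1}$, and $\zeta_h(s) := \sum_{n=1}^\infty \frac{h_n}{n^s}$ for $\Re s>1$. $\zeta(s)$ is the Riemann zeta function. $\zeta(s,x)$ is the Hurwitz zeta function, defined for $\Re s>1$, $x>0$ by $\zeta(s,x)=\sum_{n=0}^\infty (n+x)^{-s}$ and extended by analytic continuation in $s$ to $\mathbb{C}\setminus\{1\}$; $\zeta'(s,x)$ denotes its derivative with respect to $s$. *)

theory Defs
  imports "HOL-Complex_Analysis.Complex_Analysis"
begin

definition odd_harm :: "nat \<Rightarrow> real" where
  "odd_harm n = (\<Sum>k=1..n. 1 / (2 * real k - 1))"

text \<open>Meaningful for \<open>Re s > 1\<close> only; \<open>summable_zeta_h\<close> below shows convergence there.\<close>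
definition zeta_h :: "complex \<Rightarrow> complex" where
  "zeta_h s = (\<Sum>n. of_real (odd_harm (Suc n)) / of_nat (Suc n) powr s)"

text \<open>
  The two zeta functions are the analytic continuations to the complement of \<open>1\<close> of their
  Dirichlet series. By the identity theorem the chosen function is determined at every point
  other than \<open>1\<close>; its value at \<open>1\<close> is arbitrary.
\<close>
definition riemann_zeta :: "complex \<Rightarrow> complex" where
  "riemann_zeta = (SOME f. f holomorphic_on (UNIV - {1}) \<and>
     (\<forall>s. Re s > 1 \<longrightarrow> f s = (\<Sum>n. of_nat (Suc n) powr (-s))))"

text \<open>Meaningful for \<open>x > 0\<close> only.\<close>
definition hurwitz_zeta :: "complex \<Rightarrow> real \<Rightarrow> complex" where
  "hurwitz_zeta s x = (SOME f. f holomorphic_on (UNIV - {1}) \<and>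
     (\<forall>s. Re s > 1 \<longrightarrow> f s = (\<Sum>n. (of_nat n + of_real x) powr (-s)))) s"

text \<open>The derivative with respect to the first argument.\<close>
definition hurwitz_zeta' :: "complex \<Rightarrow> real \<Rightarrow> complex" where
  "hurwitz_zeta' s x = deriv (\<lambda>z. hurwitz_zeta z x) s"

text \<open>Meaningful for \<open>Re z < 1\<close> only.\<close>
definition G_fun :: "complex \<Rightarrow> complex" where
  "G_fun z = (LBINT x:{0<..<pi/2}. hurwitz_zeta z (2 / pi * x) * of_real (ln (tan x)))"

definition w_fun :: "real \<Rightarrow> real" where
  "w_fun y = (\<Sum>n. odd_harm (Suc n) / (real (Suc n) ^ 2 + (y / (2 * pi)) ^ 2))"

lemma odd_harm_nonneg: "odd_harm n \<ge> 0"
  unfolding odd_harm_def by (intro sum_nonneg) auto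

lemma odd_harm_le_powr:
  assumes "e > 0" "n > 0"
  shows "odd_harm n \<le> (1 + 1 / e) * real n powr e"
proof -
  have "odd_harm n \<le> (\<Sum>k=1..n. inverse (real k))"
    unfolding odd_harm_def by (intro sum_mono) (auto simp: field_simps)
  also have "\<dots> = harm n"
    by (simp add: harm_def)
  also have "\<dots> \<le> ln (real n) + 1"
    using euler_mascheroni_sequence_decreasing[of 1 n] assms(2) by (simp add: harm_def)
  also have "ln (real n) \<le> real n powr e / e"
    using assms by (intro ln_powr_bound) auto
  also have "1 \<le> real n powr e"
    using assms by (intro ge_one_powr_ge_zero) auto
  finally show ?thesis
    by (simp add: algebra_simps)
qed

lemma summable_odd_harm_powr:
  assumes "\<sigma> > 1"
  shows "summable (\<lambda>n. odd_harm (Suc n) / real (Suc n) powr \<sigma>)"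
proof -
  define e where "e = (\<sigma> - 1) / 2"
  have e: "e > 0" "e - \<sigma> < -1"
    using assms by (auto simp: e_def field_simps)
  have "summable (\<lambda>n. real n powr (e - \<sigma>))"
    using e by (simp add: summable_real_powr_iff)
  hence "summable (\<lambda>n. (1 + 1 / e) * real (Suc n) powr (e - \<sigma>))"
    by (intro summable_mult) (subst summable_Suc_iff)
  thus ?thesis
  proof (rule summable_comparison_test'[where N = 0])
    fix n :: nat
    have "odd_harm (Suc n) / real (Suc n) powr \<sigma>
            \<le> ((1 + 1 / e) * real (Suc n) powr e) / real (Suc n) powr \<sigma>"
      using e(1) by (intro divide_right_mono odd_harm_le_powr) auto
    thus "norm (odd_harm (Suc n) / real (Suc n) powr \<sigma>)
            \<le> (1 + 1 / e) * real (Suc n) powr (e - \<sigma>)"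
      using odd_harm_nonneg[of "Suc n"] by (simp add: powr_diff)
  qed
qed

lemma summable_zeta_h:
  assumes "Re s > 1"
  shows "summable (\<lambda>n. of_real (odd_harm (Suc n)) / of_nat (Suc n) powr s :: complex)"
proof (rule summable_norm_cancel)
  have "norm (of_real (odd_harm (Suc n)) / of_nat (Suc n) powr s :: complex)
          = odd_harm (Suc n) / real (Suc n) powr Re s" for n
    using norm_powr_real_powr[of "of_nat (Suc n)" s] odd_harm_nonneg[of "Suc n"]
    by (simp add: norm_divide del: of_nat_Suc)
  thus "summable (\<lambda>n. norm (of_real (odd_harm (Suc n)) / of_nat (Suc n) powr s :: complex))"
    using summable_odd_harm_powr[OF assms] by simp
qed

lemma summable_w_fun:
  "summable (\<lambda>n. odd_harm (Suc n) / (real (Suc n) ^ 2 + (y / (2 * pi)) ^ 2))"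
proof (rule summable_comparison_test'[where N = 0])
  show "summable (\<lambda>n. odd_harm (Suc n) / real (Suc n) powr 2)"
    by (rule summable_odd_harm_powr) auto
next
  fix n :: nat
  have "odd_harm (Suc n) / (real (Suc n) ^ 2 + (y / (2 * pi)) ^ 2)
          \<le> odd_harm (Suc n) / real (Suc n) ^ 2"
    using odd_harm_nonneg[of "Suc n"]
    by (intro divide_left_mono mult_pos_pos add_pos_nonneg) auto
  thus "norm (odd_harm (Suc n) / (real (Suc n) ^ 2 + (y / (2 * pi)) ^ 2))
          \<le> odd_harm (Suc n) / real (Suc n) powr 2"
    using odd_harm_nonneg[of "Suc n"] by simp
qed

end

theory Submission
  imports Defs
begin

text \<open>
  Put \<open>g(t) = ln (tan (\<pi>t/2))\<close> on \<open>(0,1)\<close>. Up to the factor \<open>\<pi>/2\<close> the function \<open>G(z)\<close> is the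
  integral of \<open>\<zeta>(z,t) g(t)\<close> over \<open>(0,1)\<close>. Everything rests on one Laplace transform
  (\<open>laplace_logtan\<close>): for \<open>y > 0\<close>,

    \<open>\<integral> e^(-ty) g(t) dt = - (2/\<pi>^2) (1 - e^(-y)) w(y)\<close>.

  It is the point where the numbers \<open>h_n\<close> enter. Since \<open>g\<close> is odd about \<open>1/2\<close>, only the part
  \<open>sinh (y(1/2 - t))\<close> of the exponential matters. Integration by parts moves the derivative to
  \<open>g'(t) = \<pi> / sin (\<pi>t)\<close>, the antiderivative \<open>cosh (y/2) - cosh (y(1/2 - t))\<close> is a series in
  \<open>1 - cos (2\<pi>nt)\<close> with coefficients proportional to \<open>1/(y^2 + 4\<pi>^2n^2)\<close>, and
  \<open>\<integral> (1 - cos (2\<pi>nt)) \<pi> / sin (\<pi>t) dt = 4 h_n\<close>.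

  From \<open>(c+t)^(-s) \<Gamma>(s) = \<integral> y^(s-1) e^(-(c+t)y) dy\<close> and Fubini one obtains
  \<open>\<integral> (c+t)^(-s) g(t) dt\<close> as a Mellin integral of \<open>e^(-cy) (1 - e^(-y)) w(y)\<close>. Two uses of this
  describe \<open>\<zeta>(z,t) = t^(-z) + \<zeta>(z,1+t)\<close>.

  \<^item> Summing over \<open>c = 1, 2, \<dots>\<close> for \<open>s > 1\<close> leads to a geometric series and gives the
    contribution of \<open>\<zeta>(z,1+t)\<close> as \<open>-(2/\<pi>^2) / \<Gamma>(z)\<close> times the Mellin transform of \<open>e^(-y) w(y)\<close>.
    Both sides, multiplied by \<open>z - 1\<close>, are holomorphic for \<open>Re z > 0\<close>, so the identity persists
    there (\<open>hurwitz_entire_logtan_eq\<close>). The contribution of \<open>t^(-z)\<close> is evaluated with the power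
    series of \<open>g(t) - ln (\<pi>t/2)\<close> (\<open>set_integral_powr_logtan\<close>). This is the formula of part (ii),
    first for \<open>0 < Re z < 1\<close>; its right-hand side is meromorphic for \<open>Re z > 0\<close> and exhibits the
    poles.

  \<^item> For \<open>c = 0\<close> and \<open>0 < s < 1\<close> the contribution of \<open>t^(-s)\<close> is the same multiple of the
    Mellin transform of \<open>(1 - e^(-y)) w(y)\<close>. Adding the two contributions, \<open>e^(-y)\<close> cancels and \<open>G(s)\<close> becomes
    \<open>-1/(\<pi>\<Gamma>(s))\<close> times the Mellin transform of \<open>w\<close> itself, which termwise is a multiple of
    \<open>\<zeta>_h(2-s)\<close>. With the reflection formula and the identity theorem this yields, for \<open>Re z < 1\<close>,

      \<open>G(z) = - (1/\<pi>) cos (\<pi>z/2) \<Gamma>(1-z) (2\<pi>)^z \<zeta>_h(2-z)\<close>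

    (\<open>hurwitz_logtan_eq_zeta_h\<close>). Solving for \<open>\<zeta>_h\<close> gives the first formula of part (i). At
    \<open>z = 1 - 2n\<close> the cosine has a simple zero, and differentiating there gives the second one.

  The analytic continuation of \<open>(z-1) \<zeta>(z,1+t)\<close> is constructed together with bounds that are locally
  uniform in \<open>z\<close> and uniform in \<open>0 \<le> t \<le> 1\<close>, so that all integrals may be treated as holomorphic parameter integrals.
\<close>

section \<open>Series and integrals depending holomorphically on a parameter\<close>

lemma holomorphic_suminf:
  fixes f :: "nat \<Rightarrow> complex \<Rightarrow> complex"
  assumes U: "open U"
    and hol: "\<And>n. f n holomorphic_on U"
    and bd: "\<And>z. z \<in> U \<Longrightarrow> \<exists>r>0. \<exists>M. summable M \<and>
               (\<forall>\<^sub>F n in sequentially. \<forall>w\<in>cball z r \<inter> U. norm (f n w) \<le> M n)"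
  shows "(\<lambda>z. \<Sum>n. f n z) holomorphic_on U"
proof (rule holomorphic_uniform_sequence[where f = "\<lambda>N z. \<Sum>n<N. f n z", OF U])
  show "(\<lambda>z. \<Sum>n<N. f n z) holomorphic_on U" for N
    by (intro holomorphic_intros hol)
next
  fix z assume z: "z \<in> U"
  obtain r M where r: "r > 0" "summable M"
    "\<forall>\<^sub>F n in sequentially. \<forall>w\<in>cball z r \<inter> U. norm (f n w) \<le> M n"
    using bd[OF z] by blast
  obtain r' where r': "r' > 0" "cball z r' \<subseteq> U"
    using U z open_contains_cball by blast
  define d where "d = min r r'"
  have d: "d > 0" "cball z d \<subseteq> U" "cball z d \<subseteq> cball z r \<inter> U"
    using r(1) r' by (auto simp: d_def)
  have "uniform_limit (cball z r \<inter> U) (\<lambda>N z. \<Sum>n<N. f n z) (\<lambda>z. \<Sum>n. f n z) sequentially"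
    by (rule Weierstrass_m_test_ev[OF r(3,2)])
  hence "uniform_limit (cball z d) (\<lambda>N z. \<Sum>n<N. f n z) (\<lambda>z. \<Sum>n. f n z) sequentially"
    by (rule uniform_limit_on_subset) (use d in auto)
  thus "\<exists>d>0. cball z d \<subseteq> U \<and> uniform_limit (cball z d) (\<lambda>N z. \<Sum>n<N. f n z) (\<lambda>z. \<Sum>n. f n z) sequentially"
    using d by blast
qed

text \<open>
  A locally uniform integrable majorant of \<open>f\<close> alone controls the difference quotients in \<open>z\<close>:
  Cauchy's inequality bounds the derivative by \<open>h t / d\<close> on a smaller disc, the mean value estimate
  transfers this to the quotients, and dominated convergence applies. Continuity in \<open>t\<close> is not
  required, which matters because the integrands below are singular at the ends of the interval.
\<close>

lemma
  fixes f :: "complex \<Rightarrow> 'a \<Rightarrow> complex"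
  assumes U: "open U" and z: "z \<in> U" and A: "A \<in> sets M"
    and hol: "\<And>t. t \<in> A \<Longrightarrow> (\<lambda>z. f z t) holomorphic_on U"
    and meas: "\<And>z. z \<in> U \<Longrightarrow> set_borel_measurable M A (f z)"
    and bd: "\<And>z. z \<in> U \<Longrightarrow> \<exists>r>0. \<exists>h. set_integrable M A h \<and>
               (\<forall>w\<in>cball z r \<inter> U. \<forall>t\<in>A. norm (f w t) \<le> h t)"
  shows set_integrable_holomorphic_param: "set_integrable M A (f z)"
    and set_integrable_deriv_param: "set_integrable M A (\<lambda>t. deriv (\<lambda>z. f z t) z)"
    and has_field_derivative_set_integral:
      "((\<lambda>z. set_lebesgue_integral M A (f z)) has_field_derivative
          set_lebesgue_integral M A (\<lambda>t. deriv (\<lambda>z. f z t) z)) (at z)"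
proof -
  have int: "set_integrable M A (f z)" if z: "z \<in> U" for z
  proof -
    obtain r h where "r > 0" and h: "set_integrable M A h"
      "\<forall>w\<in>cball z r \<inter> U. \<forall>t\<in>A. norm (f w t) \<le> h t"
      using bd[OF z] by blast
    show ?thesis
      using meas[OF z] h \<open>r > 0\<close> z
      by (intro set_integrable_bound[OF h(1)] AE_I2) force+
  qed
  show "set_integrable M A (f z)" by (rule int[OF z])
  obtain r h where r: "r > 0" and h: "set_integrable M A h"
    and hb: "\<And>w t. w \<in> cball z r \<Longrightarrow> w \<in> U \<Longrightarrow> t \<in> A \<Longrightarrow> norm (f w t) \<le> h t"
    using bd[OF z] by blast
  obtain r' where r': "r' > 0" "cball z r' \<subseteq> U"
    using U z open_contains_cball by blast
  define d where "d = min r r' / 2"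
  have d: "d > 0" using r r' by (auto simp: d_def)
  have d2: "cball w d \<subseteq> U" "cball w d \<subseteq> cball z r" if "w \<in> cball z d" for w
  proof -
    have "dist z x \<le> min r r'" if "x \<in> cball w d" for x
      using that \<open>w \<in> _\<close> dist_triangle[of z x w] by (auto simp: d_def field_simps)
    thus "cball w d \<subseteq> U" "cball w d \<subseteq> cball z r" using r' by auto
  qed
  have db: "norm (deriv (\<lambda>z. f z t) w) \<le> h t / d" if t: "t \<in> A" and w: "w \<in> cball z d" for w t
  proof -
    have "norm ((deriv ^^ 1) (\<lambda>z. f z t) w) \<le> fact 1 * h t / d ^ 1"
    proof (rule Cauchy_inequality)
      show "(\<lambda>z. f z t) holomorphic_on ball w d"
        using holomorphic_on_subset[OF hol[OF t]] d2(1)[OF w] ball_subset_cball by blast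
      show "continuous_on (cball w d) (\<lambda>z. f z t)"
        using holomorphic_on_subset[OF hol[OF t] d2(1)[OF w]] holomorphic_on_imp_continuous_on by blast
      show "norm (f x t) \<le> h t" if "norm (w - x) = d" for x
        using that d2[OF w] t by (intro hb) (auto simp: dist_norm)
    qed fact
    thus ?thesis by simp
  qed
  have der: "((\<lambda>z. f z t) has_field_derivative deriv (\<lambda>z. f z t) w) (at w)" if "t \<in> A" "w \<in> U" for t w
    using hol[OF that(1)] U that(2) holomorphic_derivI by blast
  have lip: "norm (f w t - f z t) \<le> h t / d * norm (w - z)" if "t \<in> A" "w \<in> cball z d" for w t
  proof (rule field_differentiable_bound)
    show "convex (cball z d)" by simp
    show "((\<lambda>z. f z t) has_field_derivative deriv (\<lambda>z. f z t) x) (at x within cball z d)"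
      if "x \<in> cball z d" for x
      using that d2[OF that] d \<open>t \<in> A\<close>
      by (intro DERIV_subset[OF der]) auto
  qed (use db that d in auto)
  have main: "set_integrable M A (\<lambda>t. deriv (\<lambda>z. f z t) z) \<and>
     (\<lambda>n. set_lebesgue_integral M A (\<lambda>t. (f (X n) t - f z t) / (X n - z)))
        \<longlonglongrightarrow> set_lebesgue_integral M A (\<lambda>t. deriv (\<lambda>z. f z t) z)"
    if X: "\<And>n. X n \<in> cball z d - {z}" "X \<longlonglongrightarrow> z" for X :: "nat \<Rightarrow> complex"
  proof -
    let ?q = "\<lambda>n t. indicator A t *\<^sub>R ((f (X n) t - f z t) / (X n - z))"
    let ?l = "\<lambda>t. indicator A t *\<^sub>R deriv (\<lambda>z. f z t) z"
    have XU: "X n \<in> U" for n using X(1)[of n] d2(1)[of z] d by auto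
    have q: "?q n = (\<lambda>t. (indicator A t *\<^sub>R f (X n) t - indicator A t *\<^sub>R f z t) / (X n - z))" for n
      by (auto simp: fun_eq_iff indicator_def)
    have qm [measurable]: "?q n \<in> borel_measurable M" for n
      using meas[OF XU[of n]] meas[OF z] unfolding q set_borel_measurable_def by measurable
    have ql: "(\<lambda>n. ?q n t) \<longlonglongrightarrow> ?l t" for t
    proof (cases "t \<in> A")
      case True
      have "((\<lambda>w. (f w t - f z t) / (w - z)) \<longlongrightarrow> deriv (\<lambda>z. f z t) z) (at z)"
        using der[OF True z] by (simp add: has_field_derivative_iff)
      moreover have "filterlim X (at z) sequentially"
        using X by (auto simp: filterlim_at intro!: always_eventually)
      ultimately have "(\<lambda>n. (f (X n) t - f z t) / (X n - z)) \<longlonglongrightarrow> deriv (\<lambda>z. f z t) z"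
        by (rule filterlim_compose)
      thus ?thesis using True by simp
    qed auto
    have lm [measurable]: "?l \<in> borel_measurable M"
      by (rule borel_measurable_LIMSEQ_metric[OF qm ql])
    have dom: "integrable M (\<lambda>t. indicator A t *\<^sub>R (h t / d))"
      using integrable_divide_zero[OF h(1)[unfolded set_integrable_def], of d] by simp
    have qb: "norm (?q n t) \<le> indicator A t *\<^sub>R (h t / d)" for n t
    proof (cases "t \<in> A")
      case True
      show ?thesis using lip[OF True, of "X n"] X(1)[of n] True
        by (auto simp: norm_divide field_simps)
    qed auto
    show ?thesis
      unfolding set_integrable_def set_lebesgue_integral_def
      using integrable_dominated_convergence[where s = ?q, OF lm qm dom AE_I2[OF ql] AE_I2[OF qb]]
        integral_dominated_convergence[where s = ?q, OF lm qm dom AE_I2[OF ql] AE_I2[OF qb]]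
      by simp
  qed
  define X0 where "X0 n = z + of_real (d / real (Suc n))" for n
  have "X0 n \<in> cball z d - {z}" for n
  proof -
    have "0 < d / real (Suc n)" "d / real (Suc n) \<le> d"
      using d by (auto simp: field_simps)
    thus ?thesis
      unfolding X0_def by (simp add: dist_norm del: of_real_divide of_nat_Suc)
  qed
  moreover have "X0 \<longlonglongrightarrow> z"
  proof -
    have "(\<lambda>n. d / real (Suc n)) \<longlonglongrightarrow> 0"
      by (intro LIMSEQ_Suc lim_const_over_n)
    hence "(\<lambda>n. z + of_real (d / real (Suc n))) \<longlonglongrightarrow> z + of_real 0"
      by (intro tendsto_intros)
    thus ?thesis unfolding X0_def by simp
  qed
  ultimately show "set_integrable M A (\<lambda>t. deriv (\<lambda>z. f z t) z)"
    using main[of X0] by blast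
  have "((\<lambda>w. (set_lebesgue_integral M A (f w) - set_lebesgue_integral M A (f z)) / (w - z))
          \<longlongrightarrow> set_lebesgue_integral M A (\<lambda>t. deriv (\<lambda>z. f z t) z)) (at z within (cball z d - {z}))"
  proof (subst tendsto_at_iff_sequentially, intro allI impI, unfold o_def)
    fix X assume X: "\<forall>i. X i \<in> cball z d - {z} - {z}" "X \<longlonglongrightarrow> z"
    have XU: "X n \<in> U" for n using X(1) d2(1)[of z] d by auto
    have "(\<lambda>n. set_lebesgue_integral M A (\<lambda>t. (f (X n) t - f z t) / (X n - z)))
        \<longlonglongrightarrow> set_lebesgue_integral M A (\<lambda>t. deriv (\<lambda>z. f z t) z)"
      using main[of X] X by auto
    moreover have "set_lebesgue_integral M A (\<lambda>t. (f (X n) t - f z t) / (X n - z)) =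
      (set_lebesgue_integral M A (f (X n)) - set_lebesgue_integral M A (f z)) / (X n - z)" for n
      using int[OF XU[of n]] int[OF z]
      by (simp add: set_integral_diff)
    ultimately show "(\<lambda>n. (set_lebesgue_integral M A (f (X n)) - set_lebesgue_integral M A (f z)) / (X n - z))
        \<longlonglongrightarrow> set_lebesgue_integral M A (\<lambda>t. deriv (\<lambda>z. f z t) z)" by (simp only:)
  qed
  also have "at z within (cball z d - {z}) = at z"
    using d by (intro at_within_nhd[of z "ball z d"]) auto
  finally show "((\<lambda>z. set_lebesgue_integral M A (f z)) has_field_derivative
          set_lebesgue_integral M A (\<lambda>t. deriv (\<lambda>z. f z t) z)) (at z)"
    by (simp add: has_field_derivative_iff)
qed

lemma holomorphic_on_set_integral:
  fixes f :: "complex \<Rightarrow> 'a \<Rightarrow> complex"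
  assumes "open U" and "A \<in> sets M"
    and "\<And>t. t \<in> A \<Longrightarrow> (\<lambda>z. f z t) holomorphic_on U"
    and "\<And>z. z \<in> U \<Longrightarrow> set_borel_measurable M A (f z)"
    and "\<And>z. z \<in> U \<Longrightarrow> \<exists>r>0. \<exists>h. set_integrable M A h \<and>
               (\<forall>w\<in>cball z r \<inter> U. \<forall>t\<in>A. norm (f w t) \<le> h t)"
  shows "(\<lambda>z. set_lebesgue_integral M A (f z)) holomorphic_on U"
  using has_field_derivative_set_integral[OF assms(1) _ assms(2-)] assms(1)
  by (simp add: holomorphic_on_open) blast

text \<open>
  The identity theorem in the form in which it is applied throughout: all evaluations of integrals
  are done for a real parameter, where the integrands are real and mostly of one sign.
\<close>

lemma holomorphic_eq_of_real_eq:
  fixes f g :: "complex \<Rightarrow> complex"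
  assumes hol: "f holomorphic_on U" "g holomorphic_on U" and U: "open U" "connected U"
    and I: "a < b" "\<And>x. a < x \<Longrightarrow> x < b \<Longrightarrow> of_real x \<in> U"
    and eq: "\<And>x. a < x \<Longrightarrow> x < b \<Longrightarrow> f (of_real x) = g (of_real x)"
    and z: "z \<in> U"
  shows "f z = g z"
proof -
  define c where "c = (a + b) / 2"
  have c: "a < c" "c < b" using I(1) by (auto simp: c_def)
  have "f z - g z = 0"
  proof (rule analytic_continuation[where f = "\<lambda>z. f z - g z" and S = U and U = "of_real ` {a<..<b}"])
    show "complex_of_real c islimpt of_real ` {a<..<b}"
    proof -
      have "c islimpt {a<..<b}" using c by (simp add: islimpt_greaterThanLessThan1 interior_limit_point)
      thus ?thesis
        using islimpt_isCont_image[of c "{a<..<b}" complex_of_real]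
        by (auto simp: eventually_at_filter)
    qed
  qed (use hol U I z eq c in \<open>auto intro!: holomorphic_intros\<close>)
  thus ?thesis by simp
qed

text \<open>
  Monotone convergence for series, phrased such that the integrability of the sum is read off from the
  convergence of the series of integrals.
\<close>

lemma
  fixes f :: "nat \<Rightarrow> 'a \<Rightarrow> real"
  assumes int: "\<And>n. set_integrable M A (f n)"
    and nonneg: "\<And>n x. x \<in> A \<Longrightarrow> f n x \<ge> 0"
    and sums: "\<And>x. x \<in> A \<Longrightarrow> (\<lambda>n. f n x) sums F x"
    and sm: "summable (\<lambda>n. LINT x:A|M. f n x)"
  shows set_integrable_sums_nonneg: "set_integrable M A F"
    and set_integral_sums_nonneg: "(\<lambda>n. LINT x:A|M. f n x) sums (LINT x:A|M. F x)"
proof -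
  define g where "g n x = indicator A x *\<^sub>R f n x" for n x
  have g_int: "integrable M (g n)" for n
    using int[of n] unfolding g_def[abs_def] set_integrable_def .
  have g_norm: "norm (g n x) = g n x" for n x
    using nonneg by (simp add: g_def indicator_def)
  have g_sums: "(\<lambda>n. g n x) sums (indicator A x *\<^sub>R F x)" for x
    using sums by (cases "x \<in> A") (simp_all add: g_def)
  have ptw: "AE x in M. summable (\<lambda>n. norm (g n x))"
    using g_sums unfolding g_norm by (intro AE_I2) (simp add: sums_iff)
  have sm': "summable (\<lambda>n. \<integral>x. norm (g n x) \<partial>M)"
    using sm unfolding g_norm by (simp add: g_def set_lebesgue_integral_def)
  have lim: "(\<lambda>x. \<Sum>n. g n x) = (\<lambda>x. indicator A x *\<^sub>R F x)"
    using g_sums by (simp add: sums_iff)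
  show "set_integrable M A F"
    using integrable_suminf[OF g_int ptw sm'] unfolding lim set_integrable_def .
  show "(\<lambda>n. LINT x:A|M. f n x) sums (LINT x:A|M. F x)"
    using sums_integral[OF g_int ptw sm'] unfolding lim by (simp add: g_def set_lebesgue_integral_def)
qed

lemma bounded_on_compact_Times:
  fixes f :: "complex \<Rightarrow> real \<Rightarrow> complex"
  assumes "continuous_on (Z \<times> T) (\<lambda>(z, t). f z t)" "compact Z" "compact T"
  obtains M where "\<And>z t. z \<in> Z \<Longrightarrow> t \<in> T \<Longrightarrow> norm (f z t) \<le> M"
proof -
  have "bounded ((\<lambda>(z, t). f z t) ` (Z \<times> T))"
    using assms by (intro compact_imp_bounded compact_continuous_image compact_Times)
  then obtain M where "\<forall>p\<in>Z \<times> T. norm ((\<lambda>(z, t). f z t) p) \<le> M"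
    by (auto simp: bounded_iff)
  thus ?thesis using that by fastforce
qed

lemma Re_cball_bounds:
  assumes "w \<in> cball z r"
  shows "Re z - r \<le> Re w" "Re w \<le> Re z + r"
proof -
  have "\<bar>Re (z - w)\<bar> \<le> r"
    using assms abs_Re_le_cmod[of "z - w"] by (simp add: dist_norm)
  hence "\<bar>Re z - Re w\<bar> \<le> r" by simp
  thus "Re z - r \<le> Re w" "Re w \<le> Re z + r" by linarith+
qed

text \<open>
  Used with the polar part multiplied out, so that \<open>f\<close> is the numerator and \<open>f a\<close> the leading coefficient
  up to sign.
\<close>

lemma is_pole_divide_power:
  assumes hol: "f holomorphic_on U" and U: "open U" "a \<in> U" and "f a \<noteq> 0" "n > 0"
    and eq: "\<And>z. z \<noteq> a \<Longrightarrow> g z = f z / (a - z) ^ n"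
  shows "is_pole g a"
proof -
  have "isCont f a"
    using holomorphic_on_imp_continuous_on[OF hol] continuous_on_eq_continuous_at[OF U(1)] U(2) by blast
  moreover have "filterlim (\<lambda>z. (a - z) ^ n) (at 0) (at a)"
    using \<open>n > 0\<close> by (intro filterlim_atI) (auto intro!: tendsto_eq_intros simp: eventually_at_filter)
  ultimately have "is_pole (\<lambda>z. f z / (a - z) ^ n) a"
    using \<open>f a \<noteq> 0\<close> by (rule is_pole_divide)
  thus ?thesis
    using eq by (subst is_pole_cong[where g = "\<lambda>z. f z / (a - z) ^ n"]) (auto simp: eventually_at_filter)
qed

section \<open>Analytic continuation of the Hurwitz zeta function\<close>

text \<open>
  The values are \<open>(z - 1) \<zeta>(z, 1 + t)\<close> on the half-plane \<open>Re z > 1 - k\<close>. The recursion extends the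
  domain by one unit to the left. It comes from \<open>\<partial>\<zeta>(z,x)/\<partial>x = - z \<zeta>(z+1,x)\<close> and
  \<open>\<integral> \<zeta>(z, x+v) dv = x^(1-z) / (z-1)\<close> over \<open>0 \<le> v \<le> 1\<close>: together they give
  \<open>\<zeta>(z,x) = x^(1-z) / (z-1) + z \<integral> (1-u) \<zeta>(z+1, x+u) du\<close>. After multiplication by \<open>z - 1\<close> no pole is
  left, and joint continuity in \<open>(z,t)\<close> passes through the recursion. The shift of the second argument
  by one keeps \<open>t = 0\<close> in the domain, so that compactness gives bounds that are uniform in \<open>0 \<le> t \<le> 1\<close>.
\<close>

fun hurwitz_entire_aux :: "nat \<Rightarrow> complex \<Rightarrow> real \<Rightarrow> complex" where
  "hurwitz_entire_aux 0 z t = (z - 1) * (\<Sum>n. of_real (real (Suc n) + t) powr (-z))"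
| "hurwitz_entire_aux (Suc k) z t = of_real (1 + t) powr (1 - z) +
     (z - 1) * integral {0..1} (\<lambda>u. of_real (1 - u) * hurwitz_entire_aux k (z + 1) (t + u))"

text \<open>
  The entire function \<open>z \<mapsto> (z - 1) \<zeta>(z, 1 + t)\<close>, pieced together from its restrictions to half-planes.
\<close>

definition hurwitz_entire :: "complex \<Rightarrow> real \<Rightarrow> complex" where
  "hurwitz_entire z t = hurwitz_entire_aux (nat \<lceil>2 - Re z\<rceil>) z t"

lemma norm_hurwitz_term_le:
  assumes "t \<ge> 0" "\<sigma> \<le> Re z" "\<sigma> > 0"
  shows "norm (complex_of_real (real (Suc n) + t) powr (-z)) \<le> real (Suc n) powr (-\<sigma>)"
proof -
  have "norm (complex_of_real (real (Suc n) + t) powr (-z)) = (real (Suc n) + t) powr (- Re z)"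
    using assms by (subst norm_powr_real_powr) auto
  also have "\<dots> \<le> (real (Suc n) + t) powr (-\<sigma>)"
    using assms by (intro powr_mono) auto
  also have "\<dots> \<le> real (Suc n) powr (-\<sigma>)"
    using assms by (intro powr_mono2') auto
  finally show ?thesis .
qed

lemma summable_Suc_powr: "\<sigma> > 1 \<Longrightarrow> summable (\<lambda>n. real (Suc n) powr (-\<sigma>))"
  by (subst summable_Suc_iff) (simp add: summable_real_powr_iff)

lemma summable_hurwitz_terms:
  assumes "t \<ge> 0" "Re z > 1"
  shows "summable (\<lambda>n. complex_of_real (real (Suc n) + t) powr (-z))"
  by (rule summable_comparison_test'[OF summable_Suc_powr[OF assms(2)]])
     (use assms in \<open>intro norm_hurwitz_term_le, auto\<close>)

text \<open>
  The second factor \<open>T\<close> is a closed half-line below, so that the product sets are not open and gluing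
  along an open cover has to be done in the first coordinate only.
\<close>

lemma continuous_on_local_Re:
  fixes f :: "complex \<times> real \<Rightarrow> complex"
  assumes "\<And>z. z \<in> U \<Longrightarrow> \<exists>V g. open V \<and> z \<in> V \<and> continuous_on ((U \<inter> V) \<times> T) g \<and>
             (\<forall>w\<in>U \<inter> V. \<forall>t\<in>T. f (w, t) = g (w, t))"
  shows "continuous_on (U \<times> T) f"
  unfolding continuous_on_eq_continuous_within
proof
  fix p assume p: "p \<in> U \<times> T"
  obtain V g where V: "open V" "fst p \<in> V" "continuous_on ((U \<inter> V) \<times> T) g"
    "\<forall>w\<in>U \<inter> V. \<forall>t\<in>T. f (w, t) = g (w, t)"
    using assms[of "fst p"] p by auto
  have "continuous_on ((U \<inter> V) \<times> T) f"
    using V(3) by (rule continuous_on_eq) (use V(4) in auto)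
  hence "continuous (at p within (U \<inter> V) \<times> T) f"
    using p V(2) by (cases p) (auto simp: continuous_on_eq_continuous_within)
  also have "at p within (U \<inter> V) \<times> T = at p within U \<times> T"
    using p V by (intro at_within_nhd[of p "V \<times> UNIV"]) (auto simp: mem_Times_iff intro!: open_Times)
  finally show "continuous (at p within U \<times> T) f" .
qed

lemma continuous_on_hurwitz_entire_aux_0:
  "continuous_on ({z. Re z > 1} \<times> {0..}) (\<lambda>(z, t). hurwitz_entire_aux 0 z t)"
proof (rule continuous_on_local_Re)
  fix z :: complex assume z: "z \<in> {z. Re z > 1}"
  define \<sigma> where "\<sigma> = (1 + Re z) / 2"
  have \<sigma>: "\<sigma> > 1" "Re z > \<sigma>" using z by (auto simp: \<sigma>_def)
  let ?S = "{z. Re z > \<sigma>}"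
  let ?g = "\<lambda>N p. \<Sum>n<N. complex_of_real (real (Suc n) + snd p) powr (- fst p)"
  have "uniform_limit (?S \<times> {0..}) ?g
          (\<lambda>p. \<Sum>n. complex_of_real (real (Suc n) + snd p) powr (- fst p)) sequentially"
    using \<sigma> by (intro Weierstrass_m_test[OF norm_hurwitz_term_le summable_Suc_powr[OF \<sigma>(1)]]) auto
  moreover have "continuous_on (?S \<times> {0..}) (?g N)" for N
    by (intro continuous_intros) (auto simp del: of_real_add of_nat_Suc)
  ultimately have "continuous_on (?S \<times> {0..})
      (\<lambda>p. \<Sum>n. complex_of_real (real (Suc n) + snd p) powr (- fst p))"
    by (intro uniform_limit_theorem[where F = sequentially and f = ?g]) auto
  hence "continuous_on (?S \<times> {0..}) (\<lambda>(z, t). hurwitz_entire_aux 0 z t)"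
    by (auto simp: case_prod_unfold intro!: continuous_intros)
  hence "continuous_on (({z. Re z > 1} \<inter> ?S) \<times> {0..}) (\<lambda>(z, t). hurwitz_entire_aux 0 z t)"
    by (rule continuous_on_subset) auto
  thus "\<exists>V g. open V \<and> z \<in> V \<and> continuous_on (({z. Re z > 1} \<inter> V) \<times> {0..}) g \<and>
             (\<forall>w\<in>{z. Re z > 1} \<inter> V. \<forall>t\<in>{0..}. (case (w, t) of (z, t) \<Rightarrow> hurwitz_entire_aux 0 z t) = g (w, t))"
    using \<sigma> by (intro exI[of _ ?S] exI[of _ "\<lambda>(z, t). hurwitz_entire_aux 0 z t"])
               (auto simp: open_halfspace_Re_gt)
qed

lemma continuous_on_hurwitz_entire_aux:
  "continuous_on ({z. Re z > 1 - real k} \<times> {0..}) (\<lambda>(z, t). hurwitz_entire_aux k z t)"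
proof (induction k)
  case 0
  thus ?case using continuous_on_hurwitz_entire_aux_0 by simp
next
  case (Suc k)
  let ?S = "{z. Re z > 1 - real (Suc k)} \<times> {0::real..}"
  have "continuous_on (?S \<times> cbox 0 1)
          (\<lambda>q. of_real (1 - snd q) * (\<lambda>(z, t). hurwitz_entire_aux k z t) (fst (fst q) + 1, snd (fst q) + snd q))"
    by (intro continuous_intros continuous_on_compose2[OF Suc.IH]) auto
  hence "continuous_on (?S \<times> cbox 0 1)
          (\<lambda>(p, u). of_real (1 - u) * hurwitz_entire_aux k (fst p + 1) (snd p + u))"
    by (simp add: case_prod_unfold)
  hence "continuous_on ?S (\<lambda>p. integral (cbox 0 1)
           (\<lambda>u. of_real (1 - u) * hurwitz_entire_aux k (fst p + 1) (snd p + u)))"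
    by (rule integral_continuous_on_param)
  hence "continuous_on ?S (\<lambda>p. integral {0..1}
           (\<lambda>u. of_real (1 - u) * hurwitz_entire_aux k (fst p + 1) (snd p + u)))"
    by simp
  thus ?case
    unfolding hurwitz_entire_aux.simps case_prod_unfold
    by (intro continuous_intros) (auto simp del: of_real_add of_real_diff)
qed

lemma continuous_on_hurwitz_entire_aux_section:
  assumes "Re z > 1 - real k" "t \<ge> 0"
  shows "continuous_on {0..} (\<lambda>u. hurwitz_entire_aux k z (t + u))"
proof -
  have "continuous_on {0..} (\<lambda>u. (case (z, t + u) of (z, t) \<Rightarrow> hurwitz_entire_aux k z t))"
    by (rule continuous_on_compose2[OF continuous_on_hurwitz_entire_aux[of k]])
       (use assms in \<open>auto intro!: continuous_intros\<close>)
  thus ?thesis by simp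
qed

lemma holomorphic_on_hurwitz_entire_aux:
  assumes "t \<ge> 0"
  shows "(\<lambda>z. hurwitz_entire_aux k z t) holomorphic_on {z. Re z > 1 - real k}"
  using assms
proof (induction k arbitrary: t)
  case 0
  have "(\<lambda>z. \<Sum>n. of_real (real (Suc n) + t) powr (-z)) holomorphic_on {z. Re z > 1}"
  proof (rule holomorphic_suminf)
    fix z :: complex assume z: "z \<in> {z. Re z > 1}"
    define r where "r = (Re z - 1) / 2"
    have r: "r > 0" "Re z - r > 1" using z by (auto simp: r_def field_simps)
    have "norm (complex_of_real (real (Suc n) + t) powr (- w)) \<le> real (Suc n) powr (-(Re z - r))"
      if "w \<in> cball z r" for w n
      using Re_cball_bounds[OF that] r 0 by (intro norm_hurwitz_term_le) auto
    thus "\<exists>r>0. \<exists>M. summable M \<and> (\<forall>\<^sub>F n in sequentially. \<forall>w\<in>cball z r \<inter> {z. Re z > 1}.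
        norm (complex_of_real (real (Suc n) + t) powr (- w)) \<le> M n)"
      using r summable_Suc_powr[OF r(2)] by (blast intro: always_eventually)
  qed (use 0 in \<open>auto intro!: holomorphic_intros open_halfspace_Re_gt\<close>)
  thus ?case by (auto intro!: holomorphic_intros)
next
  case (Suc k)
  let ?U = "{z. Re z > 1 - real (Suc k)}"
  let ?f = "\<lambda>z u. complex_of_real (1 - u) * hurwitz_entire_aux k (z + 1) (t + u)"
  have cont: "continuous_on {0..1} (?f z)" if "z \<in> ?U" for z
    using that Suc.prems
    by (intro continuous_intros continuous_on_subset[OF continuous_on_hurwitz_entire_aux_section]) auto
  have "(\<lambda>z. set_lebesgue_integral lborel {0..1} (?f z)) holomorphic_on ?U"
  proof (rule holomorphic_on_set_integral)
    show "(\<lambda>z. ?f z u) holomorphic_on ?U" if "u \<in> {0..1}" for u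
    proof (intro holomorphic_intros)
      have "(\<lambda>z. hurwitz_entire_aux k z (t + u)) \<circ> (\<lambda>z. z + 1) holomorphic_on ?U"
        by (rule holomorphic_on_compose_gen[OF _ Suc.IH[of "t + u"]])
           (use Suc.prems that in \<open>auto intro!: holomorphic_intros\<close>)
      thus "(\<lambda>z. hurwitz_entire_aux k (z + 1) (t + u)) holomorphic_on ?U"
        by (simp add: o_def)
    qed
    show "set_borel_measurable lborel {0..1} (?f z)" if "z \<in> ?U" for z
      using borel_measurable_continuous_on_indicator[OF _ cont[OF that]]
      by (simp add: set_borel_measurable_def)
    fix z assume z: "z \<in> ?U"
    obtain r where r: "r > 0" "cball z r \<subseteq> ?U"
      using z open_halfspace_Re_gt open_contains_cball by blast
    have "cball (z + 1) r \<subseteq> {z. Re z > 1 - real k}"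
    proof
      fix w assume "w \<in> cball (z + 1) r"
      hence "w - 1 \<in> cball z r" by (simp add: dist_norm algebra_simps)
      hence "w - 1 \<in> ?U" using r by blast
      thus "w \<in> {z. Re z > 1 - real k}" by simp
    qed
    hence "continuous_on (cball (z + 1) r \<times> {t..t+1}) (\<lambda>(z, t). hurwitz_entire_aux k z t)"
      using Suc.prems by (intro continuous_on_subset[OF continuous_on_hurwitz_entire_aux[of k]]) auto
    then obtain M where M: "\<And>w s. w \<in> cball (z + 1) r \<Longrightarrow> s \<in> {t..t+1} \<Longrightarrow> norm (hurwitz_entire_aux k w s) \<le> M"
      by (rule bounded_on_compact_Times) auto
    have "norm (?f w u) \<le> \<bar>M\<bar>" if "w \<in> cball z r" "u \<in> {0..1}" for w u
    proof -
      have "norm (?f w u) \<le> 1 * norm (hurwitz_entire_aux k (w + 1) (t + u))"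
        unfolding norm_mult using that by (intro mult_right_mono) (auto simp del: of_real_diff)
      also have "\<dots> \<le> M" using that by simp (intro M, auto simp: dist_norm)
      finally show ?thesis by simp
    qed
    moreover have "set_integrable lborel {0..1::real} (\<lambda>_. \<bar>M\<bar>)"
      by (simp add: set_integrable_def)
    ultimately show "\<exists>r>0. \<exists>h. set_integrable lborel {0..1} h \<and>
        (\<forall>w\<in>cball z r \<inter> ?U. \<forall>u\<in>{0..1}. norm (?f w u) \<le> h u)"
      using r by (intro exI[of _ r] conjI exI[of _ "\<lambda>_. \<bar>M\<bar>"]) auto
  qed (auto intro: open_halfspace_Re_gt)
  also have "?this \<longleftrightarrow> (\<lambda>z. integral {0..1} (?f z)) holomorphic_on ?U"
  proof (rule holomorphic_cong[OF refl])
    show "set_lebesgue_integral lborel {0..1} (?f z) = integral {0..1} (?f z)" if "z \<in> ?U" for z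
      by (intro set_borel_integral_eq_integral borel_integrable_atLeastAtMost' cont that)
  qed
  finally show ?case
    unfolding hurwitz_entire_aux.simps using Suc.prems by (intro holomorphic_intros) auto
qed

text \<open>
  The recursion for a single term \<open>a^(-z)\<close> of the Dirichlet series; the last two summands telescope
  when \<open>a\<close> runs through an arithmetic progression with difference 1.
\<close>

lemma hurwitz_term_integral:
  fixes z :: complex
  assumes a: "a > 0" and z: "z \<noteq> 1"
  shows "((\<lambda>u. of_real (1 - u) * (z * of_real (a + u) powr (-(z + 1)))) has_integral
           (of_real a powr (-z) + of_real (a + 1) powr (1 - z) / (z - 1)
              - of_real a powr (1 - z) / (z - 1))) {0..1}"
proof -
  let ?F = "\<lambda>u. - complex_of_real (1 - u) * complex_of_real (a + u) powr (-z) + complex_of_real (a + u) powr (1 - z) / (z - 1)"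
  have "((\<lambda>u. of_real (1 - u) * (z * of_real (a + u) powr (-(z + 1)))) has_integral ?F 1 - ?F 0) {0..1}"
  proof (rule fundamental_theorem_of_calculus)
    fix u :: real assume u: "u \<in> {0..1}"
    let ?G = "\<lambda>u::complex. - (1 - u) * (of_real a + u) powr (-z) + (of_real a + u) powr (1 - z) / (z - 1)"
    have nz: "complex_of_real a + of_real u \<notin> \<real>\<^sub>\<le>\<^sub>0"
      using a u by (auto simp: complex_nonpos_Reals_iff)
    let ?w = "complex_of_real u" and ?X = "complex_of_real a + of_real u"
    have P: "((\<lambda>w. (of_real a + w) powr c) has_field_derivative c * ?X powr (c - 1)) (at ?w)" for c
    proof -
      have "((\<lambda>w. complex_of_real a + w) has_field_derivative 1) (at ?w)"
        by (auto intro!: derivative_eq_intros)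
      from DERIV_chain2[OF has_field_derivative_powr[OF nz] this] show ?thesis by simp
    qed
    have "((\<lambda>w. - (1 - w)) has_field_derivative 1) (at ?w)"
      by (auto intro!: derivative_eq_intros)
    from DERIV_add[OF DERIV_mult[OF this P[of "-z"]] DERIV_cdivide[OF P[of "1 - z"], of "z - 1"]]
    have "(?G has_field_derivative (1 * ?X powr (-z) + - z * ?X powr (- z - 1) * - (1 - ?w)) +
            (1 - z) * ?X powr (1 - z - 1) / (z - 1)) (at ?w)" .
    also have "(1 - z) * ?X powr (1 - z - 1) / (z - 1) = - (?X powr (-z))"
      using z by (simp add: divide_simps) (simp add: algebra_simps)
    also have "1 * ?X powr (-z) + - z * ?X powr (- z - 1) * - (1 - ?w) + - (?X powr (-z)) =
        of_real (1 - u) * (z * of_real (a + u) powr (-(z + 1)))"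
      by (simp add: ring_distribs mult_ac)
    finally have "(?G has_field_derivative of_real (1 - u) * (z * of_real (a + u) powr (-(z + 1)))) (at ?w)" .
    from has_vector_derivative_real_field[OF this]
    show "(?F has_vector_derivative of_real (1 - u) * (z * of_real (a + u) powr (-(z + 1)))) (at u within {0..1})"
      by simp
  qed auto
  also have "?F 1 - ?F 0 = of_real a powr (-z) + of_real (a + 1) powr (1 - z) / (z - 1)
              - of_real a powr (1 - z) / (z - 1)"
    by simp
  finally show ?thesis .
qed

lemma tendsto_of_nat_powr_neg:
  assumes "Re z > 0" "t \<ge> 0"
  shows "(\<lambda>n. complex_of_real (real n + t) powr (-z)) \<longlonglongrightarrow> 0"
proof (rule Lim_null_comparison)
  show "\<forall>\<^sub>F n in sequentially. norm (complex_of_real (real n + t) powr (-z)) \<le> real n powr (- Re z)"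
    using eventually_gt_at_top[of 0]
  proof eventually_elim
    case (elim n)
    then obtain m where "n = Suc m" by (cases n) auto
    thus ?case using norm_hurwitz_term_le[of t "Re z" z m] assms by simp
  qed
  show "(\<lambda>n. real n powr (- Re z)) \<longlonglongrightarrow> 0"
    using assms by (intro tendsto_neg_powr filterlim_real_sequentially) auto
qed

text \<open>
  On the half-plane of convergence the first recursion step reproduces the Dirichlet series. By
  induction each further step then agrees with the previous one wherever both are defined.
\<close>

lemma hurwitz_entire_aux_Suc_0:
  assumes z: "Re z > 1" and t: "t \<ge> 0"
  shows "hurwitz_entire_aux (Suc 0) z t = hurwitz_entire_aux 0 z t"
proof -
  define a where "a n = real (Suc n) + t" for n
  have a: "a n > 0" "a (Suc n) = a n + 1" for n using t by (auto simp: a_def)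
  have z1: "z \<noteq> 1" using z by auto
  define f where "f = (\<lambda>N u. \<Sum>n<N. of_real (1 - u) * (z * complex_of_real (a n + u) powr (-(z + 1))))"
  define g where "g = (\<lambda>u. complex_of_real (1 - u) * hurwitz_entire_aux 0 (z + 1) (t + u))"
  have "uniform_limit {0..1} (\<lambda>N u. \<Sum>n<N. of_real (1 - u) * (z * complex_of_real (a n + u) powr (-(z + 1))))
          (\<lambda>u. \<Sum>n. of_real (1 - u) * (z * complex_of_real (a n + u) powr (-(z + 1)))) sequentially"
  proof (rule Weierstrass_m_test)
    show "summable (\<lambda>n. norm z * real (Suc n) powr (-2))"
      by (intro summable_mult summable_Suc_powr) auto
    fix n and u :: real assume u: "u \<in> {0..1}"
    have "norm (complex_of_real (1 - u) * (z * of_real (a n + u) powr (-(z + 1)))) \<le>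
            1 * (norm z * real (Suc n) powr (-2))"
      unfolding norm_mult
    proof (intro mult_mono)
      show "norm (complex_of_real (a n + u) powr (-(z + 1))) \<le> real (Suc n) powr (-2)"
        using norm_hurwitz_term_le[of "t + u" 2 "z + 1" n] u t z by (simp add: a_def add_ac)
    qed (use u in \<open>auto simp del: of_real_diff\<close>)
    thus "norm (complex_of_real (1 - u) * (z * of_real (a n + u) powr (-(z + 1)))) \<le>
            norm z * real (Suc n) powr (-2)" by simp
  qed
  also have "?this \<longleftrightarrow> uniform_limit {0..1} f g sequentially"
  proof (rule uniform_limit_cong')
    fix u :: real assume u: "u \<in> {0..1}"
    have "summable (\<lambda>n. complex_of_real (real (Suc n) + (t + u)) powr (-(z + 1)))"
      by (rule summable_hurwitz_terms) (use u t z in auto)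
    from suminf_mult[OF this, of z] suminf_mult[OF summable_mult[OF this, of z], of "of_real (1 - u)"]
    show "(\<Sum>n. of_real (1 - u) * (z * complex_of_real (a n + u) powr (-(z + 1)))) = g u"
      by (simp add: a_def g_def add_ac)
  qed (auto simp: f_def)
  finally have lim: "uniform_limit {0..1} f g sequentially" .
  have "0 \<le> a k + u" "a k + u \<noteq> 0" if "u \<in> {0..1}" for k u
    using a(1)[of k] that by auto
  hence "continuous_on {0..1} (f n)" for n
    unfolding f_def by (intro continuous_intros) (simp_all del: of_real_add add: subset_iff)
  then obtain I J where IJ: "\<And>n. (f n has_integral I n) {0..1}" "(g has_integral J) {0..1}" "I \<longlonglongrightarrow> J"
    using uniform_limit_integral[OF lim] by (metis sequentially_bot)
  let ?p = "\<lambda>n. complex_of_real (a n) powr (1 - z) / (z - 1)"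
  have I: "I N = (\<Sum>n<N. complex_of_real (a n) powr (-z)) - ?p 0 + ?p N" for N
  proof -
    have "(f N has_integral (\<Sum>n<N. complex_of_real (a n) powr (-z) + ?p (Suc n) - ?p n)) {0..1}"
      unfolding f_def a(2) by (intro has_integral_sum hurwitz_term_integral finite_lessThan a(1) z1)
    from has_integral_unique[OF IJ(1) this]
    have "I N = (\<Sum>n<N. complex_of_real (a n) powr (-z) + (?p (Suc n) - ?p n))"
      by (simp only: add_diff_eq)
    also have "\<dots> = (\<Sum>n<N. complex_of_real (a n) powr (-z)) + (?p N - ?p 0)"
      by (subst sum.distrib, subst sum_lessThan_telescope) simp
    finally show ?thesis by simp
  qed
  define S where "S = (\<Sum>n. complex_of_real (a n) powr (-z))"
  have "(\<lambda>n. complex_of_real (a n) powr (-z)) sums S"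
    unfolding S_def a_def by (rule summable_sums, rule summable_hurwitz_terms) (use z t in auto)
  moreover have "?p \<longlonglongrightarrow> 0 / (z - 1)"
  proof (intro tendsto_divide tendsto_const)
    have "(\<lambda>n. complex_of_real (real n + (1 + t)) powr (-(z - 1))) \<longlonglongrightarrow> 0"
      by (rule tendsto_of_nat_powr_neg) (use z t in auto)
    thus "(\<lambda>n. complex_of_real (a n) powr (1 - z)) \<longlonglongrightarrow> 0"
      by (simp add: a_def ac_simps)
  qed (use z1 in auto)
  ultimately have "(\<lambda>N. (\<Sum>n<N. complex_of_real (a n) powr (-z)) - ?p 0 + ?p N) \<longlonglongrightarrow> S - ?p 0 + 0 / (z - 1)"
    unfolding sums_def by (intro tendsto_add tendsto_diff tendsto_const)
  hence "I \<longlonglongrightarrow> S - ?p 0"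
    unfolding I[symmetric] by simp
  hence J: "J = S - ?p 0" using IJ(3) by (rule LIMSEQ_unique[rotated])
  have "integral {0..1} g = J" using IJ(2) by (rule integral_unique)
  hence "hurwitz_entire_aux (Suc 0) z t = of_real (1 + t) powr (1 - z) + (z - 1) * J"
    unfolding g_def by simp
  also have "\<dots> = (z - 1) * S"
    using z1 by (simp add: J a_def field_simps)
  finally show ?thesis by (simp add: S_def a_def)
qed

lemma hurwitz_entire_aux_Suc:
  assumes "Re z > 1 - real k" "t \<ge> 0"
  shows "hurwitz_entire_aux (Suc k) z t = hurwitz_entire_aux k z t"
  using assms
proof (induction k arbitrary: z t)
  case 0
  thus ?case using hurwitz_entire_aux_Suc_0 by simp
next
  case (Suc k)
  have "integral {0..1} (\<lambda>u. of_real (1 - u) * hurwitz_entire_aux (Suc k) (z + 1) (t + u)) =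
        integral {0..1} (\<lambda>u. of_real (1 - u) * hurwitz_entire_aux k (z + 1) (t + u))"
    by (intro integral_cong arg_cong2[of _ _ _ _ "(*)"] Suc.IH refl) (use Suc.prems in auto)
  thus ?case using Suc.prems by (simp only: hurwitz_entire_aux.simps(2))
qed

lemma hurwitz_entire_eq_aux:
  assumes "Re z > 1 - real k" "t \<ge> 0"
  shows "hurwitz_entire z t = hurwitz_entire_aux k z t"
proof -
  have le: "hurwitz_entire_aux (j + i) z t = hurwitz_entire_aux j z t" if "Re z > 1 - real j" for i j
    using that assms(2) by (induction i) (simp_all add: hurwitz_entire_aux_Suc del: hurwitz_entire_aux.simps)
  define j where "j = nat \<lceil>2 - Re z\<rceil>"
  have j: "Re z > 1 - real j" unfolding j_def by linarith
  show ?thesis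
  proof (cases "j \<le> k")
    case True
    thus ?thesis using le[OF j, of "k - j"] by (simp add: hurwitz_entire_def j_def)
  next
    case False
    thus ?thesis using le[OF assms(1), of "j - k"] by (simp add: hurwitz_entire_def flip: j_def)
  qed
qed

lemma holomorphic_on_hurwitz_entire: "t \<ge> 0 \<Longrightarrow> (\<lambda>z. hurwitz_entire z t) holomorphic_on UNIV"
proof -
  assume t: "t \<ge> 0"
  have "(\<lambda>z. hurwitz_entire z t) holomorphic_on {z. Re z > 1 - real k}" for k
    using holomorphic_on_hurwitz_entire_aux[OF t, of k]
    by (rule holomorphic_transform) (use t in \<open>simp add: hurwitz_entire_eq_aux\<close>)
  hence "(\<lambda>z. hurwitz_entire z t) holomorphic_on (\<Union>k. {z. Re z > 1 - real k})"
    by (intro holomorphic_on_UN_open) (auto simp: open_halfspace_Re_gt)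
  also have "(\<Union>k. {z. Re z > 1 - real k}) = UNIV"
  proof -
    have "z \<in> (\<Union>k. {w. Re w > 1 - real k})" for z
      by (rule UN_I[of "nat \<lceil>2 - Re z\<rceil>"]) (auto, linarith)
    thus ?thesis by blast
  qed
  finally show ?thesis .
qed

lemma continuous_on_hurwitz_entire: "continuous_on (UNIV \<times> {0..}) (\<lambda>(z, t). hurwitz_entire z t)"
proof (rule continuous_on_local_Re)
  fix z :: complex
  define k where "k = nat \<lceil>2 - Re z\<rceil>"
  have "Re z > 1 - real k" unfolding k_def by linarith
  thus "\<exists>V g. open V \<and> z \<in> V \<and> continuous_on ((UNIV \<inter> V) \<times> {0..}) g \<and>
             (\<forall>w\<in>UNIV \<inter> V. \<forall>t\<in>{0..}. (case (w, t) of (z, t) \<Rightarrow> hurwitz_entire z t) = g (w, t))"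
    using continuous_on_hurwitz_entire_aux[of k]
    by (intro exI[of _ "{z. Re z > 1 - real k}"] exI[of _ "\<lambda>(z, t). hurwitz_entire_aux k z t"])
       (auto simp: open_halfspace_Re_gt hurwitz_entire_eq_aux)
qed

lemma bounded_hurwitz_entire:
  assumes "compact Z"
  obtains M where "\<And>z t. z \<in> Z \<Longrightarrow> t \<in> {0..1} \<Longrightarrow> norm (hurwitz_entire z t) \<le> M"
proof -
  have "continuous_on (Z \<times> {0..1}) (\<lambda>(z, t). hurwitz_entire z t)"
    by (rule continuous_on_subset[OF continuous_on_hurwitz_entire]) auto
  thus ?thesis using bounded_on_compact_Times assms that by blast
qed

lemma hurwitz_entire_eq_series:
  assumes "Re z > 1" "t \<ge> 0"
  shows "hurwitz_entire z t = (z - 1) * (\<Sum>n. of_real (real (Suc n) + t) powr (-z))"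
  using hurwitz_entire_eq_aux[of 0 z t] assms by simp

lemma hurwitz_zeta_eq:
  assumes x: "x > 0" and z: "z \<noteq> 1"
  shows "hurwitz_zeta z x = of_real x powr (-z) + hurwitz_entire z x / (z - 1)"
proof -
  let ?P = "\<lambda>f. f holomorphic_on (UNIV - {1}) \<and>
     (\<forall>s. Re s > 1 \<longrightarrow> f s = (\<Sum>n. (of_nat n + of_real x) powr (-s)))"
  let ?f = "\<lambda>z. of_real x powr (-z) + hurwitz_entire z x / (z - 1)"
  have f: "?P ?f"
  proof (intro conjI allI impI)
    show "?f holomorphic_on UNIV - {1}"
      using x by (auto intro!: holomorphic_intros holomorphic_on_subset[OF holomorphic_on_hurwitz_entire])
    fix s :: complex assume s: "Re s > 1"
    have sm: "summable (\<lambda>n. (of_nat (Suc n) + complex_of_real x) powr (-s))"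
      using summable_hurwitz_terms[of x s] x s by simp
    hence "summable (\<lambda>n. (of_nat n + complex_of_real x) powr (-s))"
      by (subst (asm) summable_Suc_iff)
    hence "(\<Sum>n. (of_nat n + complex_of_real x) powr (-s)) =
        of_real x powr (-s) + (\<Sum>n. (of_nat (Suc n) + complex_of_real x) powr (-s))"
      by (subst suminf_split_head) simp_all
    thus "?f s = (\<Sum>n. (of_nat n + of_real x) powr (-s))"
      using x s by (auto simp: hurwitz_entire_eq_series)
  qed
  define h where "h = (SOME f. ?P f)"
  have h: "?P h" unfolding h_def by (rule someI[of ?P, OF f])
  have "h z = ?f z"
  proof (rule holomorphic_eq_of_real_eq[of h "UNIV - {1}" ?f 2 3])
    show "connected (UNIV - {1 :: complex})"
      using connected_punctured_universe[of "1 :: complex"] by (simp add: Compl_eq_Diff_UNIV)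
  qed (use h f z in auto)
  thus ?thesis by (simp add: hurwitz_zeta_def h_def)
qed

lemma riemann_zeta_eq_suminf:
  assumes "Re s > 1"
  shows "riemann_zeta s = (\<Sum>n. of_nat (Suc n) powr (-s))"
proof -
  let ?P = "\<lambda>f. f holomorphic_on (UNIV - {1}) \<and>
     (\<forall>s. Re s > 1 \<longrightarrow> f s = (\<Sum>n. complex_of_nat (Suc n) powr (-s)))"
  have "?P (\<lambda>z. hurwitz_entire z 0 / (z - 1))"
    by (auto intro!: holomorphic_intros holomorphic_on_subset[OF holomorphic_on_hurwitz_entire]
             simp: hurwitz_entire_eq_series)
  hence "?P riemann_zeta" unfolding riemann_zeta_def by (rule someI[of ?P])
  thus ?thesis using assms by blast
qed

section \<open>A cosine series for the hyperbolic cosine\<close>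

lemma has_integral_real_deriv:
  fixes F f :: "real \<Rightarrow> real"
  assumes "\<And>t. (F has_real_derivative f t) (at t)" "a \<le> b"
  shows "(f has_integral (F b - F a)) {a..b}"
  using assms
  by (intro fundamental_theorem_of_calculus)
     (auto simp: has_real_derivative_iff_has_vector_derivative intro: has_vector_derivative_at_within)

lemma sin_cos_2pi_of_int: "sin (2 * pi * of_int k) = 0" "cos (2 * pi * of_int k) = 1"
  using sin_int_2pin[of k] cos_int_2pin[of k] by (simp_all add: mult_ac)

text \<open>
  Multiplication by \<open>sin^2 (\<pi>t) = (1 - cos (2\<pi>t)) / 2\<close> turns one cosine into a combination of three
  neighbouring ones. Integer frequencies avoid a special case at zero.
\<close>

lemma cosine_moment_zero:
  fixes f :: "real \<Rightarrow> real" and k :: int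
  assumes f: "continuous_on {0..1} f"
    and mom: "\<And>n::nat. ((\<lambda>t. f t * cos (2 * pi * real n * t)) has_integral 0) {0..1}"
  shows "((\<lambda>t. f t * (sin (pi * t) ^ 2) ^ j * cos (2 * pi * of_int k * t)) has_integral 0) {0..1}"
proof (induction j arbitrary: k)
  case 0
  show ?case
  proof (cases "k \<ge> 0")
    case True
    thus ?thesis using mom[of "nat k"] by simp
  next
    case False
    have "cos (2 * pi * of_int k * t) = cos (2 * pi * real (nat (-k)) * t)" for t
      using False by (subst cos_minus [symmetric]) simp
    thus ?thesis using mom[of "nat (-k)"] by (simp only: power_0 mult_1_right)
  qed
next
  case (Suc j)
  let ?g = "\<lambda>k t. f t * (sin (pi * t) ^ 2) ^ j * cos (2 * pi * of_int k * t)"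
  have "((\<lambda>t. ?g k t / 2 - (?g (k + 1) t + ?g (k - 1) t) / 4) has_integral 0 / 2 - (0 + 0) / 4) {0..1}"
    by (intro has_integral_diff has_integral_add has_integral_divide Suc.IH)
  moreover have "?g k t / 2 - (?g (k + 1) t + ?g (k - 1) t) / 4 =
      f t * (sin (pi * t) ^ 2) ^ Suc j * cos (2 * pi * of_int k * t)" for t
  proof -
    define x where "x = 2 * pi * of_int k * t"
    have e: "2 * pi * of_int (k + 1) * t = x + 2 * (pi * t)" "2 * pi * of_int (k - 1) * t = x - 2 * (pi * t)"
      by (simp_all add: x_def algebra_simps)
    have c: "cos (x + 2 * (pi * t)) + cos (x - 2 * (pi * t)) = 2 * cos x * (1 - 2 * sin (pi * t) ^ 2)"
      by (simp add: cos_add cos_diff cos_double_sin)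
    have "?g k t / 2 - (?g (k + 1) t + ?g (k - 1) t) / 4 =
        f t * (sin (pi * t) ^ 2) ^ j * (cos x / 2 - (cos (x + 2 * (pi * t)) + cos (x - 2 * (pi * t))) / 4)"
      unfolding e x_def[symmetric] by (simp add: algebra_simps)
    also have "cos x / 2 - (cos (x + 2 * (pi * t)) + cos (x - 2 * (pi * t))) / 4 = sin (pi * t) ^ 2 * cos x"
      unfolding c by (simp add: field_simps)
    finally show ?thesis by (simp add: x_def)
  qed
  ultimately show ?case by simp
qed

text \<open>
  Completeness of the cosines: by the symmetry, \<open>f\<close> is a continuous function of
  \<open>s = sin (\<pi>t)^2 \<in> [0,1]\<close>. Approximating it uniformly by polynomials in \<open>s\<close>, to which \<open>f\<close> is
  orthogonal, makes the integral of \<open>f^2\<close> arbitrarily small.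
\<close>

lemma even_continuous_eq_0_of_cosine_coeffs:
  fixes f :: "real \<Rightarrow> real"
  assumes f: "continuous_on {0..1} f"
    and sym: "\<And>t. t \<in> {0..1} \<Longrightarrow> f (1 - t) = f t"
    and mom: "\<And>n::nat. ((\<lambda>t. f t * cos (2 * pi * real n * t)) has_integral 0) {0..1}"
    and t: "t \<in> {0..1}"
  shows "f t = 0"
proof -
  define \<phi> where "\<phi> s = f (arcsin (sqrt s) / pi)" for s
  have arc: "arcsin (sqrt s) / pi \<in> {0..1/2}" if "s \<in> {0..1}" for s
  proof -
    have "-1 \<le> sqrt s" using that by (intro order_trans[of "-1" 0 "sqrt s"]) auto
    hence "0 \<le> arcsin (sqrt s)" "arcsin (sqrt s) \<le> pi / 2"
      using that arcsin_le_arcsin[of 0 "sqrt s"] arcsin_bounded[of "sqrt s"]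
      by auto
    thus ?thesis by (auto simp: field_simps)
  qed
  have \<phi>: "f t = \<phi> (sin (pi * t) ^ 2)" if "t \<in> {0..1}" for t
  proof -
    have half: "f t = \<phi> (sin (pi * t) ^ 2)" if "t \<in> {0..1/2}" for t
    proof -
      have "pi * t \<le> pi * 1" using that by (intro mult_left_mono) auto
      hence "sin (pi * t) \<ge> 0" using that by (intro sin_ge_zero) auto
      moreover have "arcsin (sin (pi * t)) = pi * t"
      proof (rule arcsin_sin)
        show "pi * t \<le> pi / 2" using that by (auto simp: field_simps)
        show "- (pi / 2) \<le> pi * t" 
          using that by (intro order_trans[of "- (pi / 2)" 0 "pi * t"]) auto
      qed
      ultimately show ?thesis by (simp add: \<phi>_def)
    qed
    show ?thesis
    proof (cases "t \<le> 1/2")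
      case True
      thus ?thesis using half[of t] that by simp
    next
      case False
      have "f t = f (1 - t)" using sym that by simp
      also have "\<dots> = \<phi> (sin (pi * (1 - t)) ^ 2)" using False that by (intro half) auto
      also have "sin (pi * (1 - t)) = sin (pi * t)"
        by (simp add: right_diff_distrib sin_diff)
      finally show ?thesis .
    qed
  qed
  have \<phi>c: "continuous_on {0..1} \<phi>"
    unfolding \<phi>_def
  proof (rule continuous_on_compose2[OF f])
    show "continuous_on {0..1} (\<lambda>s. arcsin (sqrt s) / pi)"
      by (intro continuous_intros) (auto intro: order_trans[of _ 0])
    show "(\<lambda>s. arcsin (sqrt s) / pi) ` {0..1} \<subseteq> {0..1}"
    proof
      fix x assume "x \<in> (\<lambda>s. arcsin (sqrt s) / pi) ` {0..1}"
      hence "x \<in> {0..1/2}" using arc by blast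
      thus "x \<in> {0..1}" by simp
    qed
  qed
  define I where "I = integral {0..1} (\<lambda>t. f t ^ 2)"
  define J where "J = integral {0..1} (\<lambda>t. \<bar>f t\<bar>)"
  have sq: "(\<lambda>t. f t ^ 2) integrable_on {0..1}" and ab: "(\<lambda>t. \<bar>f t\<bar>) integrable_on {0..1}"
    by (intro integrable_continuous_real continuous_intros f)+
  have IJ: "I \<le> e * J" if e: "e > 0" for e
  proof -
    obtain p where p: "real_polynomial_function p" "\<And>x. x \<in> {0..1} \<Longrightarrow> \<bar>\<phi> x - p x\<bar> < e"
      using Stone_Weierstrass_real_polynomial_function[OF _ \<phi>c e] by auto
    then obtain a n where pa: "p = (\<lambda>x. \<Sum>i\<le>n. a i * x ^ i)"
      using real_polynomial_function_iff_sum by blast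
    have "((\<lambda>t. \<Sum>i\<le>n. a i * (f t * (sin (pi * t) ^ 2) ^ i * cos (2 * pi * of_int 0 * t))) has_integral
             (\<Sum>i\<le>n. a i * 0)) {0..1}"
      by (intro has_integral_sum has_integral_mult_right cosine_moment_zero f mom) auto
    hence fp: "((\<lambda>t. f t * p (sin (pi * t) ^ 2)) has_integral 0) {0..1}"
      by (simp add: pa sum_distrib_left mult_ac)
    have "((\<lambda>t. f t ^ 2 - f t * p (sin (pi * t) ^ 2)) has_integral I - 0) {0..1}"
      using sq fp unfolding I_def by (intro has_integral_diff integrable_integral)
    moreover have "((\<lambda>t. e * \<bar>f t\<bar>) has_integral e * J) {0..1}"
      using ab unfolding J_def by (intro has_integral_mult_right integrable_integral)
    ultimately have "I - 0 \<le> e * J"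
    proof (rule has_integral_le)
      fix t :: real assume t: "t \<in> {0..1}"
      have s: "sin (pi * t) ^ 2 \<in> {0..1}" by (auto simp: abs_square_le_1)
      have "f t ^ 2 - f t * p (sin (pi * t) ^ 2) = f t * (\<phi> (sin (pi * t) ^ 2) - p (sin (pi * t) ^ 2))"
        using \<phi>[OF t] by (simp add: power2_eq_square right_diff_distrib)
      also have "\<dots> \<le> \<bar>f t\<bar> * \<bar>\<phi> (sin (pi * t) ^ 2) - p (sin (pi * t) ^ 2)\<bar>"
        by (metis abs_ge_self abs_mult)
      also have "\<dots> \<le> \<bar>f t\<bar> * e" using p(2)[OF s] by (intro mult_left_mono) auto
      finally show "f t ^ 2 - f t * p (sin (pi * t) ^ 2) \<le> e * \<bar>f t\<bar>" by (simp add: mult_ac)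
    qed
    thus ?thesis by simp
  qed
  have J0: "J \<ge> 0" unfolding J_def by (intro integral_nonneg ab) auto
  have "I \<le> 0"
  proof (rule field_le_epsilon)
    fix e :: real assume "e > 0"
    hence "e / (J + 1) * J \<le> e" using J0 by (simp add: field_simps)
    thus "I \<le> 0 + e" using IJ[of "e / (J + 1)"] J0 \<open>e > 0\<close> by (simp add: divide_pos_pos add_nonneg_pos)
  qed
  moreover have "I \<ge> 0" unfolding I_def by (intro integral_nonneg sq) auto
  ultimately have "I = 0" by simp
  moreover have "continuous_on {0..1} (\<lambda>t. f t ^ 2)" by (intro continuous_intros f)
  ultimately have "f t ^ 2 = 0"
    using integral_eq_0_iff[of 0 1 "\<lambda>t. f t ^ 2"] t unfolding I_def by auto
  thus ?thesis by simp
qed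

lemma has_integral_cosh_cos:
  fixes y :: real
  assumes y: "y > 0"
  shows "((\<lambda>t. cosh (y * (1/2 - t)) * cos (2 * pi * real m * t)) has_integral
           2 * y * sinh (y / 2) / (y ^ 2 + (2 * pi * real m) ^ 2)) {0..1}"
proof -
  define b where "b = 2 * pi * real m"
  define D where "D = y ^ 2 + b ^ 2"
  have D: "D > 0" using y unfolding D_def by (intro add_pos_nonneg) auto
  let ?F = "\<lambda>t. (- y * sinh (y * (1/2 - t)) * cos (b * t) + b * cosh (y * (1/2 - t)) * sin (b * t)) / D"
  have "((\<lambda>t. cosh (y * (1/2 - t)) * cos (b * t)) has_integral ?F 1 - ?F 0) {0..1}"
  proof (rule has_integral_real_deriv)
    fix t
    have "(?F has_real_derivative (D * (cosh (y * (1/2 - t)) * cos (b * t))) / D) (at t)"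
      by (rule DERIV_cdivide) (auto intro!: derivative_eq_intros simp: D_def power2_eq_square algebra_simps)
    thus "(?F has_real_derivative cosh (y * (1/2 - t)) * cos (b * t)) (at t)"
      using D by simp
  qed auto
  moreover have "sin b = 0" "cos b = 1"
    using sin_cos_2pi_of_int[of "int m"] by (simp_all add: b_def)
  hence "?F 1 - ?F 0 = 2 * y * sinh (y / 2) / D"
    by (simp add: diff_divide_distrib[symmetric])
  ultimately show ?thesis by (simp add: b_def D_def)
qed

lemma has_integral_cos_cos:
  "((\<lambda>t. cos (2 * pi * real n * t) * cos (2 * pi * real m * t)) has_integral
     (if n = m then if n = 0 then 1 else 1/2 else 0)) {0..1}"
proof -
  have c: "((\<lambda>t. cos (2 * pi * of_int k * t)) has_integral (if k = 0 then 1 else 0)) {0..1}" for k :: int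
  proof (cases "k = 0")
    case True
    thus ?thesis using has_integral_const_real[of "1::real" 0 1] by simp
  next
    case False
    let ?F = "\<lambda>t. sin (2 * pi * of_int k * t) / (2 * pi * of_int k)"
    have "((\<lambda>t. cos (2 * pi * of_int k * t)) has_integral ?F 1 - ?F 0) {0..1}"
      using False by (intro has_integral_real_deriv) (auto intro!: derivative_eq_intros)
    thus ?thesis using False by (simp add: sin_cos_2pi_of_int)
  qed
  have "((\<lambda>t. (cos (2 * pi * of_int (int n + int m) * t) + cos (2 * pi * of_int (int n - int m) * t)) / 2)
      has_integral ((if int n + int m = 0 then 1 else 0) + (if int n - int m = 0 then 1 else 0)) / 2) {0..1}"
    by (intro has_integral_divide has_integral_add c)
  moreover have "cos (2 * pi * of_int (int n + int m) * t) + cos (2 * pi * of_int (int n - int m) * t)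
      = 2 * (cos (2 * pi * real n * t) * cos (2 * pi * real m * t))" for t
    by (simp add: ring_distribs cos_add cos_diff)
  ultimately have A: "((\<lambda>t. cos (2 * pi * real n * t) * cos (2 * pi * real m * t)) has_integral
      ((if int n + int m = 0 then 1 else 0) + (if int n - int m = 0 then 1 else 0)) / 2) {0..1}"
    by (simp only:) simp
  have B: "((if int n + int m = 0 then 1 else 0) + (if int n - int m = 0 then 1 else 0)) / 2 =
      (if n = m then if n = 0 then 1 else 1/2 else (0::real))" by auto
  show ?thesis using A unfolding B .
qed

lemma summable_inverse_quadratic: "summable (\<lambda>n. 1 / (y ^ 2 + (2 * pi * real (Suc n)) ^ 2))"
proof (rule summable_comparison_test'[OF summable_Suc_powr[of 2]])
  fix n
  have "1 * real (Suc n) ^ 2 \<le> y ^ 2 + (2 * pi) ^ 2 * real (Suc n) ^ 2"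
  proof -
    have "1 \<le> (2 * pi) ^ 2" using pi_ge_two by (intro one_le_power) simp
    hence "1 * real (Suc n) ^ 2 \<le> (2 * pi) ^ 2 * real (Suc n) ^ 2" by (intro mult_right_mono) auto
    also have "\<dots> \<le> y ^ 2 + (2 * pi) ^ 2 * real (Suc n) ^ 2" by simp
    finally show ?thesis .
  qed
  hence "1 / (y ^ 2 + (2 * pi * real (Suc n)) ^ 2) \<le> 1 / real (Suc n) ^ 2"
    by (intro divide_left_mono mult_pos_pos add_nonneg_pos) (auto simp: power_mult_distrib)
  thus "norm (1 / (y ^ 2 + (2 * pi * real (Suc n)) ^ 2)) \<le> real (Suc n) powr - 2"
    by (simp add: powr_minus divide_inverse abs_of_nonneg)
qed auto

text \<open>
  The cosine series on the right converges uniformly and has the same cosine coefficients as the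
  left-hand side, so that the two agree by completeness of the cosines.
\<close>

lemma cosh_cosine_series:
  fixes y t :: real
  assumes y: "y > 0" and t: "t \<in> {0..1}"
  shows "cosh (y * (1/2 - t)) = 2 * sinh (y / 2) / y +
     (\<Sum>n. 4 * y * sinh (y / 2) / (y ^ 2 + (2 * pi * real (Suc n)) ^ 2) * cos (2 * pi * real (Suc n) * t))"
proof -
  define c where "c n = (if n = 0 then 2 * sinh (y / 2) / y
                         else 4 * y * sinh (y / 2) / (y ^ 2 + (2 * pi * real n) ^ 2))" for n
  define T where "T n t = c n * cos (2 * pi * real n * t)" for n t
  have c_Suc: "c (Suc n) = 4 * y * sinh (y / 2) * (1 / (y ^ 2 + (2 * pi * real (Suc n)) ^ 2))" for n
    by (simp add: c_def)
  have sinh0: "sinh (y / 2) \<ge> 0" using y by simp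
  have c_nonneg: "c n \<ge> 0" for n using y sinh0 by (simp add: c_def)
  have "summable (\<lambda>n. c (Suc n))"
    unfolding c_Suc by (intro summable_mult summable_inverse_quadratic)
  hence c_summable: "summable c" by (subst (asm) summable_Suc_iff)
  have T_le: "norm (T n t) \<le> c n" for n t
    using c_nonneg[of n] by (simp add: T_def abs_mult mult_left_le)
  define S where "S t = (\<Sum>n. T n t)" for t
  have unif: "uniform_limit {0..1} (\<lambda>N t. \<Sum>n<N. T n t) S sequentially"
    unfolding S_def by (rule Weierstrass_m_test[OF T_le c_summable])
  have T_cont: "continuous_on {0..1} (T n)" for n
    unfolding T_def by (intro continuous_intros)
  have S_cont: "continuous_on {0..1} S"
    by (rule uniform_limit_theorem[OF _ unif])
       (auto intro!: continuous_intros T_cont always_eventually)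
  have S_int: "((\<lambda>t. S t * cos (2 * pi * real m * t)) has_integral
      2 * y * sinh (y / 2) / (y ^ 2 + (2 * pi * real m) ^ 2)) {0..1}" for m
  proof -
    define v where "v = (if m = 0 then c 0 else c m / 2)"
    have "uniform_limit {0..1} (\<lambda>N t. \<Sum>n<N. T n t * cos (2 * pi * real m * t))
            (\<lambda>t. \<Sum>n. T n t * cos (2 * pi * real m * t)) sequentially"
    proof (rule Weierstrass_m_test[OF _ c_summable])
      show "norm (T n t * cos (2 * pi * real m * t)) \<le> c n" for n t
        using mult_mono[OF T_le[of n t] abs_cos_le_one[of "2 * pi * real m * t"]] c_nonneg[of n]
        by (simp add: abs_mult)
    qed
    also have "(\<lambda>t. \<Sum>n. T n t * cos (2 * pi * real m * t)) = (\<lambda>t. S t * cos (2 * pi * real m * t))"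
      unfolding S_def
      by (intro ext suminf_mult2[symmetric] summable_comparison_test'[OF c_summable T_le])
    finally have ul: "uniform_limit {0..1} (\<lambda>N t. \<Sum>n<N. T n t * cos (2 * pi * real m * t))
        (\<lambda>t. S t * cos (2 * pi * real m * t)) sequentially" .
    obtain I J where IJ: "\<And>N. ((\<lambda>t. \<Sum>n<N. T n t * cos (2 * pi * real m * t)) has_integral I N) {0..1}"
        "((\<lambda>t. S t * cos (2 * pi * real m * t)) has_integral J) {0..1}" "I \<longlonglongrightarrow> J"
      by (rule uniform_limit_integral[OF ul]) (auto intro!: continuous_intros T_cont)
    have "I N = v" if "N > m" for N
    proof -
      have "((\<lambda>t. \<Sum>n<N. c n * (cos (2 * pi * real n * t) * cos (2 * pi * real m * t))) has_integral
          (\<Sum>n<N. c n * (if n = m then if n = 0 then 1 else 1/2 else 0))) {0..1}"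
        by (intro has_integral_sum has_integral_mult_right has_integral_cos_cos) auto
      hence "((\<lambda>t. \<Sum>n<N. T n t * cos (2 * pi * real m * t)) has_integral
          (\<Sum>n<N. c n * (if n = m then if n = 0 then 1 else 1/2 else 0))) {0..1}"
        by (simp add: T_def mult_ac)
      with IJ(1) have "I N = (\<Sum>n<N. c n * (if n = m then if n = 0 then 1 else 1/2 else 0))"
        using has_integral_unique by blast
      also have "\<dots> = (\<Sum>n<N. if n = m then v else 0)"
        by (intro sum.cong) (auto simp: v_def)
      also have "\<dots> = v" using that by simp
      finally show ?thesis .
    qed
    hence "I \<longlonglongrightarrow> v"
      by (intro tendsto_eventually eventually_mono[OF eventually_gt_at_top[of m]])
    hence "J = v" using IJ(3) LIMSEQ_unique by blast
    moreover have "v = 2 * y * sinh (y / 2) / (y ^ 2 + (2 * pi * real m) ^ 2)"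
    proof (cases "m = 0")
      case True
      thus ?thesis using y by (simp add: v_def c_def power2_eq_square)
    next
      case False
      have "4 * a / D / 2 = 2 * a / D" for a D :: real by simp
      from this[of "y * sinh (y / 2)" "y ^ 2 + (2 * pi * real m) ^ 2"] show ?thesis
        using False by (simp only: v_def c_def if_False mult.assoc)
    qed
    ultimately show ?thesis using IJ(2) by simp
  qed
  have "cosh (y * (1/2 - t)) - S t = 0"
  proof (rule even_continuous_eq_0_of_cosine_coeffs[OF _ _ _ t])
    show "continuous_on {0..1} (\<lambda>t. cosh (y * (1/2 - t)) - S t)"
      by (intro continuous_intros S_cont)
    show "((\<lambda>t. (cosh (y * (1/2 - t)) - S t) * cos (2 * pi * real n * t)) has_integral 0) {0..1}" for n
      using has_integral_diff[OF has_integral_cosh_cos[OF y, of n] S_int[of n]]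
      by (simp add: left_diff_distrib)
    fix t :: real
    have "T n (1 - t) = T n t" for n
    proof -
      have "cos (2 * pi * real n * (1 - t)) = cos (2 * pi * real_of_int (int n) - 2 * pi * real n * t)"
        by (simp add: algebra_simps)
      also have "\<dots> = cos (2 * pi * real n * t)"
        unfolding cos_diff sin_cos_2pi_of_int by simp
      finally show ?thesis by (simp add: T_def)
    qed
    moreover have "cosh (y * (1/2 - (1 - t))) = cosh (y * (1/2 - t))"
      using cosh_minus[of "y * (1/2 - t)"] by (simp add: algebra_simps)
    ultimately show "cosh (y * (1/2 - (1 - t))) - S (1 - t) = cosh (y * (1/2 - t)) - S t"
      by (simp add: S_def)
  qed
  hence "cosh (y * (1/2 - t)) = S t" by simp
  also have "S t = T 0 t + (\<Sum>n. T (Suc n) t)"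
    unfolding S_def using suminf_split_head[OF summable_comparison_test'[OF c_summable T_le[of _ t]]] by simp
  finally show ?thesis by (simp add: T_def c_def)
qed

text \<open>
  Subtracting the values at \<open>0\<close> and \<open>t\<close> leaves a series of nonnegative terms which vanish at both ends
  of the interval. They can therefore be integrated against \<open>\<pi> / sin (\<pi>t)\<close> term by term.
\<close>

lemma cosh_diff_sums:
  fixes y t :: real
  assumes y: "y > 0" and t: "t \<in> {0..1}"
  shows "(\<lambda>n. 4 * y * sinh (y / 2) / (y ^ 2 + (2 * pi * real (Suc n)) ^ 2) * (1 - cos (2 * pi * real (Suc n) * t)))
     sums (cosh (y / 2) - cosh (y * (1/2 - t)))"
proof -
  define c where "c n = 4 * y * sinh (y / 2) / (y ^ 2 + (2 * pi * real (Suc n)) ^ 2)" for n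
  have "c n = 4 * y * sinh (y / 2) * (1 / (y ^ 2 + (2 * pi * real (Suc n)) ^ 2))" for n
    by (simp add: c_def)
  hence c_summable: "summable c"
    using summable_mult[OF summable_inverse_quadratic] by presburger
  have c_nonneg: "c n \<ge> 0" for n using y by (simp add: c_def)
  have sm: "summable (\<lambda>n. c n * cos (2 * pi * real (Suc n) * t))" for t
    by (rule summable_comparison_test'[OF c_summable])
       (use c_nonneg in \<open>simp add: abs_mult mult_left_le del: of_nat_Suc\<close>)
  have "(\<lambda>n. c n * cos (2 * pi * real (Suc n) * 0) - c n * cos (2 * pi * real (Suc n) * t)) sums
          ((\<Sum>n. c n * cos (2 * pi * real (Suc n) * 0)) - (\<Sum>n. c n * cos (2 * pi * real (Suc n) * t)))"
    by (intro sums_diff summable_sums sm)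
  also have "(\<Sum>n. c n * cos (2 * pi * real (Suc n) * 0)) = cosh (y * (1/2 - 0)) - 2 * sinh (y / 2) / y"
    using cosh_cosine_series[OF y, of 0] by (simp add: c_def)
  also have "(\<Sum>n. c n * cos (2 * pi * real (Suc n) * t)) = cosh (y * (1/2 - t)) - 2 * sinh (y / 2) / y"
    using cosh_cosine_series[OF y t] by (simp only: c_def)
  finally show ?thesis
    by (simp add: c_def right_diff_distrib del: of_nat_Suc)
qed

section \<open>The weight log tan and its Laplace transform\<close>

definition logtan :: "real \<Rightarrow> real" where
  "logtan t = ln (tan (pi / 2 * t))"

lemma borel_measurable_logtan [measurable]: "logtan \<in> borel_measurable borel"
  unfolding logtan_def[abs_def] tan_def by measurable

lemma logtan_reflect: "logtan (1 - t) = - logtan t"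
proof -
  have "tan (pi / 2 * (1 - t)) = inverse (tan (pi / 2 * t))"
    using tan_cot[of "pi / 2 * t"] by (simp add: right_diff_distrib)
  thus ?thesis by (simp add: logtan_def ln_inverse)
qed

lemma ln_le_logtan:
  assumes "0 < t" "t < 1"
  shows "ln t \<le> logtan t"
proof -
  define x where "x = pi / 2 * t"
  have x: "0 < x" "x < pi / 2" using assms by (auto simp: x_def)
  have "t \<le> x" using assms pi_ge_two by (simp add: x_def field_simps)
  also have "x = arctan (tan x)" using x by (simp add: arctan_tan)
  also have "\<dots> \<le> tan x" using x tan_gt_zero[of x] by (intro arctan_le_self) auto
  finally show ?thesis using assms by (simp add: logtan_def x_def)
qed

lemma neg_ln_le_powr:
  fixes t e :: real
  assumes "0 < t" "t < 1" "e > 0"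
  shows "- ln t \<le> t powr (-e) / e"
proof -
  have "ln (1 / t) \<le> (1 / t) powr e / e" using assms by (intro ln_powr_bound) auto
  thus ?thesis using assms by (simp add: ln_div powr_divide powr_minus_divide)
qed

text \<open>
  The singularities at both ends are logarithmic, hence weaker than any power; the exponent \<open>e\<close> is
  chosen later according to the power that accompanies \<open>logtan\<close>.
\<close>

lemma abs_logtan_le:
  assumes "0 < t" "t < 1" "e > 0"
  shows "\<bar>logtan t\<bar> \<le> (t powr (-e) + (1 - t) powr (-e)) / e"
proof -
  have "\<bar>logtan t\<bar> \<le> - ln t - ln (1 - t)"
  proof -
    have "ln t < 0" "ln (1 - t) < 0" using assms by (auto intro!: ln_less_zero)
    moreover have "ln t \<le> logtan t" "ln (1 - t) \<le> - logtan t"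
      using assms ln_le_logtan[of t] ln_le_logtan[of "1 - t"] by (simp_all add: logtan_reflect)
    ultimately show ?thesis unfolding abs_le_iff by linarith
  qed
  also have "\<dots> \<le> t powr (-e) / e + (1 - t) powr (-e) / e"
    using neg_ln_le_powr[of t e] neg_ln_le_powr[of "1 - t" e] assms by simp
  finally show ?thesis by (simp add: add_divide_distrib)
qed

lemma set_integrable_powr_mult_powr:
  assumes "a < 1" "b < (1::real)"
  shows "set_integrable lborel {0<..<1} (\<lambda>t. t powr (-a) * (1 - t) powr (-b))"
proof (rule set_integrable_subset)
  show "set_integrable lborel {0..1} (\<lambda>t. t powr (-a) * (1 - t) powr (-b))"
    using integrable_Beta[of "1 - a" "1 - b"] assms by simp
qed auto

lemma set_integrable_powr_logtan:
  assumes a: "a < 1"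
  shows "set_integrable lborel {0<..<1} (\<lambda>t. t powr (-a) * \<bar>logtan t\<bar>)"
proof -
  \<comment> \<open>One bound makes \<open>t powr (-(a + e))\<close> integrable at 0, the other \<open>(1 - t) powr (-e)\<close> at 1.\<close>
  define e where "e = min ((1 - a) / 2) (1 / 2)"
  have e: "e > 0" "a + e < 1" "e < 1" using a by (auto simp: e_def min_def field_simps)
  show ?thesis
  proof (rule set_integrable_bound)
    show "set_integrable lborel {0<..<1}
            (\<lambda>t. (t powr (-(a + e)) * (1 - t) powr (-0) + t powr (-a) * (1 - t) powr (-e)) / e)"
      by (intro set_integrable_divide set_integral_add set_integrable_powr_mult_powr) (use e a in auto)
    show "AE t in lborel. t \<in> {0<..<1} \<longrightarrow> norm (t powr (-a) * \<bar>logtan t\<bar>) \<le>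
            norm ((t powr (-(a + e)) * (1 - t) powr (-0) + t powr (-a) * (1 - t) powr (-e)) / e)"
    proof (intro AE_I2 impI)
      fix t :: real assume t: "t \<in> {0<..<1}"
      have "t powr (-a) * \<bar>logtan t\<bar> \<le> t powr (-a) * ((t powr (-e) + (1 - t) powr (-e)) / e)"
        using t e by (intro mult_left_mono abs_logtan_le) auto
      also have "\<dots> = (t powr (-(a + e)) * (1 - t) powr (-0) + t powr (-a) * (1 - t) powr (-e)) / e"
        using t by (simp add: powr_diff powr_minus field_simps)
      finally show "norm (t powr (-a) * \<bar>logtan t\<bar>) \<le>
            norm ((t powr (-(a + e)) * (1 - t) powr (-0) + t powr (-a) * (1 - t) powr (-e)) / e)"
        using t e by (simp add: abs_mult)
    qed
  qed (simp add: set_borel_measurable_def)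
qed

lemma set_integrable_continuous_logtan:
  fixes f :: "real \<Rightarrow> 'a :: {banach, second_countable_topology, real_normed_div_algebra}"
  assumes f: "continuous_on {0..1} f"
  shows "set_integrable lborel {0<..<1} (\<lambda>t. f t * of_real (logtan t))"
proof -
  obtain M where M: "\<And>t. t \<in> {0..1} \<Longrightarrow> norm (f t) \<le> M"
    using compact_imp_bounded[OF compact_continuous_image[OF f]] unfolding bounded_iff by fastforce
  show ?thesis
  proof (rule set_integrable_bound)
    show "set_integrable lborel {0<..<1} (\<lambda>t. M * (t powr (-0) * \<bar>logtan t\<bar>))"
      by (intro set_integrable_mult_right set_integrable_powr_logtan) auto
    have "(\<lambda>t. indicator {0<..<1} t *\<^sub>R f t) \<in> borel_measurable borel"
      by (rule borel_measurable_continuous_on_indicator) (auto intro: continuous_on_subset[OF f])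
    hence "(\<lambda>t. (indicator {0<..<1} t *\<^sub>R f t) * of_real (logtan t)) \<in> borel_measurable lborel"
      by measurable
    thus "set_borel_measurable lborel {0<..<1} (\<lambda>t. f t * of_real (logtan t))"
      by (simp add: set_borel_measurable_def)
    show "AE t in lborel. t \<in> {0<..<1} \<longrightarrow> norm (f t * of_real (logtan t)) \<le>
            norm (M * (t powr (-0) * \<bar>logtan t\<bar>))"
      using order_trans[OF M abs_ge_self]
      by (intro AE_I2 impI) (auto simp: norm_mult abs_mult intro!: mult_right_mono)
  qed
qed

text \<open>
  The substitution \<open>x = \<pi>t/2\<close>, which moves all integrals to the unit interval.
\<close>

lemma
  fixes F :: "real \<Rightarrow> complex"
  shows set_integrable_logtan_scale:
    "set_integrable lborel {0<..<pi/2} (\<lambda>x. F (2 / pi * x) * of_real (ln (tan x))) \<longleftrightarrow>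
     set_integrable lborel {0<..<1} (\<lambda>t. F t * of_real (logtan t))"
  and set_integral_logtan_scale:
    "(LBINT x:{0<..<pi/2}. F (2 / pi * x) * of_real (ln (tan x))) =
     of_real (pi / 2) * (LBINT t:{0<..<1}. F t * of_real (logtan t))"
proof -
  define h where "h x = indicator {0<..<pi/2} x *\<^sub>R (F (2 / pi * x) * of_real (ln (tan x)))" for x :: real
  have h: "h (0 + pi / 2 * t) = indicator {0<..<1} t *\<^sub>R (F t * of_real (logtan t))" for t
  proof -
    have "pi / 2 * t \<in> {0<..<pi/2} \<longleftrightarrow> t \<in> {0<..<1}"
      by (auto simp: zero_less_mult_iff)
    thus ?thesis by (simp add: h_def logtan_def indicator_def)
  qed
  show "set_integrable lborel {0<..<pi/2} (\<lambda>x. F (2 / pi * x) * of_real (ln (tan x))) \<longleftrightarrow>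
     set_integrable lborel {0<..<1} (\<lambda>t. F t * of_real (logtan t))"
    using lborel_integrable_real_affine_iff[of "pi / 2" h 0]
    unfolding set_integrable_def h by (simp add: h_def[abs_def])
  show "(LBINT x:{0<..<pi/2}. F (2 / pi * x) * of_real (ln (tan x))) =
     of_real (pi / 2) * (LBINT t:{0<..<1}. F t * of_real (logtan t))"
    using lborel_integral_real_affine[of "pi / 2" h 0]
    unfolding set_lebesgue_integral_def h by (simp add: h_def[abs_def] scaleR_conv_of_real)
qed

lemma set_integral_odd_reflect:
  fixes f :: "real \<Rightarrow> real"
  assumes "\<And>t. f (1 - t) = - f t"
  shows "(LBINT t:{0<..<1}. f t) = 0"
proof -
  have "(LBINT t:{0<..<1}. f t) = (LBINT t. indicator {0<..<1} (1 + (-1) * t) *\<^sub>R f (1 + (-1) * t))"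
    unfolding set_lebesgue_integral_def using lborel_integral_real_affine[of "-1" _ 1] by simp
  also have "\<dots> = (LBINT t. - (indicator {0<..<1} t *\<^sub>R f t))"
    by (intro Bochner_Integration.integral_cong) (auto simp: assms indicator_def)
  finally show ?thesis unfolding set_lebesgue_integral_def by simp
qed

lemma has_integral_nonneg_imp_set_integrable:
  fixes f :: "real \<Rightarrow> real"
  assumes meas: "set_borel_measurable lborel A f" and A: "A \<in> sets borel"
    and nonneg: "\<And>x. x \<in> A \<Longrightarrow> f x \<ge> 0" and I: "(f has_integral I) A"
  shows "set_integrable lborel A f" and "(LBINT x:A. f x) = I"
proof -
  have "f absolutely_integrable_on A"
    using I nonneg by (subst absolutely_integrable_on_iff_nonneg) auto
  thus *: "set_integrable lborel A f"
    using meas unfolding set_integrable_def set_borel_measurable_def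
    by (subst (asm) integrable_completion) auto
  have "(LBINT x:A. f x) = integral A f"
    using * by (rule set_borel_integral_eq_integral)
  thus "(LBINT x:A. f x) = I" using I by (simp add: integral_unique)
qed

lemma sin_square_eq_sum: "sin (real n * x) ^ 2 = sin x * (\<Sum>k=1..n. sin ((2 * real k - 1) * x))"
proof (induction n)
  case (Suc n)
  have "sin (real (Suc n) * x) ^ 2 - sin (real n * x) ^ 2 =
      (sin (real (Suc n) * x) - sin (real n * x)) * (sin (real (Suc n) * x) + sin (real n * x))"
    by (simp add: power2_eq_square algebra_simps)
  also have "\<dots> = (2 * sin (x / 2) * cos ((2 * real n + 1) * x / 2)) *
                   (2 * sin ((2 * real n + 1) * x / 2) * cos (x / 2))"
    by (simp add: sin_diff_sin sin_plus_sin ring_distribs)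
       (simp add: add_divide_distrib diff_divide_distrib mult_ac)
  also have "\<dots> = (2 * sin (x / 2) * cos (x / 2)) *
      (2 * sin ((2 * real n + 1) * x / 2) * cos ((2 * real n + 1) * x / 2))"
    by (simp only: mult_ac)
  also have "2 * sin (x / 2) * cos (x / 2) = sin x"
    using sin_double[of "x / 2"] by simp
  also have "2 * sin ((2 * real n + 1) * x / 2) * cos ((2 * real n + 1) * x / 2) = sin ((2 * real n + 1) * x)"
    using sin_double[of "(2 * real n + 1) * x / 2"] by simp
  finally show ?case using Suc.IH by (simp add: algebra_simps)
qed simp

text \<open>
  The numbers \<open>h_n\<close> arise here: \<open>sin (n\<pi>t)^2 / sin (\<pi>t)\<close> is the sum of \<open>sin ((2k-1)\<pi>t)\<close> for
  \<open>k = 1, \<dots>, n\<close>, and the integral of each of these is \<open>2 / ((2k-1)\<pi>)\<close>.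
\<close>

lemma
  shows set_integrable_fejer: "set_integrable lborel {0<..<1}
      (\<lambda>t. (1 - cos (2 * pi * real n * t)) * (pi / sin (pi * t)))"
    and set_integral_fejer:
      "(LBINT t:{0<..<1}. (1 - cos (2 * pi * real n * t)) * (pi / sin (pi * t))) = 4 * odd_harm n"
proof -
  let ?f = "\<lambda>t. (1 - cos (2 * pi * real n * t)) * (pi / sin (pi * t))"
  have sinpos: "sin (pi * t) > 0" if "t \<in> {0<..<1}" for t
    using that by (intro sin_gt_zero) auto
  have nonneg: "?f t \<ge> 0" if "t \<in> {0<..<1}" for t
    using sinpos[OF that] by simp
  have eq: "2 * pi * (\<Sum>k=1..n. sin ((2 * real k - 1) * pi * t)) = ?f t" if "t \<in> {0<..<1}" for t
  proof -
    have "1 - cos (2 * pi * real n * t) = 2 * sin (real n * (pi * t)) ^ 2"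
      using cos_double_sin[of "real n * (pi * t)"] by (simp add: mult_ac)
    also have "\<dots> = 2 * sin (pi * t) * (\<Sum>k=1..n. sin ((2 * real k - 1) * pi * t))"
      by (subst sin_square_eq_sum) (simp add: mult_ac)
    finally show ?thesis using sinpos[OF that] by simp
  qed
  have trm: "((\<lambda>t. sin ((2 * real k - 1) * pi * t)) has_integral 2 / ((2 * real k - 1) * pi)) {0..1}"
    if k: "k \<in> {1..n}" for k
  proof -
    define b where "b = (2 * real k - 1) * pi"
    have b: "b > 0" using k by (simp add: b_def)
    have "((\<lambda>t. sin (b * t)) has_integral (- cos (b * 1) / b) - (- cos (b * 0) / b)) {0..1}"
      using b by (intro has_integral_real_deriv) (auto intro!: derivative_eq_intros)
    moreover have "cos b = -1"
    proof -
      have "cos b = cos (2 * pi * real_of_int (int k) - pi)" by (simp add: b_def algebra_simps)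
      thus ?thesis unfolding cos_diff sin_cos_2pi_of_int by simp
    qed
    ultimately show ?thesis using b by (simp add: b_def[symmetric])
  qed
  have "((\<lambda>t. 2 * pi * (\<Sum>k=1..n. sin ((2 * real k - 1) * pi * t))) has_integral
          2 * pi * (\<Sum>k=1..n. 2 / ((2 * real k - 1) * pi))) {0..1}"
    by (intro has_integral_mult_right has_integral_sum trm) auto
  also have "2 * pi * (\<Sum>k=1..n. 2 / ((2 * real k - 1) * pi)) = 4 * odd_harm n"
    unfolding odd_harm_def sum_distrib_left by (intro sum.cong refl) simp
  finally have "((\<lambda>t. 2 * pi * (\<Sum>k=1..n. sin ((2 * real k - 1) * pi * t))) has_integral 4 * odd_harm n) {0<..<1}"
    by (simp only: has_integral_Icc_iff_Ioo)
  hence I: "(?f has_integral 4 * odd_harm n) {0<..<1}"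
    by (rule has_integral_eq[OF eq, rotated])
  have "set_borel_measurable lborel {0<..<1} ?f"
    unfolding set_borel_measurable_def by measurable
  from has_integral_nonneg_imp_set_integrable[OF this _ nonneg I]
  show "set_integrable lborel {0<..<1} ?f" "(LBINT t:{0<..<1}. ?f t) = 4 * odd_harm n" by auto
qed

lemma logtan_has_derivative:
  assumes "0 < t" "t < 1"
  shows "(logtan has_real_derivative pi / sin (pi * t)) (at t)"
proof -
  define x where "x = pi / 2 * t"
  have x: "0 < x" "x < pi / 2" using assms by (auto simp: x_def)
  have c: "cos x > 0" "sin x > 0" "tan x > 0"
    using x by (auto intro: cos_gt_zero sin_gt_zero tan_gt_zero)
  have "sin (pi * t) = 2 * sin x * cos x"
    using sin_double[of x] by (simp add: x_def)
  moreover have "(logtan has_real_derivative (1 / tan x) * (inverse (cos x ^ 2) * (pi / 2))) (at t)"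
    unfolding logtan_def[abs_def] using c
    by (auto intro!: derivative_eq_intros simp: x_def)
  ultimately show ?thesis using c
    by (simp add: tan_def power2_eq_square field_simps)
qed

lemma
  fixes y :: real
  assumes y: "y > 0"
  defines "K \<equiv> \<lambda>t. cosh (y / 2) - cosh (y * (1/2 - t))"
  shows set_integrable_cosh_diff: "set_integrable lborel {0<..<1} (\<lambda>t. K t * (pi / sin (pi * t)))"
    and set_integral_cosh_diff: "(LBINT t:{0<..<1}. K t * (pi / sin (pi * t))) = 4 / pi ^ 2 * y * sinh (y / 2) * w_fun y"
proof -
  define c where "c n = 4 * y * sinh (y / 2) / (y ^ 2 + (2 * pi * real (Suc n)) ^ 2)" for n
  let ?f = "\<lambda>n t. c n * ((1 - cos (2 * pi * real (Suc n) * t)) * (pi / sin (pi * t)))"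
  have int: "set_integrable lborel {0<..<1} (?f n)" for n
    by (intro set_integrable_mult_right set_integrable_fejer)
  have nonneg: "?f n t \<ge> 0" if "t \<in> {0<..<1}" for n t
  proof -
    have "sin (pi * t) > 0" using that by (intro sin_gt_zero) auto
    thus ?thesis using y by (simp add: c_def)
  qed
  have sums: "(\<lambda>n. ?f n t) sums (K t * (pi / sin (pi * t)))" if "t \<in> {0<..<1}" for t
    unfolding K_def c_def mult.assoc[symmetric] using that by (intro sums_mult2 cosh_diff_sums y) auto
  have val: "(LBINT t:{0<..<1}. ?f n t) =
      4 / pi ^ 2 * y * sinh (y / 2) * (odd_harm (Suc n) / (real (Suc n) ^ 2 + (y / (2 * pi)) ^ 2))" for n
  proof -
    have "(LBINT t:{0<..<1}. ?f n t) = c n * (4 * odd_harm (Suc n))"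
      unfolding set_integral_mult_right set_integral_fejer ..
    also have "y ^ 2 + (2 * pi * real (Suc n)) ^ 2 =
        4 * pi ^ 2 * (real (Suc n) ^ 2 + (y / (2 * pi)) ^ 2)"
      by (simp add: power_mult_distrib power_divide distrib_left del: of_nat_Suc)
    hence "c n * (4 * odd_harm (Suc n)) = 4 / pi ^ 2 * y * sinh (y / 2) *
        (odd_harm (Suc n) / (real (Suc n) ^ 2 + (y / (2 * pi)) ^ 2))"
      unfolding c_def by (simp only:) simp
    finally show ?thesis .
  qed
  have vals: "(\<lambda>n. LBINT t:{0<..<1}. ?f n t) sums (4 / pi ^ 2 * y * sinh (y / 2) * w_fun y)"
    unfolding val w_fun_def by (intro sums_mult summable_sums summable_w_fun)
  note S = set_integrable_sums_nonneg set_integral_sums_nonneg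
  note S = S[OF int nonneg sums sums_summable[OF vals]]
  show "set_integrable lborel {0<..<1} (\<lambda>t. K t * (pi / sin (pi * t)))" by (rule S(1))
  show "(LBINT t:{0<..<1}. K t * (pi / sin (pi * t))) = 4 / pi ^ 2 * y * sinh (y / 2) * w_fun y"
    by (rule sums_unique2[OF S(2) vals])
qed

text \<open>
  The boundary terms in the integration by parts: a differentiable factor with zeros at both ends
  is \<open>O(t(1-t))\<close> and absorbs the singularities of \<open>logtan\<close>.
\<close>

lemma continuous_on_vanishing_mult_logtan:
  fixes K K' :: "real \<Rightarrow> real"
  assumes K: "\<And>t. (K has_real_derivative K' t) (at t)"
    and K': "continuous_on {0..1} K'" and ends: "K 0 = 0" "K 1 = 0"
  shows "continuous_on {0..1} (\<lambda>t. K t * logtan t)"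
proof -
  obtain M where M: "\<And>t. t \<in> {0..1} \<Longrightarrow> norm (K' t) \<le> M"
    using compact_imp_bounded[OF compact_continuous_image[OF K']] unfolding bounded_iff by fastforce
  have lip: "\<bar>K s - K t\<bar> \<le> M * \<bar>s - t\<bar>" if "s \<in> {0..1}" "t \<in> {0..1}" for s t
    using field_differentiable_bound[of "{0..1}" K K' M s t] M that K
    by (auto intro: has_field_derivative_at_within)
  have K_le: "\<bar>K t\<bar> \<le> 2 * M * (t * (1 - t))" if t: "t \<in> {0..1}" for t
  proof -
    have M0: "M \<ge> 0" using M[of 0] by auto
    have "\<bar>K t\<bar> \<le> M * min t (1 - t)"
      using lip[of t 0] lip[of t 1] t ends M0 by (auto simp: min_def abs_minus_commute)
    moreover have "min t (1 - t) \<le> 2 * (t * (1 - t))"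
    proof (cases "t \<le> 1/2")
      case True
      have "t * 1 \<le> t * (2 * (1 - t))" using True t by (intro mult_left_mono) auto
      thus ?thesis using True by (simp add: algebra_simps)
    next
      case False
      have "1 * (1 - t) \<le> 2 * t * (1 - t)" using False t by (intro mult_right_mono) auto
      thus ?thesis using False by simp
    qed
    from mult_left_mono[OF this M0] have "M * min t (1 - t) \<le> 2 * M * (t * (1 - t))"
      by (simp only: mult_ac)
    ultimately show ?thesis by (rule order_trans)
  qed
  define B where "B t = 4 * M * (sqrt t * (1 - t) + t * sqrt (1 - t))" for t
  have B: "\<bar>K t * logtan t\<bar> \<le> B t" if t: "t \<in> {0..1}" for t
  proof (cases "t = 0 \<or> t = 1")
    case True
    thus ?thesis using ends by (auto simp: B_def)
  next
    case False
    hence t: "0 < t" "t < 1" using t by auto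
    have "\<bar>K t * logtan t\<bar> \<le> (2 * M * (t * (1 - t))) * ((t powr (-1/2) + (1 - t) powr (-1/2)) / (1/2))"
      unfolding abs_mult using t K_le[of t] abs_logtan_le[of t "1/2"] by (intro mult_mono) auto
    also have "t powr (-1/2) = 1 / sqrt t"
      using t powr_minus_divide[of t "1/2"] by (simp add: powr_half_sqrt)
    also have "(1 - t) powr (-1/2) = 1 / sqrt (1 - t)"
      using t powr_minus_divide[of "1 - t" "1/2"] by (simp add: powr_half_sqrt)
    also have "(2 * M * (t * (1 - t))) * ((1 / sqrt t + 1 / sqrt (1 - t)) / (1/2)) =
        4 * M * (t / sqrt t * (1 - t) + t * ((1 - t) / sqrt (1 - t)))"
    proof -
      have "(2 * M * (t * (1 - t))) * ((a + b) / (1/2)) = 4 * M * (t * a * (1 - t) + t * ((1 - t) * b))" for a b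
        by (simp add: algebra_simps)
      from this[of "1 / sqrt t" "1 / sqrt (1 - t)"] show ?thesis by simp
    qed
    also have "t / sqrt t = sqrt t"
      using t by (simp add: real_div_sqrt)
    also have "(1 - t) / sqrt (1 - t) = sqrt (1 - t)"
      using t by (simp add: real_div_sqrt)
    finally show ?thesis by (simp add: B_def)
  qed
  have B_cont: "continuous_on {0..1} B"
    unfolding B_def by (intro continuous_intros)
  show ?thesis
    unfolding continuous_on_eq_continuous_within
  proof
    fix s :: real assume s: "s \<in> {0..1}"
    show "continuous (at s within {0..1}) (\<lambda>t. K t * logtan t)"
    proof (cases "s = 0 \<or> s = 1")
      case True
      have "(B \<longlongrightarrow> B s) (at s within {0..1})"
        using B_cont s by (auto simp: continuous_on_def)
      hence "(B \<longlongrightarrow> 0) (at s within {0..1})" using True by (auto simp: B_def)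
      hence "((\<lambda>t. K t * logtan t) \<longlongrightarrow> 0) (at s within {0..1})"
        by (rule Lim_null_comparison[rotated]) (use B in \<open>auto simp: eventually_at_filter\<close>)
      thus ?thesis using True ends by (auto simp: continuous_within)
    next
      case False
      hence "isCont (\<lambda>t. K t * logtan t) s"
        using s by (intro isCont_mult DERIV_isCont[OF K] DERIV_isCont[OF logtan_has_derivative]) auto
      thus ?thesis by (rule continuous_at_imp_continuous_at_within)
    qed
  qed
qed

text \<open>
  Write \<open>e^(-yt) = e^(-y/2) (sinh (y(1/2 - t)) + cosh (y(1/2 - t)))\<close>. The even part contributes
  nothing because \<open>logtan\<close> is odd about \<open>1/2\<close>; the odd part is integrated by parts.
\<close>

lemma laplace_logtan:
  fixes y :: real
  assumes y: "y > 0"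
  shows "(LBINT t:{0<..<1}. exp (- (y * t)) * logtan t) = - (2 / pi ^ 2) * (1 - exp (- y)) * w_fun y"
proof -
  define K where "K t = cosh (y / 2) - cosh (y * (1/2 - t))" for t
  define S where "S = (LBINT t:{0<..<1}. sinh (y * (1/2 - t)) * logtan t)"
  have K: "(K has_real_derivative y * sinh (y * (1/2 - t))) (at t)" for t
    unfolding K_def by (auto intro!: derivative_eq_intros)
  have int_sinh: "set_integrable lborel {0<..<1} (\<lambda>t. sinh (y * (1/2 - t)) * logtan t)"
    and int_cosh: "set_integrable lborel {0<..<1} (\<lambda>t. cosh (y * (1/2 - t)) * logtan t)"
    using set_integrable_continuous_logtan[of "\<lambda>t. sinh (y * (1/2 - t))"]
      set_integrable_continuous_logtan[of "\<lambda>t. cosh (y * (1/2 - t))"]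
    by (simp_all add: continuous_intros)
  note fej = set_integrable_cosh_diff[OF y, folded K_def] set_integral_cosh_diff[OF y, folded K_def]
  have int: "set_integrable lborel {0<..<1} (\<lambda>t. y * (sinh (y * (1/2 - t)) * logtan t) + K t * (pi / sin (pi * t)))"
    by (intro set_integral_add set_integrable_mult_right int_sinh fej)
  have "((\<lambda>t. y * (sinh (y * (1/2 - t)) * logtan t) + K t * (pi / sin (pi * t))) has_integral
          (K 1 * logtan 1 - K 0 * logtan 0)) {0..1}"
  proof (rule fundamental_theorem_of_calculus_interior)
    \<comment> \<open>The zeros of \<open>K\<close> cancel whatever value \<open>logtan\<close> takes at the two ends.\<close>
    have "K 1 = 0" unfolding K_def using cosh_minus[of "y / 2"] by simp
    thus "continuous_on {0..1} (\<lambda>t. K t * logtan t)"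
      by (intro continuous_on_vanishing_mult_logtan[OF K] continuous_intros) (auto simp: K_def)
    fix t :: real assume t: "t \<in> {0<..<1}"
    have "((\<lambda>t. K t * logtan t) has_real_derivative
            y * sinh (y * (1/2 - t)) * logtan t + pi / sin (pi * t) * K t) (at t)"
      using t by (intro DERIV_mult K logtan_has_derivative) auto
    thus "((\<lambda>t. K t * logtan t) has_vector_derivative
            y * (sinh (y * (1/2 - t)) * logtan t) + K t * (pi / sin (pi * t))) (at t)"
      by (simp add: has_real_derivative_iff_has_vector_derivative mult_ac)
  qed auto
  hence "((\<lambda>t. y * (sinh (y * (1/2 - t)) * logtan t) + K t * (pi / sin (pi * t))) has_integral 0) {0<..<1}"
    unfolding has_integral_Icc_iff_Ioo using cosh_minus[of "y / 2"] by (simp add: K_def)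
  hence "0 = (LBINT t:{0<..<1}. y * (sinh (y * (1/2 - t)) * logtan t) + K t * (pi / sin (pi * t)))"
    using set_borel_integral_eq_integral(2)[OF int] by (simp add: integral_unique)
  also have "\<dots> = y * S + 4 / pi ^ 2 * y * sinh (y / 2) * w_fun y"
    unfolding S_def using int_sinh fej by (subst set_integral_add) auto
  finally have "y * (S + 4 / pi ^ 2 * sinh (y / 2) * w_fun y) = 0"
    by (simp add: algebra_simps)
  hence S: "S = - (4 / pi ^ 2 * sinh (y / 2) * w_fun y)" using y by simp
  have "(LBINT t:{0<..<1}. exp (- (y * t)) * logtan t) =
        (LBINT t:{0<..<1}. exp (- (y / 2)) * (sinh (y * (1/2 - t)) * logtan t + cosh (y * (1/2 - t)) * logtan t))"
  proof (intro set_lebesgue_integral_cong allI impI)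
    fix t :: real
    have "exp (- (y * t)) = exp (- (y / 2)) * exp (y * (1/2 - t))"
      by (simp add: exp_add[symmetric] algebra_simps)
    also have "exp (y * (1/2 - t)) = sinh (y * (1/2 - t)) + cosh (y * (1/2 - t))"
      by (simp add: sinh_plus_cosh)
    finally show "exp (- (y * t)) * logtan t =
        exp (- (y / 2)) * (sinh (y * (1/2 - t)) * logtan t + cosh (y * (1/2 - t)) * logtan t)"
      by (simp add: algebra_simps)
  qed auto
  also have "\<dots> = exp (- (y / 2)) * (S + (LBINT t:{0<..<1}. cosh (y * (1/2 - t)) * logtan t))"
    unfolding S_def by (simp add: set_integral_add int_sinh int_cosh)
  also have "(LBINT t:{0<..<1}. cosh (y * (1/2 - t)) * logtan t) = 0"
  proof (rule set_integral_odd_reflect)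
    fix t
    have "cosh (y * (1/2 - (1 - t))) = cosh (y * (1/2 - t))"
      using cosh_minus[of "y * (1/2 - t)"] by (simp add: algebra_simps)
    thus "cosh (y * (1/2 - (1 - t))) * logtan (1 - t) = - (cosh (y * (1/2 - t)) * logtan t)"
      by (simp add: logtan_reflect)
  qed
  also have "exp (- (y / 2)) * (S + 0) = - (2 / pi ^ 2) * (exp (- (y / 2)) * (2 * sinh (y / 2))) * w_fun y"
    by (simp add: S)
  also have "exp (- (y / 2)) * (2 * sinh (y / 2)) = 1 - exp (- y)"
    by (simp add: sinh_def right_diff_distrib exp_add[symmetric])
  finally show ?thesis .
qed

section \<open>Mellin integrals of w against exponentials\<close>

lemma
  fixes f :: "real \<Rightarrow> real \<Rightarrow> real"
  assumes meas: "(\<lambda>(x, y). f x y) \<in> borel_measurable (borel \<Otimes>\<^sub>M borel)"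
    and A: "A \<in> sets borel" and B: "B \<in> sets borel"
    and inner: "\<And>x. x \<in> A \<Longrightarrow> set_integrable lborel B (f x)"
    and outer: "set_integrable lborel A (\<lambda>x. LBINT y:B. \<bar>f x y\<bar>)"
  shows set_integrable_Fubini: "set_integrable lborel B (\<lambda>y. LBINT x:A. f x y)"
    and set_integral_Fubini: "(LBINT y:B. LBINT x:A. f x y) = (LBINT x:A. LBINT y:B. f x y)"
proof -
  define F where "F x y = indicator A x * (indicator B y * f x y)" for x y
  have F_meas: "(\<lambda>(x, y). F x y) \<in> borel_measurable (lborel \<Otimes>\<^sub>M lborel)"
    unfolding F_def using meas A B by measurable
  have F: "integrable (lborel \<Otimes>\<^sub>M lborel) (\<lambda>(x, y). F x y)"
  proof (rule lborel_pair.Fubini_integrable[OF F_meas])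
    have "(\<lambda>x. LBINT y. norm (case (x, y) of (x, y) \<Rightarrow> F x y)) =
          (\<lambda>x. indicator A x *\<^sub>R (LBINT y:B. \<bar>f x y\<bar>))"
      by (auto simp: F_def set_lebesgue_integral_def abs_mult indicator_def intro!: ext
               Bochner_Integration.integral_cong)
    thus "integrable lborel (\<lambda>x. LBINT y. norm (case (x, y) of (x, y) \<Rightarrow> F x y))"
      using outer by (simp add: set_integrable_def)
    have "integrable lborel (F x)" for x
    proof (cases "x \<in> A")
      case True
      thus ?thesis using inner[OF True] by (simp add: F_def[abs_def] set_integrable_def)
    qed (simp add: F_def[abs_def])
    thus "AE x in lborel. integrable lborel (\<lambda>y. case (x, y) of (x, y) \<Rightarrow> F x y)"
      by simp
  qed
  have F1: "(LBINT x. F x y) = indicator B y *\<^sub>R (LBINT x:A. f x y)" for y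
    by (auto simp: F_def set_lebesgue_integral_def indicator_def intro!: Bochner_Integration.integral_cong)
  have F2: "(LBINT y. F x y) = indicator A x *\<^sub>R (LBINT y:B. f x y)" for x
    by (auto simp: F_def set_lebesgue_integral_def indicator_def intro!: Bochner_Integration.integral_cong)
  show "set_integrable lborel B (\<lambda>y. LBINT x:A. f x y)"
    using lborel_pair.integrable_snd[OF F] by (simp add: F1 set_integrable_def)
  show "(LBINT y:B. LBINT x:A. f x y) = (LBINT x:A. LBINT y:B. f x y)"
    using lborel_pair.Fubini_integral[OF F] by (simp add: F1 F2 set_lebesgue_integral_def)
qed

lemma
  fixes s c :: real
  assumes s: "s > 0" and c: "c > 0"
  shows set_integrable_Gamma_scaled: "set_integrable lborel {0<..} (\<lambda>y. y powr (s - 1) * exp (- (c * y)))"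
    and set_integral_Gamma_scaled: "(LBINT y:{0<..}. y powr (s - 1) * exp (- (c * y))) = Gamma s * c powr (-s)"
proof -
  let ?f = "\<lambda>t::real. t powr (s - 1) / exp t"
  have "((\<lambda>t. if t \<in> {0<..} then ?f t else 0) has_integral Gamma s) {0..}"
    by (rule has_integral_spike[of "{0}", OF _ _ Gamma_integral_real[OF s]]) auto
  hence I: "(?f has_integral Gamma s) {0<..}"
    by (subst (asm) has_integral_restrict) auto
  have "set_borel_measurable lborel {0<..} ?f"
    unfolding set_borel_measurable_def by measurable
  note base = has_integral_nonneg_imp_set_integrable[OF this _ _ I, simplified]
  define h where "h t = indicator {0<..} t *\<^sub>R ?f t" for t
  have h: "h (0 + c * t) = c powr (s - 1) * (indicator {0<..} t *\<^sub>R (t powr (s - 1) * exp (- (c * t))))" for t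
    using c by (auto simp: h_def indicator_def zero_less_mult_iff powr_mult exp_minus field_simps)
  have "integrable lborel (\<lambda>t. h (0 + c * t))"
    using base(1) c by (intro lborel_integrable_real_affine) (auto simp: set_integrable_def h_def)
  thus "set_integrable lborel {0<..} (\<lambda>y. y powr (s - 1) * exp (- (c * y)))"
    unfolding h set_integrable_def using c by simp
  have "Gamma s = integral\<^sup>L lborel h"
    using base(2) unfolding set_lebesgue_integral_def h_def[abs_def] by simp
  also have "\<dots> = c * (LBINT t. h (0 + c * t))"
    using c by (subst lborel_integral_real_affine[of c _ 0]) auto
  also have "\<dots> = c powr s * (LBINT y:{0<..}. y powr (s - 1) * exp (- (c * y)))"
  proof -
    have "c * (c powr (s - 1) * x) = c powr s * x" for x
      using c powr_mult_base[of c "s - 1"] by (simp flip: mult.assoc)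
    thus ?thesis unfolding h set_lebesgue_integral_def by simp
  qed
  finally show "(LBINT y:{0<..}. y powr (s - 1) * exp (- (c * y))) = Gamma s * c powr (-s)"
    using c by (simp add: powr_minus field_simps)
qed

lemma w_fun_nonneg: "w_fun y \<ge> 0"
  unfolding w_fun_def by (intro suminf_nonneg summable_w_fun divide_nonneg_nonneg odd_harm_nonneg) auto

lemma w_fun_le: "w_fun y \<le> w_fun 0"
  unfolding w_fun_def
proof (rule suminf_le[OF _ summable_w_fun summable_w_fun])
  show "odd_harm (Suc n) / (real (Suc n) ^ 2 + (y / (2 * pi)) ^ 2) \<le>
        odd_harm (Suc n) / (real (Suc n) ^ 2 + (0 / (2 * pi)) ^ 2)" for n
    by (intro divide_left_mono odd_harm_nonneg mult_pos_pos add_pos_nonneg) auto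
qed

lemma borel_measurable_w_fun [measurable]: "w_fun \<in> borel_measurable borel"
  unfolding w_fun_def[abs_def] by measurable

text \<open>
  Fubini for \<open>logtan t * y^(s-1) * e^(-(c+t)y)\<close>: integrating over \<open>y\<close> first gives a Gamma integral,
  integrating over \<open>t\<close> first gives the Laplace transform. The case \<open>c = 0\<close> is admitted and then
  requires \<open>s < 1\<close>, which the integrability hypothesis encodes.
\<close>

lemma
  fixes s c :: real
  assumes s: "s > 0" and c: "c \<ge> 0"
    and int: "set_integrable lborel {0<..<1} (\<lambda>t. (c + t) powr (-s) * \<bar>logtan t\<bar>)"
  shows set_integrable_mellin_laplace_logtan:
      "set_integrable lborel {0<..} (\<lambda>y. y powr (s - 1) * exp (- (c * y)) * (1 - exp (- y)) * w_fun y)"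
    and set_integral_mellin_laplace_logtan:
      "(LBINT y:{0<..}. y powr (s - 1) * exp (- (c * y)) * (1 - exp (- y)) * w_fun y) =
         - (pi ^ 2 / 2) * Gamma s * (LBINT t:{0<..<1}. (c + t) powr (-s) * logtan t)"
proof -
  define f where "f t y = logtan t * (y powr (s - 1) * exp (- ((c + t) * y)))" for t y
  have f_meas: "(\<lambda>(t, y). f t y) \<in> borel_measurable (borel \<Otimes>\<^sub>M borel)"
    unfolding f_def by measurable
  have inner: "set_integrable lborel {0<..} (f t)" if "t \<in> {0<..<1}" for t
    unfolding f_def using that c s by (intro set_integrable_mult_right set_integrable_Gamma_scaled) auto
  have v: "(LBINT y:{0<..}. y powr (s - 1) * exp (- ((c + t) * y))) = Gamma s * (c + t) powr (-s)"
    if "t \<in> {0<..<1}" for t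
    using that c s by (intro set_integral_Gamma_scaled) auto
  have abs_v: "(LBINT y:{0<..}. \<bar>f t y\<bar>) = Gamma s * ((c + t) powr (-s) * \<bar>logtan t\<bar>)"
    if "t \<in> {0<..<1}" for t
    using v[OF that] by (simp add: f_def abs_mult)
  have outer: "set_integrable lborel {0<..<1} (\<lambda>t. LBINT y:{0<..}. \<bar>f t y\<bar>)"
    using set_integrable_mult_right[OF int, of "Gamma s"]
    by (subst set_integrable_cong[OF refl refl abs_v]) auto
  have L: "(LBINT t:{0<..<1}. f t y) =
      - (2 / pi ^ 2) * (y powr (s - 1) * exp (- (c * y)) * (1 - exp (- y)) * w_fun y)" if y: "y \<in> {0<..}" for y
  proof -
    have "y > 0" using y by simp
    have "(LBINT t:{0<..<1}. f t y) =
        (LBINT t:{0<..<1}. (y powr (s - 1) * exp (- (c * y))) * (exp (- (y * t)) * logtan t))"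
      unfolding f_def
      by (intro set_lebesgue_integral_cong) (auto simp: exp_add[symmetric] algebra_simps)
    also have "\<dots> = (y powr (s - 1) * exp (- (c * y))) * (- (2 / pi ^ 2) * (1 - exp (- y)) * w_fun y)"
      using laplace_logtan[OF \<open>y > 0\<close>] by (simp only: set_integral_mult_right)
    finally show ?thesis by (simp only: mult_ac)
  qed
  have "set_integrable lborel {0<..} (\<lambda>y. - (2 / pi ^ 2) *
          (y powr (s - 1) * exp (- (c * y)) * (1 - exp (- y)) * w_fun y))"
    by (rule iffD1[OF set_integrable_cong[OF refl refl L] set_integrable_Fubini[OF f_meas _ _ inner outer]]) auto
  thus "set_integrable lborel {0<..} (\<lambda>y. y powr (s - 1) * exp (- (c * y)) * (1 - exp (- y)) * w_fun y)"
    by (subst (asm) set_integrable_mult_right_iff) auto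
  have "(LBINT y:{0<..}. LBINT t:{0<..<1}. f t y) = - (2 / pi ^ 2) *
      (LBINT y:{0<..}. y powr (s - 1) * exp (- (c * y)) * (1 - exp (- y)) * w_fun y)"
    by (subst set_integral_mult_right[symmetric], intro set_lebesgue_integral_cong) (auto simp: L)
  moreover have "(LBINT t:{0<..<1}. LBINT y:{0<..}. f t y) =
      Gamma s * (LBINT t:{0<..<1}. (c + t) powr (-s) * logtan t)"
    by (subst set_integral_mult_right[symmetric], intro set_lebesgue_integral_cong) (auto simp: v f_def[abs_def])
  ultimately have "- (2 / pi ^ 2) *
      (LBINT y:{0<..}. y powr (s - 1) * exp (- (c * y)) * (1 - exp (- y)) * w_fun y) =
      Gamma s * (LBINT t:{0<..<1}. (c + t) powr (-s) * logtan t)"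
    using set_integral_Fubini[OF f_meas _ _ inner outer] by simp
  thus "(LBINT y:{0<..}. y powr (s - 1) * exp (- (c * y)) * (1 - exp (- y)) * w_fun y) =
         - (pi ^ 2 / 2) * Gamma s * (LBINT t:{0<..<1}. (c + t) powr (-s) * logtan t)"
    by (simp add: field_simps)
qed

text \<open>
  Sum of the previous identity over \<open>c = 1, 2, \<dots>\<close>. On the side of \<open>w\<close> the factors \<open>e^(-cy)\<close> form a
  geometric series which cancels \<open>1 - e^(-y)\<close> up to \<open>e^(-y)\<close>; the terms are nonnegative there, so
  summability of their integrals can be read off from the other side.
\<close>

lemma set_integral_powr_exp_w:
  fixes s :: real
  assumes s: "s > 1"
  shows "(LBINT y:{0<..}. y powr (s - 1) * exp (- y) * w_fun y) =
     - (pi ^ 2 / 2) * Gamma s * (LBINT t:{0<..<1}. (\<Sum>n. (real (Suc n) + t) powr (-s)) * logtan t)"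
proof -
  define I where "I = (LBINT t:{0<..<1}. \<bar>logtan t\<bar>)"
  have abs_int: "set_integrable lborel {0<..<1} (\<lambda>t. \<bar>logtan t\<bar>)"
    using set_integrable_abs[OF set_integrable_continuous_logtan[of "\<lambda>_. 1 :: real"]] by simp
  define a where "a n t = indicator {0<..<1} t *\<^sub>R ((real (Suc n) + t) powr (-s) * logtan t)" for n and t :: real
  have le: "(real (Suc n) + t) powr (-s) \<le> real (Suc n) powr (-s)" if "t \<in> {0<..<1}" for n t
    using that s by (intro powr_mono2') auto
  have int: "set_integrable lborel {0<..<1} (\<lambda>t. (real (Suc n) + t) powr (-s) * \<bar>logtan t\<bar>)" for n
  proof (rule set_integrable_bound)
    show "set_integrable lborel {0<..<1} (\<lambda>t. real (Suc n) powr (-s) * \<bar>logtan t\<bar>)"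
      by (intro set_integrable_mult_right abs_int)
    show "AE t in lborel. t \<in> {0<..<1} \<longrightarrow> norm ((real (Suc n) + t) powr (-s) * \<bar>logtan t\<bar>)
             \<le> norm (real (Suc n) powr (-s) * \<bar>logtan t\<bar>)"
      using le by (intro AE_I2 impI) (auto simp: abs_mult intro!: mult_right_mono)
  qed (simp add: set_borel_measurable_def)
  have a_int: "integrable lborel (a n)" for n
  proof -
    have "integrable lborel (\<lambda>t. norm (a n t))"
      using int[of n] by (simp add: a_def set_integrable_def abs_mult)
    thus ?thesis by (subst (asm) integrable_norm_iff) (simp add: a_def[abs_def])
  qed
  have a_norm: "(LBINT t. norm (a n t)) \<le> real (Suc n) powr (-s) * I" for n
  proof -
    have "(LBINT t. norm (a n t)) = (LBINT t:{0<..<1}. (real (Suc n) + t) powr (-s) * \<bar>logtan t\<bar>)"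
      by (simp add: a_def set_lebesgue_integral_def abs_mult)
    also have "\<dots> \<le> (LBINT t:{0<..<1}. real (Suc n) powr (-s) * \<bar>logtan t\<bar>)"
      by (intro set_integral_mono int set_integrable_mult_right abs_int mult_right_mono le) auto
    finally show ?thesis by (simp add: I_def)
  qed
  have a_sum: "summable (\<lambda>n. LBINT t. norm (a n t))"
    by (rule summable_comparison_test'[OF summable_mult2[OF summable_Suc_powr[OF s], of I]])
       (use a_norm in \<open>auto intro!: integral_nonneg_AE\<close>)
  have pow_sum: "summable (\<lambda>n. (real (Suc n) + t) powr (-s))" if "t \<in> {0<..<1}" for t
    by (rule summable_comparison_test'[OF summable_Suc_powr[OF s]]) (use le[OF that] in auto)
  have a_ptw: "AE t in lborel. summable (\<lambda>n. norm (a n t))"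
  proof (intro AE_I2)
    fix t show "summable (\<lambda>n. norm (a n t))"
    proof (cases "t \<in> {0<..<1}")
      case True
      thus ?thesis using summable_mult2[OF pow_sum[OF True], of "\<bar>logtan t\<bar>"]
        by (simp add: a_def abs_mult)
    qed (simp add: a_def)
  qed
  have a_lim: "(\<Sum>n. a n t) = indicator {0<..<1} t *\<^sub>R ((\<Sum>n. (real (Suc n) + t) powr (-s)) * logtan t)" for t
  proof (cases "t \<in> {0<..<1}")
    case True
    thus ?thesis using suminf_mult2[OF pow_sum[OF True], of "logtan t"] by (simp add: a_def)
  qed (simp add: a_def)
  have A: "(\<lambda>n. integral\<^sup>L lborel (a n)) sums
             (LBINT t:{0<..<1}. (\<Sum>n. (real (Suc n) + t) powr (-s)) * logtan t)"
    using sums_integral[OF a_int a_ptw a_sum] by (simp add: a_lim set_lebesgue_integral_def)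
  define b where "b n y = y powr (s - 1) * exp (- (real (Suc n) * y)) * (1 - exp (- y)) * w_fun y" for n y
  have b_int: "set_integrable lborel {0<..} (b n)" for n
    unfolding b_def using s by (intro set_integrable_mellin_laplace_logtan int) auto
  have b_nonneg: "b n y \<ge> 0" if "y \<in> {0<..}" for n y
    using w_fun_nonneg that by (simp add: b_def)
  have b_sums: "(\<lambda>n. b n y) sums (y powr (s - 1) * exp (- y) * w_fun y)" if y: "y \<in> {0<..}" for y
  proof -
    have e: "exp (- (real (Suc n) * y)) = exp (- y) * exp (- y) ^ n" for n
      by (simp add: exp_of_nat_mult[symmetric] exp_add[symmetric] algebra_simps)
    have "(\<lambda>n. exp (- y) ^ n) sums (1 / (1 - exp (- y)))"
      using y by (intro geometric_sums) auto
    from sums_mult[OF this, of "y powr (s - 1) * exp (- y) * (1 - exp (- y)) * w_fun y"]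
    show ?thesis using y unfolding b_def e by (simp add: mult_ac)
  qed
  have b_val: "(LBINT y:{0<..}. b n y) = - (pi ^ 2 / 2) * Gamma s * integral\<^sup>L lborel (a n)" for n
    using set_integral_mellin_laplace_logtan[OF _ _ int[of n]] s
    by (simp add: set_lebesgue_integral_def b_def a_def[abs_def])
  have vals: "(\<lambda>n. LBINT y:{0<..}. b n y) sums
      (- (pi ^ 2 / 2) * Gamma s * (LBINT t:{0<..<1}. (\<Sum>n. (real (Suc n) + t) powr (-s)) * logtan t))"
    unfolding b_val by (rule sums_mult[OF A])
  show ?thesis
    by (rule sums_unique2[OF set_integral_sums_nonneg[OF b_int b_nonneg b_sums sums_summable[OF vals]] vals])
qed

section \<open>The Mellin transform of w\<close>

text \<open>
  Euler's integral for \<open>\<Gamma>(a) \<Gamma>(1-a)\<close>, from \<open>1/(1+p) = \<integral> e^(-(1+p)v) dv\<close> and Fubini.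
\<close>

lemma
  fixes a :: real
  assumes a: "0 < a" "a < 1"
  shows set_integrable_powr_div_1_plus: "set_integrable lborel {0<..} (\<lambda>p. p powr (a - 1) / (1 + p))"
    and set_integral_powr_div_1_plus: "(LBINT p:{0<..}. p powr (a - 1) / (1 + p)) = pi / sin (pi * a)"
proof -
  define f where "f v p = exp (- v) * (p powr (a - 1) * exp (- (v * p)))" for v p :: real
  have f_meas: "(\<lambda>(v, p). f v p) \<in> borel_measurable (borel \<Otimes>\<^sub>M borel)"
    unfolding f_def by measurable
  have inner: "set_integrable lborel {0<..} (f v)" if "v \<in> {0<..}" for v
    unfolding f_def using that a by (intro set_integrable_mult_right set_integrable_Gamma_scaled) auto
  have v: "(LBINT p:{0<..}. f v p) = Gamma a * (v powr ((1 - a) - 1) * exp (- (1 * v)))" if "v \<in> {0<..}" for v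
  proof -
    have "(LBINT p:{0<..}. f v p) = exp (- v) * (Gamma a * v powr (-a))"
      unfolding f_def set_integral_mult_right
      using that a by (subst set_integral_Gamma_scaled) auto
    thus ?thesis by simp
  qed
  have abs_v: "(LBINT p:{0<..}. \<bar>f v p\<bar>) = Gamma a * (v powr ((1 - a) - 1) * exp (- (1 * v)))"
    if "v \<in> {0<..}" for v
    using v[OF that] by (simp add: f_def abs_mult)
  have outer: "set_integrable lborel {0<..} (\<lambda>v. LBINT p:{0<..}. \<bar>f v p\<bar>)"
    by (subst set_integrable_cong[OF refl refl abs_v], assumption)
       (intro set_integrable_mult_right set_integrable_Gamma_scaled, use a in auto)
  have L: "(LBINT v:{0<..}. f v p) = p powr (a - 1) / (1 + p)" if p: "p \<in> {0<..}" for p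
  proof -
    have "(LBINT v:{0<..}. f v p) = (LBINT v:{0<..}. p powr (a - 1) * (v powr (1 - 1) * exp (- ((1 + p) * v))))"
      unfolding f_def using p
      by (intro set_lebesgue_integral_cong) (auto simp: exp_add[symmetric] algebra_simps)
    also have "\<dots> = p powr (a - 1) * (Gamma 1 * (1 + p) powr (-1))"
      unfolding set_integral_mult_right using p by (subst set_integral_Gamma_scaled) auto
    finally show ?thesis using p by (simp add: powr_minus divide_inverse)
  qed
  show "set_integrable lborel {0<..} (\<lambda>p. p powr (a - 1) / (1 + p))"
    by (rule iffD1[OF set_integrable_cong[OF refl refl L] set_integrable_Fubini[OF f_meas _ _ inner outer]]) auto
  have "(LBINT p:{0<..}. p powr (a - 1) / (1 + p)) = (LBINT p:{0<..}. LBINT v:{0<..}. f v p)"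
    by (intro set_lebesgue_integral_cong) (auto simp: L)
  also have "\<dots> = (LBINT v:{0<..}. LBINT p:{0<..}. f v p)"
    by (rule set_integral_Fubini[OF f_meas _ _ inner outer]) auto
  also have "\<dots> = (LBINT v:{0<..}. Gamma a * (v powr ((1 - a) - 1) * exp (- (1 * v))))"
    by (intro set_lebesgue_integral_cong allI impI v) auto
  also have "\<dots> = Gamma a * Gamma (1 - a)"
    unfolding set_integral_mult_right using a by (subst set_integral_Gamma_scaled) auto
  also have "\<dots> = pi / sin (pi * a)"
  proof -
    have "complex_of_real (Gamma a * Gamma (1 - a)) = of_real (pi / sin (pi * a))"
      using Gamma_reflection_complex[of "of_real a"]
      by (simp add: Gamma_complex_of_real[symmetric] sin_of_real[symmetric])
    thus ?thesis by (simp only: of_real_eq_iff)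
  qed
  finally show "(LBINT p:{0<..}. p powr (a - 1) / (1 + p)) = pi / sin (pi * a)" .
qed

text \<open>
  The previous integral under the substitution \<open>u = sqrt p\<close>.
\<close>

lemma
  fixes s :: real
  assumes s: "0 < s" "s < 2"
  shows set_integrable_powr_div_1_plus_square: "set_integrable lborel {0<..} (\<lambda>u. u powr (s - 1) / (1 + u ^ 2))"
    and set_integral_powr_div_1_plus_square:
      "(LBINT u:{0<..}. u powr (s - 1) / (1 + u ^ 2)) = pi / (2 * sin (pi * s / 2))"
proof -
  define f where "f u = u powr (s - 1) / (1 + u ^ 2)" for u :: real
  have fg: "f (sqrt p) * (inverse (sqrt p) / 2) = 1 / 2 * (p powr (s / 2 - 1) / (1 + p))" if "p > 0" for p
  proof -
    have "f (sqrt p) * (inverse (sqrt p) / 2) = sqrt p powr (s - 1) * sqrt p powr (-1) / (1 + p) / 2"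
      using that by (simp add: f_def powr_minus)
    also have "sqrt p powr (s - 1) * sqrt p powr (-1) = p powr (s / 2 - 1)"
    proof -
      have "sqrt p = p powr (1/2)" using that by (simp add: powr_half_sqrt)
      hence "sqrt p powr (s - 1) * sqrt p powr (-1) = (p powr (1/2)) powr (s - 1) * (p powr (1/2)) powr (-1)"
        by simp
      also have "(p powr (1/2)) powr (s - 1) * (p powr (1/2)) powr (-1) = p powr (1/2 * (s - 1) + 1/2 * (-1))"
        by (simp only: powr_powr powr_add)
      also have "1/2 * (s - 1) + 1/2 * (-1) = s / 2 - 1" by (simp add: field_simps)
      finally show ?thesis .
    qed
    finally show ?thesis using that by (simp add: field_simps)
  qed
  have int: "set_integrable lborel {0<..} (\<lambda>p. f (sqrt p) * (inverse (sqrt p) / 2))"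
  proof -
    have "set_integrable lborel {0<..} (\<lambda>p. 1 / 2 * (p powr (s / 2 - 1) / (1 + p)))"
      using s by (intro set_integrable_mult_right set_integrable_powr_div_1_plus) auto
    thus ?thesis by (rule iffD2[OF set_integrable_cong[OF refl refl fg], rotated]) auto
  qed
  have inf: "((ereal \<circ> sqrt \<circ> real_of_ereal) \<longlongrightarrow> \<infinity>) (at_left \<infinity>)"
    using sqrt_at_top by (simp add: ereal_tendsto_simps)
  have "(sqrt \<longlongrightarrow> sqrt 0) (at_right 0)"
    by (intro tendsto_intros)
  hence zero: "((ereal \<circ> sqrt \<circ> real_of_ereal) \<longlongrightarrow> ereal 0) (at_right (ereal 0))"
    by (simp add: ereal_tendsto_simps)
  have f_cont: "isCont f (sqrt x)" if "x > 0" for x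
    unfolding f_def using that
    by (intro continuous_intros) (auto simp: add_nonneg_eq_0_iff)
  have g_cont: "isCont (\<lambda>p. inverse (sqrt p) / 2) x" if "x > 0" for x :: real
    using that by (intro continuous_intros) auto
  have DERIV_g: "DERIV sqrt x :> inverse (sqrt x) / 2" if "x > 0" for x
    by (rule DERIV_real_sqrt[OF that])
  have f_nonneg: "f u \<ge> 0" for u by (auto simp: f_def intro!: divide_nonneg_nonneg add_nonneg_nonneg)
  note sub = interval_integral_substitution_nonneg[of "ereal 0" \<infinity> sqrt "\<lambda>p. inverse (sqrt p) / 2" f "ereal 0" \<infinity>,
    unfolded einterval_eq interval_integral_to_infinity_eq]
  have "set_integrable lborel {0<..} f \<and>
     (LBINT u:{0<..}. f u) = (LBINT p:{0<..}. f (sqrt p) * (inverse (sqrt p) / 2))"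
    by (intro conjI sub) (use int f_cont g_cont DERIV_g f_nonneg zero inf in auto)
  moreover have "(LBINT p:{0<..}. f (sqrt p) * (inverse (sqrt p) / 2)) =
      (LBINT p:{0<..}. 1 / 2 * (p powr (s / 2 - 1) / (1 + p)))"
    by (intro set_lebesgue_integral_cong allI impI fg) auto
  moreover have "\<dots> = 1 / 2 * (pi / sin (pi * (s / 2)))"
    unfolding set_integral_mult_right using s by (subst set_integral_powr_div_1_plus) auto
  ultimately show "set_integrable lborel {0<..} (\<lambda>u. u powr (s - 1) / (1 + u ^ 2))"
    "(LBINT u:{0<..}. u powr (s - 1) / (1 + u ^ 2)) = pi / (2 * sin (pi * s / 2))"
    by (simp_all add: f_def[abs_def])
qed

lemma
  fixes s N :: real
  assumes s: "0 < s" "s < 2" and N: "N > 0"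
  shows set_integrable_mellin_lorentzian:
      "set_integrable lborel {0<..} (\<lambda>y. y powr (s - 1) / (N ^ 2 + (y / (2 * pi)) ^ 2))"
    and set_integral_mellin_lorentzian:
      "(LBINT y:{0<..}. y powr (s - 1) / (N ^ 2 + (y / (2 * pi)) ^ 2)) =
         (2 * pi) powr s * (pi / (2 * sin (pi * s / 2))) * N powr (s - 2)"
proof -
  define c where "c = 2 * pi * N"
  have c: "c > 0" using N by (simp add: c_def)
  define h where "h y = indicator {0<..} y *\<^sub>R (y powr (s - 1) / (N ^ 2 + (y / (2 * pi)) ^ 2))" for y
  define k where "k = c powr (s - 1) / N ^ 2"
  have h: "h (0 + c * u) = k * (indicator {0<..} u *\<^sub>R (u powr (s - 1) / (1 + u ^ 2)))" for u
  proof (cases "u > 0")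
    case True
    have "N ^ 2 + (c * u / (2 * pi)) ^ 2 = N ^ 2 * (1 + u ^ 2)"
      by (simp add: c_def power_mult_distrib algebra_simps)
    thus ?thesis using True c by (simp add: h_def k_def powr_mult)
  next
    case False
    thus ?thesis using c by (simp add: h_def zero_less_mult_iff)
  qed
  note base = set_integrable_powr_div_1_plus_square[OF s] set_integral_powr_div_1_plus_square[OF s]
  have "integrable lborel (\<lambda>u. h (0 + c * u))"
    unfolding h using base(1) by (intro integrable_mult_right) (simp add: set_integrable_def)
  hence "integrable lborel h" using lborel_integrable_real_affine_iff[of c h 0] c by simp
  thus "set_integrable lborel {0<..} (\<lambda>y. y powr (s - 1) / (N ^ 2 + (y / (2 * pi)) ^ 2))"
    by (simp add: set_integrable_def h_def[abs_def])
  have "(LBINT y:{0<..}. y powr (s - 1) / (N ^ 2 + (y / (2 * pi)) ^ 2)) = integral\<^sup>L lborel h"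
    by (simp add: set_lebesgue_integral_def h_def[abs_def])
  also have "\<dots> = c * (LBINT u. h (0 + c * u))"
    using c by (subst lborel_integral_real_affine[of c _ 0]) auto
  also have "\<dots> = c * k * (pi / (2 * sin (pi * s / 2)))"
    unfolding h base(2)[symmetric] set_lebesgue_integral_def integral_mult_right_zero by simp
  also have "c * k = (2 * pi) powr s * N powr (s - 2)"
  proof -
    have "c * k = c powr s / N ^ 2"
      using c powr_mult_base[of c "s - 1"] by (simp add: k_def)
    also have "\<dots> = (2 * pi) powr s * (N powr s / N powr 2)"
      using N by (simp add: c_def powr_mult)
    finally show ?thesis by (simp add: powr_diff)
  qed
  finally show "(LBINT y:{0<..}. y powr (s - 1) / (N ^ 2 + (y / (2 * pi)) ^ 2)) =
         (2 * pi) powr s * (pi / (2 * sin (pi * s / 2))) * N powr (s - 2)"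
    by (simp add: mult_ac)
qed

lemma set_integral_mellin_w:
  fixes s :: real
  assumes s: "0 < s" "s < 1"
  shows "(LBINT y:{0<..}. y powr (s - 1) * w_fun y) =
     (2 * pi) powr s * (pi / (2 * sin (pi * s / 2))) * (\<Sum>n. odd_harm (Suc n) / real (Suc n) powr (2 - s))"
proof -
  define C where "C = (2 * pi) powr s * (pi / (2 * sin (pi * s / 2)))"
  let ?f = "\<lambda>n y. odd_harm (Suc n) * (y powr (s - 1) / (real (Suc n) ^ 2 + (y / (2 * pi)) ^ 2))"
  have int: "set_integrable lborel {0<..} (?f n)" for n
    using s by (intro set_integrable_mult_right set_integrable_mellin_lorentzian) auto
  have nonneg: "?f n y \<ge> 0" for n y
    by (intro mult_nonneg_nonneg divide_nonneg_nonneg add_nonneg_nonneg odd_harm_nonneg) auto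
  have sums: "(\<lambda>n. ?f n y) sums (y powr (s - 1) * w_fun y)" for y
    using sums_mult[OF summable_sums[OF summable_w_fun[of y]], of "y powr (s - 1)"]
    by (simp add: w_fun_def mult_ac)
  have val: "(LBINT y:{0<..}. ?f n y) = C * (odd_harm (Suc n) / real (Suc n) powr (2 - s))" for n
  proof -
    have "(LBINT y:{0<..}. ?f n y) = odd_harm (Suc n) * (C * real (Suc n) powr (s - 2))"
      unfolding set_integral_mult_right C_def using s by (subst set_integral_mellin_lorentzian) auto
    also have "real (Suc n) powr (s - 2) = 1 / real (Suc n) powr (2 - s)"
      using powr_minus_divide[of "real (Suc n)" "2 - s"] by simp
    finally show ?thesis by simp
  qed
  have vals: "(\<lambda>n. LBINT y:{0<..}. ?f n y) sums (C * (\<Sum>n. odd_harm (Suc n) / real (Suc n) powr (2 - s)))"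
    unfolding val using s by (intro sums_mult summable_sums summable_odd_harm_powr) auto
  show ?thesis unfolding C_def[symmetric]
    by (rule sums_unique2[OF set_integral_sums_nonneg[OF int nonneg sums sums_summable[OF vals]] vals])
qed

section \<open>The integrals as holomorphic functions\<close>

lemma open_Re_less_1: "open {z. Re z < 1}"
  by (simp add: open_halfspace_Re_lt)

lemma set_borel_measurable_hurwitz_entire:
  "set_borel_measurable lborel {0<..<1} (\<lambda>t. hurwitz_entire z t)"
proof -
  have "continuous_on {0..} (\<lambda>t. (\<lambda>(z, t). hurwitz_entire z t) (z, t))"
    by (rule continuous_on_compose2[OF continuous_on_hurwitz_entire]) (auto intro!: continuous_intros)
  hence "continuous_on {0..} (hurwitz_entire z)" by simp
  hence "continuous_on {0<..<1} (hurwitz_entire z)"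
    by (rule continuous_on_subset) auto
  from borel_measurable_continuous_on_indicator[OF _ this] show ?thesis
    by (simp add: set_borel_measurable_def)
qed

lemma norm_of_real_powr_neg_le:
  assumes "0 < t" "t < 1" "Re w \<le> \<sigma>"
  shows "norm (complex_of_real t powr (-w)) \<le> t powr (-\<sigma>)"
  using assms powr_mono'[of "-\<sigma>" "- Re w" t]
  by (subst norm_powr_real_powr) auto

text \<open>
  The hypotheses of the parameter integral lemmas. On a small disc about \<open>z\<close> the function
  \<open>\<zeta>(w,t)\<close> is bounded by \<open>t^(-\<sigma>) + M / r\<close> with \<open>\<sigma> < 1\<close>, because \<open>\<zeta>(w,1+t)\<close> stays bounded for
  \<open>0 \<le> t \<le> 1\<close> as long as \<open>w\<close> keeps the distance \<open>r\<close> from its pole at 1.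
\<close>

lemma hurwitz_logtan_param:
  defines "U \<equiv> {z. Re z < 1}" and "f \<equiv> \<lambda>z t. hurwitz_zeta z t * of_real (logtan t)"
  shows "t \<in> {0<..<1} \<Longrightarrow> (\<lambda>z. f z t) holomorphic_on U"
    and "z \<in> U \<Longrightarrow> set_borel_measurable lborel {0<..<1} (f z)"
    and "z \<in> U \<Longrightarrow> \<exists>r>0. \<exists>h. set_integrable lborel {0<..<1} h \<and>
           (\<forall>w\<in>cball z r \<inter> U. \<forall>t\<in>{0<..<1}. norm (f w t) \<le> h t)"
proof -
  have ne1: "z \<noteq> 1" if "z \<in> U" for z using that by (auto simp: U_def)
  show "(\<lambda>z. f z t) holomorphic_on U" if t: "t \<in> {0<..<1}"
  proof -
    have "(\<lambda>z. (of_real t powr (-z) + hurwitz_entire z t / (z - 1)) * of_real (logtan t)) holomorphic_on U"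
      using t ne1 by (auto intro!: holomorphic_intros holomorphic_on_subset[OF holomorphic_on_hurwitz_entire])
    thus ?thesis
      by (rule holomorphic_transform) (use t ne1 in \<open>auto simp: f_def hurwitz_zeta_eq\<close>)
  qed
  show "set_borel_measurable lborel {0<..<1} (f z)" if z: "z \<in> U"
  proof -
    have "indicator {0<..<1} t *\<^sub>R f z t = (indicator {0<..<1} t * of_real t powr (-z) +
        (indicator {0<..<1} t *\<^sub>R hurwitz_entire z t) / (z - 1)) * of_real (logtan t)" for t
      using ne1[OF z] by (auto simp: f_def hurwitz_zeta_eq indicator_def)
    thus ?thesis
      using set_borel_measurable_hurwitz_entire[of z] unfolding set_borel_measurable_def by simp
  qed
  assume z: "z \<in> U"
  define r where "r = (1 - Re z) / 2"
  define \<sigma> where "\<sigma> = Re z + r"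
  have r: "r > 0" "\<sigma> < 1" "1 - \<sigma> = r" using z by (auto simp: r_def \<sigma>_def U_def field_simps)
  obtain M where M: "\<And>w t. w \<in> cball z r \<Longrightarrow> t \<in> {0..1} \<Longrightarrow> norm (hurwitz_entire w t) \<le> M"
    using bounded_hurwitz_entire[of "cball z r"] by auto
  have bound: "norm (f w t) \<le> t powr (-\<sigma>) * \<bar>logtan t\<bar> + M / r * (t powr (-0) * \<bar>logtan t\<bar>)"
    if w: "w \<in> cball z r" "w \<in> U" and t: "t \<in> {0<..<1}" for w t
  proof -
    have Rew: "Re w \<le> \<sigma>" using Re_cball_bounds[OF w(1)] by (simp add: \<sigma>_def)
    have "r \<le> \<bar>Re (w - 1)\<bar>" using Rew r by simp
    also have "\<dots> \<le> norm (w - 1)" by (rule abs_Re_le_cmod)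
    finally have rw: "r \<le> norm (w - 1)" .
    have M0: "M \<ge> 0" using order_trans[OF norm_ge_zero M[of w 0]] w by simp
    have "norm (hurwitz_zeta w t) \<le> norm (complex_of_real t powr (-w)) + norm (hurwitz_entire w t) / norm (w - 1)"
      using t ne1[OF w(2)] by (simp add: hurwitz_zeta_eq norm_triangle_le norm_divide)
    also have "\<dots> \<le> t powr (-\<sigma>) + M / r"
      using M[OF w(1), of t] t r Rew rw M0 by (intro add_mono frac_le norm_of_real_powr_neg_le) auto
    finally have "norm (f w t) \<le> (t powr (-\<sigma>) + M / r) * \<bar>logtan t\<bar>"
      by (simp add: f_def norm_mult mult_right_mono)
    thus ?thesis using t by (simp add: algebra_simps)
  qed
  have "set_integrable lborel {0<..<1} (\<lambda>t. t powr (-\<sigma>) * \<bar>logtan t\<bar> + M / r * (t powr (-0) * \<bar>logtan t\<bar>))"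
    using r by (intro set_integral_add set_integrable_mult_right set_integrable_powr_logtan) auto
  thus "\<exists>r>0. \<exists>h. set_integrable lborel {0<..<1} h \<and>
           (\<forall>w\<in>cball z r \<inter> U. \<forall>t\<in>{0<..<1}. norm (f w t) \<le> h t)"
    using r(1) bound by blast
qed

definition hurwitz_logtan :: "complex \<Rightarrow> complex" where
  "hurwitz_logtan z = (LBINT t:{0<..<1}. hurwitz_zeta z t * of_real (logtan t))"

lemma G_fun_eq: "G_fun z = of_real (pi / 2) * hurwitz_logtan z"
  unfolding G_fun_def hurwitz_logtan_def by (rule set_integral_logtan_scale)

lemma set_integrable_hurwitz_logtan:
  assumes "Re z < 1"
  shows "set_integrable lborel {0<..<1} (\<lambda>t. hurwitz_zeta z t * of_real (logtan t))"
  by (rule set_integrable_holomorphic_param[OF open_Re_less_1 _ _ hurwitz_logtan_param]) (use assms in auto)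

lemma holomorphic_hurwitz_logtan: "hurwitz_logtan holomorphic_on {z. Re z < 1}"
  unfolding hurwitz_logtan_def[abs_def]
  by (rule holomorphic_on_set_integral[OF open_Re_less_1]) (use hurwitz_logtan_param in auto)

lemma
  assumes z: "Re z < 1"
  shows set_integrable_hurwitz'_logtan:
      "set_integrable lborel {0<..<1} (\<lambda>t. hurwitz_zeta' z t * of_real (logtan t))"
    and hurwitz_logtan_has_derivative:
      "(hurwitz_logtan has_field_derivative
         (LBINT t:{0<..<1}. hurwitz_zeta' z t * of_real (logtan t))) (at z)"
proof -
  have d: "deriv (\<lambda>z. hurwitz_zeta z t * of_real (logtan t)) z = hurwitz_zeta' z t * of_real (logtan t)"
    if "t \<in> {0<..<1}" for t
  proof (cases "logtan t = 0")
    case False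
    have "(\<lambda>z. (hurwitz_zeta z t * of_real (logtan t)) / of_real (logtan t)) holomorphic_on {z. Re z < 1}"
      using hurwitz_logtan_param(1)[OF that] False
      by (intro holomorphic_on_divide holomorphic_on_const) auto
    hence "(\<lambda>z. hurwitz_zeta z t) holomorphic_on {z. Re z < 1}"
      by (rule holomorphic_transform) (use False in simp)
    hence "(\<lambda>z. hurwitz_zeta z t) field_differentiable at z"
      using z open_Re_less_1 holomorphic_on_imp_differentiable_at by blast
    thus ?thesis unfolding hurwitz_zeta'_def by (subst deriv_cmult_right) auto
  qed simp
  have prm: "z \<in> {z. Re z < 1}" "{0<..<1::real} \<in> sets lborel" using z by auto
  note P = hurwitz_logtan_param
  have "set_integrable lborel {0<..<1} (\<lambda>t. deriv (\<lambda>z. hurwitz_zeta z t * of_real (logtan t)) z)"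
    by (rule set_integrable_deriv_param[OF open_Re_less_1 prm P])
  thus "set_integrable lborel {0<..<1} (\<lambda>t. hurwitz_zeta' z t * of_real (logtan t))"
    by (rule iffD1[OF set_integrable_cong[OF refl refl d], rotated])
  have "(LBINT t:{0<..<1}. deriv (\<lambda>z. hurwitz_zeta z t * of_real (logtan t)) z) =
      (LBINT t:{0<..<1}. hurwitz_zeta' z t * of_real (logtan t))"
    by (intro set_lebesgue_integral_cong) (use d in auto)
  thus "(hurwitz_logtan has_field_derivative
         (LBINT t:{0<..<1}. hurwitz_zeta' z t * of_real (logtan t))) (at z)"
    using has_field_derivative_set_integral[OF open_Re_less_1 prm P]
    unfolding hurwitz_logtan_def[abs_def] by simp
qed

definition hurwitz_entire_logtan :: "complex \<Rightarrow> complex" where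
  "hurwitz_entire_logtan z = (LBINT t:{0<..<1}. hurwitz_entire z t * of_real (logtan t))"

lemma set_integrable_hurwitz_entire_logtan:
  "set_integrable lborel {0<..<1} (\<lambda>t. hurwitz_entire z t * of_real (logtan t))"
proof (rule set_integrable_continuous_logtan)
  have "continuous_on {0..1} (\<lambda>t. (\<lambda>(z, t). hurwitz_entire z t) (z, t))"
    by (rule continuous_on_compose2[OF continuous_on_hurwitz_entire]) (auto intro!: continuous_intros)
  thus "continuous_on {0..1} (hurwitz_entire z)" by simp
qed

lemma holomorphic_hurwitz_entire_logtan: "hurwitz_entire_logtan holomorphic_on UNIV"
  unfolding hurwitz_entire_logtan_def[abs_def]
proof (rule holomorphic_on_set_integral)
  show "(\<lambda>z. hurwitz_entire z t * of_real (logtan t)) holomorphic_on UNIV" if "t \<in> {0<..<1}" for t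
    using that by (intro holomorphic_intros holomorphic_on_hurwitz_entire) auto
  show "set_borel_measurable lborel {0<..<1} (\<lambda>t. hurwitz_entire z t * of_real (logtan t))" for z
    using set_integrable_hurwitz_entire_logtan[of z]
    by (simp add: set_integrable_def set_borel_measurable_def)
  fix z :: complex
  obtain M where M: "\<And>w t. w \<in> cball z 1 \<Longrightarrow> t \<in> {0..1} \<Longrightarrow> norm (hurwitz_entire w t) \<le> M"
    using bounded_hurwitz_entire[of "cball z 1"] by auto
  have "set_integrable lborel {0<..<1} (\<lambda>t. M * (t powr (-0) * \<bar>logtan t\<bar>))"
    by (intro set_integrable_mult_right set_integrable_powr_logtan) auto
  moreover have "norm (hurwitz_entire w t * of_real (logtan t)) \<le> M * (t powr (-0) * \<bar>logtan t\<bar>)"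
    if "w \<in> cball z 1" "t \<in> {0<..<1}" for w t
    using M[of w t] that by (simp add: norm_mult mult_right_mono)
  ultimately show "\<exists>r>0. \<exists>h. set_integrable lborel {0<..<1} h \<and>
      (\<forall>w\<in>cball z r \<inter> UNIV. \<forall>t\<in>{0<..<1}. norm (hurwitz_entire w t * of_real (logtan t)) \<le> h t)"
    by (intro exI[of _ 1] conjI exI[of _ "\<lambda>t. M * (t powr (-0) * \<bar>logtan t\<bar>)"]) auto
qed auto

text \<open>
  The Mellin transform of \<open>e^(-y) w(y)\<close>. Since \<open>w\<close> is bounded it exists for \<open>Re z > 0\<close>.
\<close>

definition mellin_exp_w :: "complex \<Rightarrow> complex" where
  "mellin_exp_w z = (LBINT y:{0<..}. of_real (w_fun y) * of_real (exp (- y)) * of_real y powr (z - 1))"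

lemma mellin_exp_w_param:
  defines "U \<equiv> {z. Re z > 0}" and "f \<equiv> \<lambda>z y. of_real (w_fun y) * of_real (exp (- y)) * of_real y powr (z - 1) :: complex"
  shows "y \<in> {0<..} \<Longrightarrow> (\<lambda>z. f z y) holomorphic_on U"
    and "z \<in> U \<Longrightarrow> set_borel_measurable lborel {0<..} (f z)"
    and "z \<in> U \<Longrightarrow> \<exists>r>0. \<exists>h. set_integrable lborel {0<..} h \<and>
           (\<forall>w\<in>cball z r \<inter> U. \<forall>y\<in>{0<..}. norm (f w y) \<le> h y)"
proof -
  show "(\<lambda>z. f z y) holomorphic_on U" if "y \<in> {0<..}"
    using that unfolding f_def by (auto intro!: holomorphic_intros)
  show "set_borel_measurable lborel {0<..} (f z)"
    unfolding f_def set_borel_measurable_def by measurable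
  assume z: "z \<in> U"
  define r where "r = Re z / 2"
  have r: "r > 0" "Re z + r > 0" using z by (auto simp: r_def U_def)
  let ?h = "\<lambda>y. w_fun 0 * (y powr (r - 1) * exp (- (1 * y)) + y powr (Re z + r - 1) * exp (- (1 * y)))"
  have "set_integrable lborel {0<..} ?h"
    using r by (intro set_integrable_mult_right set_integral_add set_integrable_Gamma_scaled) auto
  moreover have "norm (f w y) \<le> ?h y" if w: "w \<in> cball z r" and y: "y \<in> {0<..}" for w y
  proof -
    have Rew: "r \<le> Re w" "Re w \<le> Re z + r"
      using Re_cball_bounds[OF w] by (simp_all add: r_def)
    have "y powr (Re w - 1) \<le> y powr (r - 1) + y powr (Re z + r - 1)"
    proof (cases "y \<le> 1")
      case True
      hence "y powr (Re w - 1) \<le> y powr (r - 1)" using y Rew by (intro powr_mono') auto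
      thus ?thesis by (simp add: add_increasing2)
    next
      case False
      hence "y powr (Re w - 1) \<le> y powr (Re z + r - 1)" using Rew by (intro powr_mono) auto
      thus ?thesis by (simp add: add_increasing)
    qed
    moreover have "norm (f w y) = w_fun y * (exp (- y) * y powr (Re w - 1))"
      using y w_fun_nonneg[of y] by (simp add: f_def norm_mult norm_powr_real_powr)
    moreover have "w_fun y * (exp (- y) * y powr (Re w - 1)) \<le> w_fun 0 * (exp (- y) * y powr (Re w - 1))"
      by (intro mult_right_mono w_fun_le) auto
    moreover have "w_fun 0 * (exp (- y) * y powr (Re w - 1)) \<le>
        w_fun 0 * (exp (- y) * (y powr (r - 1) + y powr (Re z + r - 1)))"
      using calculation(1) by (intro mult_left_mono w_fun_nonneg) auto
    ultimately have "norm (f w y) \<le> w_fun 0 * (exp (- y) * (y powr (r - 1) + y powr (Re z + r - 1)))"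
      by linarith
    thus ?thesis by (simp add: algebra_simps)
  qed
  ultimately show "\<exists>r>0. \<exists>h. set_integrable lborel {0<..} h \<and>
           (\<forall>w\<in>cball z r \<inter> U. \<forall>y\<in>{0<..}. norm (f w y) \<le> h y)"
    using r(1) by blast
qed

lemma open_Re_greater_0: "open {z. Re z > 0}"
  by (simp add: open_halfspace_Re_gt)

lemma set_integrable_mellin_exp_w:
  assumes "Re z > 0"
  shows "set_integrable lborel {0<..} (\<lambda>y. of_real (w_fun y) * of_real (exp (- y)) * of_real y powr (z - 1) :: complex)"
  by (rule set_integrable_holomorphic_param[OF open_Re_greater_0 _ _ mellin_exp_w_param]) (use assms in auto)

lemma holomorphic_mellin_exp_w: "mellin_exp_w holomorphic_on {z. Re z > 0}"
  unfolding mellin_exp_w_def[abs_def]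
  by (rule holomorphic_on_set_integral[OF open_Re_greater_0]) (use mellin_exp_w_param in auto)

lemma mellin_exp_w_of_real:
  assumes "s > 0"
  shows "set_integrable lborel {0<..} (\<lambda>y. y powr (s - 1) * exp (- y) * w_fun y)"
    and "mellin_exp_w (of_real s) = of_real (LBINT y:{0<..}. y powr (s - 1) * exp (- y) * w_fun y)"
proof -
  have eq: "of_real (w_fun y) * of_real (exp (- y)) * of_real y powr (of_real s - 1) =
      complex_of_real (y powr (s - 1) * exp (- y) * w_fun y)" if "y \<in> {0<..}" for y
    using that powr_of_real[of y "s - 1"] by simp
  have "set_integrable lborel {0<..} (\<lambda>y. complex_of_real (y powr (s - 1) * exp (- y) * w_fun y))"
    by (rule iffD1[OF set_integrable_cong[OF refl refl eq] set_integrable_mellin_exp_w]) (use assms in auto)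
  from integrable_Re[OF this[unfolded set_integrable_def]]
  show "set_integrable lborel {0<..} (\<lambda>y. y powr (s - 1) * exp (- y) * w_fun y)"
    by (simp add: set_integrable_def)
  show "mellin_exp_w (of_real s) = of_real (LBINT y:{0<..}. y powr (s - 1) * exp (- y) * w_fun y)"
    unfolding mellin_exp_w_def set_integral_complex_of_real[symmetric]
    by (intro set_lebesgue_integral_cong) (use eq in auto)
qed

text \<open>
  For real \<open>z > 1\<close> the Dirichlet series of \<open>\<zeta>(z,1+t)\<close> converges and \<open>set_integral_powr_exp_w\<close> applies.
  The identity theorem then reaches the strip \<open>0 < Re z < 1\<close>, where the contribution of \<open>t^(-z)\<close> is
  finite as well.
\<close>

lemma hurwitz_entire_logtan_eq:
  assumes z: "Re z > 0"
  shows "hurwitz_entire_logtan z = - of_real (2 / pi ^ 2) * (z - 1) * rGamma z * mellin_exp_w z"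
proof (rule holomorphic_eq_of_real_eq[where f = hurwitz_entire_logtan and U = "{z. Re z > 0}" and a = 1 and b = 2 and
    g = "\<lambda>z. - of_real (2 / pi ^ 2) * (z - 1) * rGamma z * mellin_exp_w z"])
  show "(\<lambda>z. - of_real (2 / pi ^ 2) * (z - 1) * rGamma z * mellin_exp_w z) holomorphic_on {z. Re z > 0}"
    by (intro holomorphic_intros holomorphic_mellin_exp_w)
  fix s :: real assume s: "1 < s" "s < 2"
  define S where "S t = (\<Sum>n. (real (Suc n) + t) powr (-s))" for t
  have "hurwitz_entire (of_real s) t * of_real (logtan t) = complex_of_real ((s - 1) * (S t * logtan t))"
    if t: "t \<in> {0<..<1}" for t
  proof -
    have e: "complex_of_real (real (Suc n) + t) powr (- of_real s) = of_real ((real (Suc n) + t) powr (-s))" for n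
      using t powr_of_real[of "real (Suc n) + t" "-s"] by (simp del: of_real_add)
    have "summable (\<lambda>n. complex_of_real ((real (Suc n) + t) powr (-s)))"
      unfolding e[symmetric] by (rule summable_hurwitz_terms) (use t s in auto)
    hence sm: "summable (\<lambda>n. (real (Suc n) + t) powr (-s))"
      by (simp only: summable_complex_of_real)
    have "hurwitz_entire (of_real s) t = (of_real s - 1) * (\<Sum>n. complex_of_real ((real (Suc n) + t) powr (-s)))"
      unfolding e[symmetric] using t s by (intro hurwitz_entire_eq_series) auto
    also have "(\<Sum>n. complex_of_real ((real (Suc n) + t) powr (-s))) = of_real (S t)"
      unfolding S_def by (rule suminf_of_real[OF sm, symmetric])
    finally show ?thesis by simp
  qed
  hence "hurwitz_entire_logtan (of_real s) = (LBINT t:{0<..<1}. complex_of_real ((s - 1) * (S t * logtan t)))"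
    unfolding hurwitz_entire_logtan_def by (intro set_lebesgue_integral_cong) auto
  also have "\<dots> = of_real ((s - 1) * (LBINT t:{0<..<1}. S t * logtan t))"
    unfolding set_integral_complex_of_real by simp
  also have "(LBINT t:{0<..<1}. S t * logtan t) =
      - (2 / pi ^ 2) * rGamma s * (LBINT y:{0<..}. y powr (s - 1) * exp (- y) * w_fun y)"
  proof -
    have G: "Gamma s \<noteq> 0" using Gamma_real_pos[of s] s by linarith
    have "(LBINT y:{0<..}. y powr (s - 1) * exp (- y) * w_fun y) =
        - (pi ^ 2 / 2) * Gamma s * (LBINT t:{0<..<1}. S t * logtan t)"
      unfolding S_def by (rule set_integral_powr_exp_w) (use s in auto)
    moreover have "X = - (2 / pi ^ 2) * rGamma s * (- (pi ^ 2 / 2) * Gamma s * X)" for X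
      using G by (simp add: rGamma_inverse_Gamma)
    ultimately show ?thesis by (simp only:)
  qed
  finally show "hurwitz_entire_logtan (of_real s) = - of_real (2 / pi ^ 2) * (of_real s - 1) * rGamma (of_real s) * mellin_exp_w (of_real s)"
    using s by (simp add: mellin_exp_w_of_real rGamma_complex_of_real)
next
  show "connected {z. Re z > 0}"
    by (intro convex_connected convex_halfspace_Re_gt)
qed (use z in \<open>auto simp: open_Re_greater_0 intro: holomorphic_on_subset[OF holomorphic_hurwitz_entire_logtan]\<close>)

section \<open>Relation with the odd harmonic zeta function\<close>

lemma set_integrable_powr_logtan':
  "a < 1 \<Longrightarrow> set_integrable lborel {0<..<1} (\<lambda>t. t powr (-a) * logtan t)"
  by (rule set_integrable_bound[OF set_integrable_powr_logtan]) (auto simp: set_borel_measurable_def abs_mult)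

lemma set_integrable_complex_of_real:
  "set_integrable M A f \<Longrightarrow> set_integrable M A (\<lambda>x. complex_of_real (f x))"
  using integrable_of_real[where 'a = complex, of M "\<lambda>x. indicator A x *\<^sub>R f x"]
  by (simp add: set_integrable_def scaleR_conv_of_real)

lemma hurwitz_logtan_of_real:
  fixes s :: real
  assumes s: "0 < s" "s < 1"
  shows "hurwitz_logtan (of_real s) = of_real (LBINT t:{0<..<1}. t powr (-s) * logtan t)
           - of_real (2 / pi ^ 2) * rGamma (of_real s) * mellin_exp_w (of_real s)"
proof -
  have s1: "complex_of_real s \<noteq> 1" using s by auto
  have "hurwitz_logtan (of_real s) = (LBINT t:{0<..<1}. complex_of_real (t powr (-s) * logtan t) +
      hurwitz_entire (of_real s) t * of_real (logtan t) / (of_real s - 1))"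
    unfolding hurwitz_logtan_def
  proof (intro set_lebesgue_integral_cong allI impI)
    fix t :: real assume t: "t \<in> {0<..<1}"
    have "complex_of_real t powr (- of_real s) = of_real (t powr (-s))"
      using t powr_of_real[of t "-s"] by simp
    thus "hurwitz_zeta (of_real s) t * of_real (logtan t) = complex_of_real (t powr (-s) * logtan t) +
        hurwitz_entire (of_real s) t * of_real (logtan t) / (of_real s - 1)"
      using t s1 by (simp add: hurwitz_zeta_eq field_simps)
  qed auto
  also have "\<dots> = (LBINT t:{0<..<1}. complex_of_real (t powr (-s) * logtan t)) +
      (LBINT t:{0<..<1}. hurwitz_entire (of_real s) t * of_real (logtan t) / (of_real s - 1))"
    using set_integrable_powr_logtan'[of s] s set_integrable_hurwitz_entire_logtan[of "of_real s"]
    by (intro set_integral_add set_integrable_divide set_integrable_complex_of_real) auto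
  also have "\<dots> = of_real (LBINT t:{0<..<1}. t powr (-s) * logtan t) + hurwitz_entire_logtan (of_real s) / (of_real s - 1)"
    unfolding set_integral_complex_of_real hurwitz_entire_logtan_def by simp
  also have "hurwitz_entire_logtan (of_real s) / (of_real s - 1) =
      - of_real (2 / pi ^ 2) * rGamma (of_real s) * mellin_exp_w (of_real s)"
  proof -
    have "- c * d * r * m / d = - c * r * m" if "d \<noteq> 0" for c d r m :: complex
      using that by simp
    moreover have "complex_of_real s - 1 \<noteq> 0" using s1 by simp
    moreover have "Re (of_real s) > 0" using s by simp
    ultimately show ?thesis by (simp only: hurwitz_entire_logtan_eq)
  qed
  finally show ?thesis by simp
qed

text \<open>
  The two parts of \<open>\<zeta>(s,t)\<close> contribute the Mellin transforms of \<open>(1 - e^(-y)) w(y)\<close> and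
  \<open>e^(-y) w(y)\<close>, so that the exponentials cancel in the sum.
\<close>

lemma hurwitz_logtan_of_real_eq_mellin:
  fixes s :: real
  assumes s: "0 < s" "s < 1"
  shows "hurwitz_logtan (of_real s) =
           of_real (- (2 / pi ^ 2) * rGamma s * (LBINT y:{0<..}. y powr (s - 1) * w_fun y))"
proof -
  define I where "I = (LBINT t:{0<..<1}. t powr (-s) * logtan t)"
  define J where "J = (LBINT y:{0<..}. y powr (s - 1) * exp (- (0 * y)) * (1 - exp (- y)) * w_fun y)"
  define K where "K = (LBINT y:{0<..}. y powr (s - 1) * exp (- y) * w_fun y)"
  have int: "set_integrable lborel {0<..<1} (\<lambda>t. (0 + t) powr (-s) * \<bar>logtan t\<bar>)"
    using set_integrable_powr_logtan[of s] s by simp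
  have G: "Gamma s \<noteq> 0" using Gamma_real_pos[of s] s by linarith
  have "J = - (pi ^ 2 / 2) * Gamma s * I"
    unfolding J_def I_def using set_integral_mellin_laplace_logtan[OF _ _ int] s by simp
  hence I: "I = - (2 / pi ^ 2) * rGamma s * J"
    using G by (simp add: rGamma_inverse_Gamma)
  have "(LBINT y:{0<..}. y powr (s - 1) * w_fun y) =
      (LBINT y:{0<..}. y powr (s - 1) * exp (- (0 * y)) * (1 - exp (- y)) * w_fun y +
                       y powr (s - 1) * exp (- y) * w_fun y)"
    by (intro set_lebesgue_integral_cong) (auto simp: algebra_simps)
  also have "\<dots> = J + K"
    unfolding J_def K_def using set_integrable_mellin_laplace_logtan[OF _ _ int] mellin_exp_w_of_real(1) s
    by (intro set_integral_add) auto
  finally have JK: "(LBINT y:{0<..}. y powr (s - 1) * w_fun y) = J + K" .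
  have "hurwitz_logtan (of_real s) = of_real (I - 2 / pi ^ 2 * rGamma s * K)"
    using hurwitz_logtan_of_real[OF s] mellin_exp_w_of_real(2)[of s] s
    by (simp add: I_def K_def rGamma_complex_of_real)
  also have "I - 2 / pi ^ 2 * rGamma s * K = - (2 / pi ^ 2) * rGamma s * (J + K)"
    unfolding I by (simp add: ring_distribs)
  finally show ?thesis unfolding JK .
qed

lemma holomorphic_zeta_h: "zeta_h holomorphic_on {s. Re s > 1}"
  unfolding zeta_h_def[abs_def]
proof (rule holomorphic_suminf)
  fix z :: complex assume z: "z \<in> {s. Re s > 1}"
  define r where "r = (Re z - 1) / 2"
  have r: "r > 0" "Re z - r > 1" using z by (auto simp: r_def field_simps)
  have "norm (complex_of_real (odd_harm (Suc n)) / of_nat (Suc n) powr w) \<le>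
          odd_harm (Suc n) / real (Suc n) powr (Re z - r)" if "w \<in> cball z r" for w n
  proof -
    have "norm (complex_of_real (odd_harm (Suc n)) / of_nat (Suc n) powr w) =
        odd_harm (Suc n) / real (Suc n) powr Re w"
      using norm_powr_real_powr[of "of_nat (Suc n)" w] odd_harm_nonneg[of "Suc n"]
      by (simp add: norm_divide del: of_nat_Suc)
    also have "\<dots> \<le> odd_harm (Suc n) / real (Suc n) powr (Re z - r)"
      using Re_cball_bounds[OF that] by (intro divide_left_mono odd_harm_nonneg powr_mono mult_pos_pos) auto
    finally show ?thesis .
  qed
  thus "\<exists>r>0. \<exists>M. summable M \<and> (\<forall>\<^sub>F n in sequentially. \<forall>w\<in>cball z r \<inter> {s. Re s > 1}.
      norm (complex_of_real (odd_harm (Suc n)) / of_nat (Suc n) powr w) \<le> M n)"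
    using r summable_odd_harm_powr[OF r(2)] by (blast intro: always_eventually)
qed (auto intro!: holomorphic_intros open_halfspace_Re_gt simp del: of_nat_Suc)

text \<open>
  For real \<open>0 < s < 1\<close> this is the termwise Mellin transform of \<open>w\<close>; the reflection formula turns
  \<open>1 / (\<Gamma>(s) sin (\<pi>s/2))\<close> into a multiple of \<open>\<Gamma>(1-s) cos (\<pi>s/2)\<close>, which removes the apparent
  singularities at the even integers and is holomorphic on the whole half-plane.
\<close>

lemma hurwitz_logtan_eq_zeta_h:
  assumes z: "Re z < 1"
  shows "hurwitz_logtan z = - of_real (2 / pi ^ 2) *
           (cos (of_real pi / 2 * z) * (Gamma (1 - z) * of_real (2 * pi) powr z * zeta_h (2 - z)))"
    (is "_ = ?R z")
proof (rule holomorphic_eq_of_real_eq[where f = hurwitz_logtan and g = ?R and U = "{z. Re z < 1}" and a = 0 and b = 1])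
  have "(zeta_h \<circ> (\<lambda>z. 2 - z)) holomorphic_on {z. Re z < 1}"
    by (rule holomorphic_on_compose_gen[OF _ holomorphic_zeta_h]) (auto intro!: holomorphic_intros)
  hence "(\<lambda>z. zeta_h (2 - z)) holomorphic_on {z. Re z < 1}" by (simp add: o_def)
  thus "?R holomorphic_on {z. Re z < 1}"
    by (intro holomorphic_intros) (auto elim!: nonpos_Ints_cases simp: complex_eq_iff)
  fix s :: real assume s: "0 < s" "s < 1"
  define Z where "Z = (\<Sum>n. odd_harm (Suc n) / real (Suc n) powr (2 - s))"
  have zh: "zeta_h (2 - of_real s) = of_real Z"
  proof -
    have e: "complex_of_real (odd_harm (Suc n)) / of_nat (Suc n) powr (2 - of_real s) =
        of_real (odd_harm (Suc n) / real (Suc n) powr (2 - s))" for n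
      using powr_of_real[of "real (Suc n)" "2 - s"] by (simp del: of_nat_Suc)
    have "summable (\<lambda>n. odd_harm (Suc n) / real (Suc n) powr (2 - s))"
      using s by (intro summable_odd_harm_powr) auto
    thus ?thesis unfolding zeta_h_def e Z_def by (rule suminf_of_real[symmetric])
  qed
  have sin0: "sin (pi * s / 2) \<noteq> 0" using s by (intro less_imp_neq[symmetric] sin_gt_zero) auto
  have reflection: "rGamma s * (pi / (2 * sin (pi * s / 2))) = Gamma (1 - s) * cos (pi * s / 2)"
  proof -
    have "complex_of_real (rGamma s * rGamma (1 - s)) = of_real (sin (pi * s) / pi)"
      using rGamma_reflection_complex[of "of_real s"]
      by (simp add: rGamma_complex_of_real[symmetric] sin_of_real[symmetric])
    hence "rGamma s * rGamma (1 - s) = sin (pi * s) / pi"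
      by (simp only: of_real_eq_iff)
    moreover have "Gamma (1 - s) * rGamma (1 - s) = 1"
    proof -
      have "Gamma (1 - s) \<noteq> 0" using Gamma_real_pos[of "1 - s"] s by linarith
      thus ?thesis by (simp add: rGamma_inverse_Gamma)
    qed
    ultimately have "rGamma s = Gamma (1 - s) * (sin (pi * s) / pi)"
      by (metis mult.left_commute mult_1_right)
    also have "sin (pi * s) = 2 * sin (pi * s / 2) * cos (pi * s / 2)"
      using sin_double[of "pi * s / 2"] by simp
    finally show ?thesis using sin0 by simp
  qed
  have "hurwitz_logtan (of_real s) = of_real (- (2 / pi ^ 2) * rGamma s *
      ((2 * pi) powr s * (pi / (2 * sin (pi * s / 2))) * Z))"
    unfolding hurwitz_logtan_of_real_eq_mellin[OF s] set_integral_mellin_w[OF s] Z_def ..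
  also have "- (2 / pi ^ 2) * rGamma s * ((2 * pi) powr s * (pi / (2 * sin (pi * s / 2))) * Z) =
      - (2 / pi ^ 2) * (rGamma s * (pi / (2 * sin (pi * s / 2)))) * ((2 * pi) powr s * Z)"
    by (simp only: mult_ac)
  also have "\<dots> = - (2 / pi ^ 2) * (cos (pi / 2 * s) * (Gamma (1 - s) * (2 * pi) powr s * Z))"
    unfolding reflection by simp
  also have "complex_of_real \<dots> = ?R (of_real s)"
  proof -
    have "complex_of_real (cos (pi / 2 * s)) = cos (of_real pi / 2 * of_real s)"
      by (simp add: cos_of_real[symmetric])
    moreover have "complex_of_real (Gamma (1 - s)) = Gamma (1 - of_real s)"
      by (simp add: Gamma_complex_of_real[symmetric])
    moreover have "complex_of_real ((2 * pi) powr s) = of_real (2 * pi) powr of_real s"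
      by (rule powr_of_real[symmetric]) simp
    ultimately show ?thesis unfolding zh of_real_mult of_real_minus by simp
  qed
  finally show "hurwitz_logtan (of_real s) = ?R (of_real s)" .
next
  show "connected {z. Re z < 1}"
    by (intro convex_connected convex_halfspace_Re_lt)
qed (use z in \<open>auto simp: open_Re_less_1 holomorphic_hurwitz_logtan\<close>)

section \<open>The power series of log tan\<close>

definition zeta_even :: "nat \<Rightarrow> real" where
  "zeta_even k = (\<Sum>n. 1 / real (Suc n) ^ (2 * k))"

lemma summable_zeta_even: "k \<ge> 1 \<Longrightarrow> summable (\<lambda>n. 1 / real (Suc n) ^ (2 * k))"
  using inverse_power_summable[of "2 * k", where 'a = real]
  by (subst summable_Suc_iff) (simp add: divide_inverse)

lemma zeta_even_pos: "k \<ge> 1 \<Longrightarrow> zeta_even k > 0"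
  unfolding zeta_even_def by (intro suminf_pos summable_zeta_even) auto

lemma zeta_even_le: "k \<ge> 1 \<Longrightarrow> zeta_even k \<le> zeta_even 1"
  unfolding zeta_even_def
  by (intro suminf_le summable_zeta_even) (auto intro!: divide_left_mono power_increasing)

lemma riemann_zeta_even:
  assumes "k \<ge> 1"
  shows "riemann_zeta (2 * of_nat k) = of_real (zeta_even k)"
proof -
  have e: "complex_of_nat (Suc n) powr (- (2 * of_nat k)) = of_real (1 / real (Suc n) ^ (2 * k))" for n
  proof -
    have "complex_of_nat (Suc n) powr (- (2 * of_nat k)) = inverse (of_nat (Suc n) powr of_nat (2 * k))"
      by (subst powr_minus) simp
    also have "\<dots> = inverse (of_nat (Suc n) ^ (2 * k))"
      by (subst powr_nat') (auto simp del: of_nat_Suc)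
    finally show ?thesis by (simp add: divide_inverse)
  qed
  have "riemann_zeta (2 * of_nat k) = (\<Sum>n. of_real (1 / real (Suc n) ^ (2 * k)))"
    unfolding e[symmetric] using assms by (intro riemann_zeta_eq_suminf) simp
  thus ?thesis
    unfolding zeta_even_def using suminf_of_real[OF summable_zeta_even[OF assms], where 'a = complex] by simp
qed

lemma neg_ln_1_minus_sums:
  fixes x :: real
  assumes "0 \<le> x" "x < 1"
  shows "(\<lambda>n. x ^ Suc n / real (Suc n)) sums (- ln (1 - x))"
proof -
  have "(\<lambda>n. - ((- (- x)) ^ n) / of_nat n) sums ln (1 + - x)"
    using assms by (intro ln_series') auto
  \<comment> \<open>The term with index 0 is \<open>1 / 0 = 0\<close>.\<close>
  from sums_minus[OF this] have "(\<lambda>n. x ^ n / real n) sums (- ln (1 - x))" by simp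
  thus ?thesis by (subst sums_Suc_iff) simp
qed

text \<open>
  The logarithm of the sine product, with each \<open>ln (1 - u^2/n^2)\<close> expanded and the double series of
  nonnegative terms summed in the other order. The exchange of the two sums is an exchange of a sum with
  an integral over the counting measure.
\<close>

lemma neg_ln_sinc_sums:
  fixes u :: real
  assumes u: "0 < u" "u < 1"
  shows "(\<lambda>j. zeta_even (Suc j) * u ^ (2 * Suc j) / real (Suc j)) sums (- ln (sin (pi * u) / (pi * u)))"
proof -
  define x where "x n = u ^ 2 / real (Suc n) ^ 2" for n
  have x: "0 \<le> x n" "x n < 1" for n
  proof -
    have "u ^ 2 < 1 ^ 2" using u by (intro power_strict_mono) auto
    also have "(1::real) ^ 2 \<le> real (Suc n) ^ 2" by (intro power_mono) auto
    finally show "x n < 1" by (simp add: x_def divide_less_eq del: of_nat_Suc)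
  qed (simp add: x_def)
  define f where "f j n = x n ^ Suc j / real (Suc j)" for j n
  have f_nonneg: "f j n \<ge> 0" for j n using x(1)[of n] by (simp add: f_def)
  have f_eq: "f j n = u ^ (2 * Suc j) / real (Suc j) * (1 / real (Suc n) ^ (2 * Suc j))" for j n
    by (simp only: f_def x_def power_divide power_mult[symmetric]) simp
  have f_n: "(\<lambda>n. f j n) sums (zeta_even (Suc j) * u ^ (2 * Suc j) / real (Suc j))" for j
    using sums_mult[OF summable_sums[OF summable_zeta_even[of "Suc j"]], of "u ^ (2 * Suc j) / real (Suc j)"]
    unfolding f_eq zeta_even_def by (simp add: mult_ac)
  have f_j: "(\<lambda>j. f j n) sums (- ln (1 - x n))" for n
    unfolding f_def using x[of n] by (intro neg_ln_1_minus_sums)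
  have int: "integrable (count_space UNIV) (f j)" for j
    using f_n[of j] f_nonneg by (simp add: integrable_count_space_nat_iff sums_iff)
  have val: "(LINT n:UNIV|count_space UNIV. f j n) = zeta_even (Suc j) * u ^ (2 * Suc j) / real (Suc j)" for j
    using integral_count_space_nat[OF int[of j]] f_n[of j] by (simp add: set_lebesgue_integral_def sums_iff)
  have sm: "summable (\<lambda>j. LINT n:UNIV|count_space UNIV. f j n)"
    unfolding val
  proof (rule summable_comparison_test')
    have "u ^ 2 < 1 ^ 2" using u by (intro power_strict_mono) auto
    thus "summable (\<lambda>j. zeta_even 1 * u ^ 2 * (u ^ 2) ^ j)"
      using u by (intro summable_mult summable_geometric) auto
    fix j
    have le: "zeta_even (Suc j) * u ^ (2 * Suc j) / real (Suc j) \<le> zeta_even 1 * u ^ (2 * Suc j) / 1"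
      using u zeta_even_pos[of 1] zeta_even_le[of "Suc j"]
      by (intro frac_le mult_right_mono mult_nonneg_nonneg) auto
    have pw: "u ^ (2 * Suc j) = u ^ 2 * (u ^ 2) ^ j" by (simp add: power_mult power2_eq_square)
    have "zeta_even (Suc j) * u ^ (2 * Suc j) / real (Suc j) \<ge> 0"
      using u zeta_even_pos[of "Suc j"] by (intro divide_nonneg_nonneg mult_nonneg_nonneg) auto
    hence "norm (zeta_even (Suc j) * u ^ (2 * Suc j) / real (Suc j)) \<le> zeta_even 1 * u ^ (2 * Suc j)"
      using le by (simp only: real_norm_def abs_of_nonneg div_by_1)
    thus "norm (zeta_even (Suc j) * u ^ (2 * Suc j) / real (Suc j)) \<le> zeta_even 1 * u ^ 2 * (u ^ 2) ^ j"
      by (simp only: pw mult.assoc)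
  qed
  note S = set_integrable_sums_nonneg set_integral_sums_nonneg
  note S = S[where M = "count_space UNIV" and A = UNIV, OF _ f_nonneg f_j sm]
  have "(\<lambda>j. LINT n:UNIV|count_space UNIV. f j n) sums (LINT n:UNIV|count_space UNIV. - ln (1 - x n))"
    using int by (intro S(2)) (simp add: set_integrable_def)
  also have "(LINT n:UNIV|count_space UNIV. - ln (1 - x n)) = (\<Sum>n. - ln (1 - x n))"
    using S(1) int integral_count_space_nat[of "\<lambda>n. - ln (1 - x n)"]
    by (simp add: set_integrable_def set_lebesgue_integral_def)
  also have "\<dots> = - ln (sin (pi * u) / (pi * u))"
  proof (rule sums_unique[symmetric])
    have "sin (pi * u) > 0" using u by (intro sin_gt_zero) auto
    hence "(\<lambda>N. ln (\<Prod>k=1..N. 1 - u ^ 2 / of_nat k ^ 2)) \<longlonglongrightarrow> ln (sin (pi * u) / (pi * u))"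
      using u by (intro tendsto_ln sin_product_formula_real') auto
    also have "(\<lambda>N. ln (\<Prod>k=1..N. 1 - u ^ 2 / of_nat k ^ 2)) = (\<lambda>N. \<Sum>n<N. ln (1 - x n))"
    proof
      fix N
      have "(\<Prod>k=1..N. 1 - u ^ 2 / of_nat k ^ 2) = (\<Prod>n<N. 1 - x n)"
        by (simp add: x_def prod.atLeast1_atMost_eq)
      also have "ln \<dots> = (\<Sum>n<N. ln (1 - x n))"
        using x(2) less_imp_neq[OF x(2)] by (intro ln_prod) auto
      finally show "ln (\<Prod>k=1..N. 1 - u ^ 2 / of_nat k ^ 2) = (\<Sum>n<N. ln (1 - x n))" .
    qed
    finally have "(\<lambda>n. ln (1 - x n)) sums ln (sin (pi * u) / (pi * u))" by (simp add: sums_def)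
    thus "(\<lambda>n. - ln (1 - x n)) sums (- ln (sin (pi * u) / (pi * u)))" by (rule sums_minus)
  qed
  finally show ?thesis unfolding val .
qed

definition tan_coeff :: "nat \<Rightarrow> real" where
  "tan_coeff j = (1 - 1 / 2 ^ (2 * Suc j - 1)) * zeta_even (Suc j) / real (Suc j)"

lemma tan_coeff_pos: "tan_coeff j > 0"
proof -
  have "(1::real) < 2 ^ (2 * Suc j - 1)" by (intro one_less_power) auto
  thus ?thesis unfolding tan_coeff_def
    using zeta_even_pos[of "Suc j"] by (intro divide_pos_pos mult_pos_pos) auto
qed

lemma tan_coeff_le: "tan_coeff j \<le> zeta_even 1 / real (Suc j)"
  unfolding tan_coeff_def
proof (rule divide_right_mono)
  have "(1 - 1 / 2 ^ (2 * Suc j - 1)) * zeta_even (Suc j) \<le> 1 * zeta_even (Suc j)"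
    using zeta_even_pos[of "Suc j"] by (intro mult_right_mono) auto
  thus "(1 - 1 / 2 ^ (2 * Suc j - 1)) * zeta_even (Suc j) \<le> zeta_even 1"
    using zeta_even_le[of "Suc j"] by simp
qed simp

text \<open>
  With \<open>x = \<pi>t/2\<close> one has \<open>tan x = 2 sin(x)^2 / sin(2x)\<close>, so that the expansion for the sine suffices.
\<close>

lemma logtan_sums:
  assumes t: "0 < t" "t < 1"
  shows "(\<lambda>j. tan_coeff j * t ^ (2 * Suc j)) sums (logtan t - ln (pi / 2 * t))"
proof -
  define x where "x = pi / 2 * t"
  have x: "0 < x" "x < pi / 2" using t by (auto simp: x_def)
  have s: "sin x > 0" "cos x > 0" "sin (2 * x) > 0"
    using x by (auto intro: sin_gt_zero cos_gt_zero)
  have "(\<lambda>j. zeta_even (Suc j) * t ^ (2 * Suc j) / real (Suc j) -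
            2 * (zeta_even (Suc j) * (t / 2) ^ (2 * Suc j) / real (Suc j))) sums
        (- ln (sin (pi * t) / (pi * t)) - 2 * (- ln (sin (pi * (t / 2)) / (pi * (t / 2)))))"
    using t by (intro sums_diff sums_mult neg_ln_sinc_sums) auto
  also have "(\<lambda>j. zeta_even (Suc j) * t ^ (2 * Suc j) / real (Suc j) -
            2 * (zeta_even (Suc j) * (t / 2) ^ (2 * Suc j) / real (Suc j))) =
        (\<lambda>j. tan_coeff j * t ^ (2 * Suc j))"
  proof
    fix j
    have "2 * (t / 2) ^ (2 * Suc j) = t ^ (2 * Suc j) / 2 ^ (2 * Suc j - 1)"
      by (simp add: power_divide)
    hence "2 * (zeta_even (Suc j) * (t / 2) ^ (2 * Suc j) / real (Suc j)) =
        zeta_even (Suc j) * (t ^ (2 * Suc j) / 2 ^ (2 * Suc j - 1)) / real (Suc j)"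
      by (metis mult.left_commute times_divide_eq_right)
    thus "zeta_even (Suc j) * t ^ (2 * Suc j) / real (Suc j) -
            2 * (zeta_even (Suc j) * (t / 2) ^ (2 * Suc j) / real (Suc j)) =
        tan_coeff j * t ^ (2 * Suc j)"
      unfolding tan_coeff_def by (simp only:) (simp add: field_simps del: of_nat_Suc power_Suc mult_Suc_right)
  qed
  also have "- ln (sin (pi * t) / (pi * t)) - 2 * (- ln (sin (pi * (t / 2)) / (pi * (t / 2)))) =
      logtan t - ln (pi / 2 * t)"
  proof -
    have e: "pi * t = 2 * x" "pi * (t / 2) = x" "pi / 2 * t = x" by (simp_all add: x_def)
    have lt: "logtan t = ln (sin x) - ln (cos x)"
      unfolding logtan_def e tan_def using s by (simp add: ln_div)
    have "ln (sin (2 * x)) = ln 2 + ln (sin x) + ln (cos x)"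
      unfolding sin_double using s by (simp add: ln_mult)
    thus ?thesis unfolding e lt using s x by (simp add: ln_div ln_mult)
  qed
  finally show ?thesis .
qed

lemma
  fixes a :: real
  assumes a: "a > -1"
  shows set_integrable_powr_01: "set_integrable lborel {0<..<1} (\<lambda>t. t powr a)"
    and set_integral_powr_01: "(LBINT t:{0<..<1}. t powr a) = 1 / (a + 1)"
proof -
  have "((\<lambda>t. t powr a) has_integral 1 / (a + 1)) {0<..<1}"
    using has_integral_powr_from_0[OF a, of 1] by (simp add: has_integral_Icc_iff_Ioo)
  moreover have "set_borel_measurable lborel {0<..<1} (\<lambda>t. t powr a)"
    unfolding set_borel_measurable_def by measurable
  ultimately show "set_integrable lborel {0<..<1} (\<lambda>t. t powr a)" "(LBINT t:{0<..<1}. t powr a) = 1 / (a + 1)"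
    by (auto intro!: has_integral_nonneg_imp_set_integrable)
qed

lemma
  fixes s :: real
  assumes s: "s < 1"
  shows set_integrable_powr_neg_ln_01: "set_integrable lborel {0<..<1} (\<lambda>t. t powr (-s) * (- ln t))"
    and set_integral_powr_neg_ln_01: "(LBINT t:{0<..<1}. t powr (-s) * (- ln t)) = 1 / (1 - s) ^ 2"
proof -
  define b where "b = 1 - s"
  have b: "b > 0" using s by (simp add: b_def)
  define F where "F t = - (t powr b * ln t / b) + t powr b / b ^ 2" for t
  have "((\<lambda>t. t powr (-s) * (- ln t)) has_integral F 1 - F 0) {0..1}"
  proof (rule fundamental_theorem_of_calculus_interior)
    show "(F has_vector_derivative t powr (-s) * (- ln t)) (at t)" if "t \<in> {0<..<1}" for t
    proof -
      have t: "t > 0" using that by simp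
      have e: "t powr b / t = t powr (-s)" using t by (simp add: b_def powr_diff powr_minus_divide)
      have p: "((\<lambda>t. t powr b) has_real_derivative b * t powr (-s)) (at t)"
        using has_real_derivative_powr[OF t, of b] by (simp add: b_def)
      have "(F has_real_derivative - ((b * t powr (-s) * ln t + (1 / t) * t powr b) / b) + b * t powr (-s) / b ^ 2) (at t)"
        unfolding F_def using t by (intro DERIV_add DERIV_minus DERIV_cdivide DERIV_mult p DERIV_ln_divide)
      also have "(1 / t) * t powr b = t powr (-s)" using e by simp
      also have "- ((b * t powr (-s) * ln t + t powr (-s)) / b) + b * t powr (-s) / b ^ 2 = t powr (-s) * (- ln t)"
        using b by (simp add: power2_eq_square field_simps)
      finally show ?thesis by (simp add: has_real_derivative_iff_has_vector_derivative)
    qed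
    show "continuous_on {0..1} F"
      unfolding continuous_on_eq_continuous_within
    proof
      fix t :: real assume t: "t \<in> {0..1}"
      show "continuous (at t within {0..1}) F"
      proof (cases "t = 0")
        case True
        have "((\<lambda>t. t powr b * ln t) \<longlongrightarrow> 0) (at 0 within {0..1})"
        proof (rule Lim_null_comparison)
          have "((\<lambda>t::real. t powr (b / 2) / (b / 2)) \<longlongrightarrow> 0 powr (b / 2) / (b / 2)) (at 0 within {0..1})"
            using b by (intro tendsto_intros) (auto simp: eventually_at_filter)
          thus "((\<lambda>t::real. t powr (b / 2) / (b / 2)) \<longlongrightarrow> 0) (at 0 within {0..1})" by simp
          have "norm (t powr b * ln t) \<le> t powr (b / 2) / (b / 2)" if "t \<in> {0..1}" "t \<noteq> 0" for t
          proof (cases "t = 1")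
            case False
            hence t: "0 < t" "t < 1" using that by auto
            have "norm (t powr b * ln t) = t powr b * (- ln t)"
              using t ln_less_zero[of t] by (simp add: abs_mult)
            also have "\<dots> \<le> t powr b * (t powr (- (b / 2)) / (b / 2))"
              using t b by (intro mult_left_mono neg_ln_le_powr) auto
            also have "\<dots> = t powr (b + - (b / 2)) / (b / 2)" by (simp only: powr_add times_divide_eq_right)
            finally show ?thesis by simp
          qed (use b in auto)
          thus "\<forall>\<^sub>F t in at 0 within {0..1}. norm (t powr b * ln t) \<le> t powr (b / 2) / (b / 2)"
            by (auto simp: eventually_at_filter)
        qed
        moreover have "((\<lambda>t::real. t powr b) \<longlongrightarrow> 0 powr b) (at 0 within {0..1})"
          using b by (intro tendsto_intros) (auto simp: eventually_at_filter)
        ultimately have "(F \<longlongrightarrow> - (0 / b) + 0 powr b / b ^ 2) (at 0 within {0..1})"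
          unfolding F_def using b by (intro tendsto_add tendsto_minus tendsto_divide tendsto_const) auto
        thus ?thesis using True by (simp add: continuous_within F_def)
      next
        case False
        thus ?thesis unfolding F_def using t b by (intro continuous_intros) auto
      qed
    qed
  qed auto
  also have "F 1 - F 0 = 1 / (1 - s) ^ 2" by (simp add: F_def b_def)
  finally have I: "((\<lambda>t. t powr (-s) * (- ln t)) has_integral 1 / (1 - s) ^ 2) {0<..<1}"
    by (simp add: has_integral_Icc_iff_Ioo)
  have "set_borel_measurable lborel {0<..<1} (\<lambda>t. t powr (-s) * (- ln t))"
    unfolding set_borel_measurable_def by measurable
  from has_integral_nonneg_imp_set_integrable[OF this _ _ I]
  show "set_integrable lborel {0<..<1} (\<lambda>t. t powr (-s) * (- ln t))"
    "(LBINT t:{0<..<1}. t powr (-s) * (- ln t)) = 1 / (1 - s) ^ 2"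
    by (auto simp: mult_nonneg_nonpos)
qed

text \<open>
  The integral of \<open>t^(-s) ln (\<pi>t/2)\<close> supplies the first two terms, termwise integration of the power
  series the remaining ones.
\<close>

lemma set_integral_powr_logtan:
  fixes s :: real
  assumes s: "s < 1"
  shows "(LBINT t:{0<..<1}. t powr (-s) * logtan t) =
     ln (pi / 2) / (1 - s) - 1 / (1 - s) ^ 2 + (\<Sum>j. tan_coeff j / (2 * real (Suc j) + 1 - s))"
proof -
  define f where "f j t = tan_coeff j * t powr (2 * real (Suc j) - s)" for j t
  have f_int: "set_integrable lborel {0<..<1} (f j)" for j
    unfolding f_def using s by (intro set_integrable_mult_right set_integrable_powr_01) auto
  have f_nonneg: "f j t \<ge> 0" for j t
    using tan_coeff_pos[of j] by (simp add: f_def)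
  have f_sums: "(\<lambda>j. f j t) sums (t powr (-s) * (logtan t - ln (pi / 2 * t)))" if t: "t \<in> {0<..<1}" for t
  proof -
    have "t powr (2 * real (Suc j) - s) = t powr (-s) * t ^ (2 * Suc j)" for j
    proof -
      have "t powr (2 * real (Suc j) - s) = t powr (-s) * t powr real (2 * Suc j)"
        by (simp add: powr_add[symmetric])
      thus ?thesis using t by (subst (asm) powr_realpow) auto
    qed
    thus ?thesis using sums_mult[OF logtan_sums[of t], of "t powr (-s)"] t
      by (simp add: f_def mult_ac del: of_nat_Suc power_Suc mult_Suc_right)
  qed
  have f_val: "(LBINT t:{0<..<1}. f j t) = tan_coeff j / (2 * real (Suc j) + 1 - s)" for j
  proof -
    have "(LBINT t:{0<..<1}. f j t) = tan_coeff j * (1 / (2 * real (Suc j) - s + 1))"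
      unfolding f_def set_integral_mult_right using s by (subst set_integral_powr_01) auto
    thus ?thesis by (simp add: algebra_simps)
  qed
  have sm: "summable (\<lambda>j. LBINT t:{0<..<1}. f j t)"
  proof (rule summable_comparison_test')
    show "summable (\<lambda>j. zeta_even 1 * real (Suc j) powr (-2))"
      by (intro summable_mult summable_Suc_powr) auto
    fix j
    have "tan_coeff j / (2 * real (Suc j) + 1 - s) \<le> (zeta_even 1 / real (Suc j)) / real (Suc j)"
      using tan_coeff_le[of j] tan_coeff_pos[of j] zeta_even_pos[of 1] s
      by (intro frac_le divide_nonneg_nonneg) auto
    also have "\<dots> = zeta_even 1 * real (Suc j) powr (-2)"
      by (simp add: powr_minus divide_inverse power2_eq_square)
    finally show "norm (LBINT t:{0<..<1}. f j t) \<le> zeta_even 1 * real (Suc j) powr (-2)"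
      using tan_coeff_pos[of j] s by (simp add: f_val)
  qed
  note S = set_integrable_sums_nonneg[OF f_int f_nonneg f_sums sm] set_integral_sums_nonneg[OF f_int f_nonneg f_sums sm]
  note int = S(1)
  have val: "(LBINT t:{0<..<1}. t powr (-s) * (logtan t - ln (pi / 2 * t))) =
      (\<Sum>j. tan_coeff j / (2 * real (Suc j) + 1 - s))"
    using sums_unique[OF S(2)] unfolding f_val by simp
  have i1: "set_integrable lborel {0<..<1} (\<lambda>t. ln (pi / 2) * t powr (-s))"
    using s by (intro set_integrable_mult_right set_integrable_powr_01) auto
  note i2 = set_integrable_powr_neg_ln_01[OF s]
  have "(LBINT t:{0<..<1}. t powr (-s) * logtan t) =
      (LBINT t:{0<..<1}. (ln (pi / 2) * t powr (-s) - t powr (-s) * (- ln t)) + t powr (-s) * (logtan t - ln (pi / 2 * t)))"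
  proof (intro set_lebesgue_integral_cong allI impI)
    fix t :: real assume "t \<in> {0<..<1}"
    hence "ln (pi / 2 * t) = ln (pi / 2) + ln t" using ln_mult_pos[of "pi / 2" t] by simp
    thus "t powr (-s) * logtan t = (ln (pi / 2) * t powr (-s) - t powr (-s) * (- ln t)) + t powr (-s) * (logtan t - ln (pi / 2 * t))"
      by (simp add: algebra_simps)
  qed auto
  also have "\<dots> = (LBINT t:{0<..<1}. ln (pi / 2) * t powr (-s) - t powr (-s) * (- ln t)) +
      (LBINT t:{0<..<1}. t powr (-s) * (logtan t - ln (pi / 2 * t)))"
    by (intro set_integral_add set_integral_diff i1 i2 int)
  also have "(LBINT t:{0<..<1}. ln (pi / 2) * t powr (-s) - t powr (-s) * (- ln t)) =
      (LBINT t:{0<..<1}. ln (pi / 2) * t powr (-s)) - (LBINT t:{0<..<1}. t powr (-s) * (- ln t))"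
    by (intro set_integral_diff i1 i2)
  also have "(LBINT t:{0<..<1}. ln (pi / 2) * t powr (-s)) = ln (pi / 2) * (1 / (- s + 1))"
    unfolding set_integral_mult_right using s by (subst set_integral_powr_01) auto
  finally show ?thesis unfolding val set_integral_powr_neg_ln_01[OF s] by simp
qed

section \<open>The meromorphic continuation and its poles\<close>

text \<open>
  The simple fractions in the continuation of \<open>G\<close>. The index set \<open>S\<close> allows one of them to be left
  out of the series, which isolates the polar part at one point.
\<close>

definition tan_term :: "nat set \<Rightarrow> complex \<Rightarrow> nat \<Rightarrow> complex" where
  "tan_term S z j = (if j \<in> S then of_real (tan_coeff j) / (of_nat (2 * j + 3) - z) else 0)"

definition tan_series :: "nat set \<Rightarrow> complex \<Rightarrow> complex" where
  "tan_series S z = (\<Sum>j. tan_term S z j)"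

lemma tan_series_term_le:
  fixes w :: complex
  assumes "norm w \<le> real j + 1"
  shows "norm (tan_term S w j)
           \<le> zeta_even 1 * real (Suc j) powr (-2)"
proof -
  have "real (Suc j) \<le> real (2 * j + 3) - norm w" using assms by simp
  also have "\<dots> \<le> norm (of_nat (2 * j + 3) - w)"
    using norm_triangle_ineq2[of "of_nat (2 * j + 3)" w] by (simp only: norm_of_nat)
  finally have "norm (of_real (tan_coeff j) / (of_nat (2 * j + 3) - w)) \<le> (zeta_even 1 / real (Suc j)) / real (Suc j)"
    unfolding norm_divide using tan_coeff_le[of j] tan_coeff_pos[of j] zeta_even_pos[of 1]
    by (intro frac_le divide_nonneg_nonneg) auto
  also have "\<dots> = zeta_even 1 * real (Suc j) powr (-2)"
    by (simp add: powr_minus divide_inverse power2_eq_square)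
  finally show ?thesis using zeta_even_pos[of 1] by (simp add: tan_term_def)
qed

lemma summable_zeta_even_inverse_squares: "summable (\<lambda>j. zeta_even 1 * real (Suc j) powr (-2))"
  by (intro summable_mult summable_Suc_powr) auto

lemma summable_tan_series:
  fixes z :: complex
  shows "summable (\<lambda>j. tan_term S z j)"
proof (rule summable_comparison_test'[OF summable_zeta_even_inverse_squares, of "nat \<lceil>norm z\<rceil>"])
  fix j assume "j \<ge> nat \<lceil>norm z\<rceil>"
  hence "norm z \<le> real j + 1" by linarith
  thus "norm (tan_term S z j)
           \<le> zeta_even 1 * real (Suc j) powr (-2)"
    by (rule tan_series_term_le)
qed

lemma open_tan_series_domain: "open (- ((\<lambda>j. complex_of_nat (2 * j + 3)) ` S))"
proof -
  have "closed (complex_of_nat ` ((\<lambda>j. 2 * j + 3) ` S))" by (rule closed_of_nat_image)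
  thus ?thesis unfolding image_image by (rule open_Compl)
qed

lemma holomorphic_tan_series:
  "tan_series S holomorphic_on - ((\<lambda>j. of_nat (2 * j + 3)) ` S)"
  unfolding tan_series_def[abs_def]
proof (rule holomorphic_suminf[OF open_tan_series_domain])
  show "(\<lambda>z. tan_term S z j)
          holomorphic_on - ((\<lambda>j. of_nat (2 * j + 3)) ` S)" for j
    unfolding tan_term_def by (cases "j \<in> S") (auto intro!: holomorphic_intros simp del: of_nat_add of_nat_mult)
  fix z :: complex
  have "norm (tan_term S w j)
           \<le> zeta_even 1 * real (Suc j) powr (-2)" if "j \<ge> nat \<lceil>norm z\<rceil>" "w \<in> cball z 1" for j w
  proof (rule tan_series_term_le)
    have "norm w \<le> norm z + dist z w" using norm_triangle_sub[of w z] by (simp add: dist_norm norm_minus_commute)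
    thus "norm w \<le> real j + 1" using that by simp
  qed
  thus "\<exists>r>0. \<exists>M. summable M \<and> (\<forall>\<^sub>F j in sequentially. \<forall>w\<in>cball z r \<inter> - ((\<lambda>j. of_nat (2 * j + 3)) ` S).
      norm (tan_term S w j) \<le> M j)"
    by (intro exI[of _ 1] conjI exI[of _ "\<lambda>j. zeta_even 1 * real (Suc j) powr (-2)"] summable_zeta_even_inverse_squares
          eventually_sequentiallyI[of "nat \<lceil>norm z\<rceil>"]) auto
qed

lemma tan_series_split:
  "tan_series UNIV z = of_real (tan_coeff j) / (of_nat (2 * j + 3) - z) + tan_series (- {j}) z"
proof -
  have "(\<lambda>i. (if i = j then tan_term UNIV z i else 0) + tan_term (- {j}) z i) sums
      (tan_term UNIV z j + tan_series (- {j}) z)"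
    unfolding tan_series_def by (intro sums_add sums_single summable_sums summable_tan_series)
  also have "(\<lambda>i. (if i = j then tan_term UNIV z i else 0) + tan_term (- {j}) z i) = tan_term UNIV z"
    by (auto simp: tan_term_def)
  finally have "tan_series UNIV z = tan_term UNIV z j + tan_series (- {j}) z"
    unfolding tan_series_def by (rule sums_unique[symmetric])
  thus ?thesis by (simp only: tan_term_def UNIV_I if_True)
qed

lemma riemann_zeta_term_eq:
  "(let k = Suc j in (1 - 1 / 2 ^ (2 * k - 1)) * (riemann_zeta (2 * of_nat k) / (of_nat k * (2 * of_nat k + 1 - z)))) =
     tan_term UNIV z j"
proof -
  have "riemann_zeta (2 * of_nat (Suc j)) = of_real (zeta_even (Suc j))"
    by (rule riemann_zeta_even) simp
  moreover have "2 * of_nat (Suc j) + 1 - z = of_nat (2 * j + 3) - z" by simp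
  ultimately show ?thesis
    unfolding Let_def tan_term_def tan_coeff_def by (simp only:) simp
qed

text \<open>
  The right-hand side of the formula in part (ii), with \<open>rGamma\<close> in place of \<open>1 / Gamma\<close>. It is
  meaningful for \<open>Re z > 0\<close>, and so overlaps the half-plane \<open>Re z < 1\<close> where \<open>G_fun\<close> is an integral.
\<close>

definition G_cont :: "complex \<Rightarrow> complex" where
  "G_cont z = - (of_real pi / 2) * (1 / (1 - z) ^ 2)
     + of_real pi / 2 * (of_real (ln (pi / 2)) / (1 - z))
     + of_real pi / 2 * tan_series UNIV z
     - 1 / of_real pi * rGamma z * mellin_exp_w z"

text \<open>
  On the strip both expressions are finite. For real arguments the two parts of \<open>\<zeta>(s,t)\<close> give the
  elementary terms with the series, and the Mellin integral, respectively.
\<close>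

lemma G_fun_eq_G_cont:
  assumes z: "0 < Re z" "Re z < 1"
  shows "G_fun z = G_cont z"
proof (rule holomorphic_eq_of_real_eq[where f = G_fun and g = G_cont and a = 0 and b = 1 and
      U = "{z. Re z > 0} \<inter> {z. Re z < 1}"])
  show "G_fun holomorphic_on {z. Re z > 0} \<inter> {z. Re z < 1}"
    unfolding G_fun_eq[abs_def]
    by (intro holomorphic_intros holomorphic_on_subset[OF holomorphic_hurwitz_logtan]) auto
  have "tan_series UNIV holomorphic_on {z. Re z > 0} \<inter> {z. Re z < 1}"
    by (rule holomorphic_on_subset[OF holomorphic_tan_series]) auto
  moreover have "mellin_exp_w holomorphic_on {z. Re z > 0} \<inter> {z. Re z < 1}"
    by (rule holomorphic_on_subset[OF holomorphic_mellin_exp_w]) auto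
  ultimately show "G_cont holomorphic_on {z. Re z > 0} \<inter> {z. Re z < 1}"
    unfolding G_cont_def[abs_def] by (intro holomorphic_intros) auto
  show "connected ({z. Re z > 0} \<inter> {z. Re z < 1})"
    by (intro convex_connected convex_Int convex_halfspace_Re_lt convex_halfspace_Re_gt)
  fix s :: real assume s: "0 < s" "s < 1"
  define T where "T = (\<Sum>j. tan_coeff j / (2 * real (Suc j) + 1 - s))"
  have T: "tan_series UNIV (of_real s) = of_real T"
  proof -
    have e: "tan_term UNIV (of_real s) j =
        complex_of_real (tan_coeff j / (2 * real (Suc j) + 1 - s))" for j
      by (simp add: tan_term_def)
    have "summable (\<lambda>j. complex_of_real (tan_coeff j / (2 * real (Suc j) + 1 - s)))"
      using summable_tan_series[of UNIV "of_real s"] unfolding e .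
    hence "summable (\<lambda>j. tan_coeff j / (2 * real (Suc j) + 1 - s))"
      by (simp only: summable_complex_of_real)
    thus ?thesis unfolding tan_series_def e T_def by (rule suminf_of_real[symmetric])
  qed
  have "G_fun (of_real s) = of_real (pi / 2) *
      (of_real (ln (pi / 2) / (1 - s) - 1 / (1 - s) ^ 2 + T)
        - of_real (2 / pi ^ 2) * rGamma (of_real s) * mellin_exp_w (of_real s))"
    unfolding G_fun_eq hurwitz_logtan_of_real[OF s] set_integral_powr_logtan[OF s(2)] T_def ..
  also have "\<dots> = of_real (pi / 2) * of_real (ln (pi / 2) / (1 - s) - 1 / (1 - s) ^ 2 + T)
        - of_real (pi / 2 * (2 / pi ^ 2)) * rGamma (of_real s) * mellin_exp_w (of_real s)"
    by (simp only: right_diff_distrib of_real_mult mult.assoc)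
  also have "pi / 2 * (2 / pi ^ 2) = 1 / pi" by (simp add: power2_eq_square)
  finally show "G_fun (of_real s) = G_cont (of_real s)"
    unfolding G_cont_def T by (simp add: ring_distribs)
qed (use z in \<open>auto intro!: open_Int open_Re_less_1 open_Re_greater_0\<close>)

lemma odd_nat_set_eq:
  "{2 * of_nat n - 1 | n::nat. n \<ge> 1} = insert (1::complex) ((\<lambda>j. of_nat (2 * j + 3)) ` UNIV)"
proof (intro equalityI subsetI)
  fix z :: complex assume "z \<in> {2 * of_nat n - 1 | n::nat. n \<ge> 1}"
  then obtain n :: nat where n: "n \<ge> 1" "z = 2 * of_nat n - 1" by auto
  show "z \<in> insert 1 ((\<lambda>j. of_nat (2 * j + 3)) ` UNIV)"
  proof (cases "n = 1")
    case False
    then obtain j where "n = j + 2" using n(1) that[of "n - 2"] by simp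
    hence "z = of_nat (2 * j + 3)" using n(2) by simp
    thus ?thesis by blast
  qed (use n in auto)
next
  fix z :: complex assume "z \<in> insert 1 ((\<lambda>j. of_nat (2 * j + 3)) ` UNIV)"
  then consider "z = 1" | j where "z = of_nat (2 * j + 3)" by auto
  thus "z \<in> {2 * of_nat n - 1 | n::nat. n \<ge> 1}"
  proof cases
    case 1
    thus ?thesis by (intro CollectI exI[of _ 1]) auto
  next
    case (2 j)
    thus ?thesis by (intro CollectI exI[of _ "j + 2"]) auto
  qed
qed

lemma holomorphic_G_cont:
  "G_cont holomorphic_on {z. Re z > 0} - {2 * of_nat n - 1 | n::nat. n \<ge> 1}"
  unfolding odd_nat_set_eq G_cont_def[abs_def]
  by (intro holomorphic_intros holomorphic_on_subset[OF holomorphic_tan_series]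
        holomorphic_on_subset[OF holomorphic_mellin_exp_w]) auto

text \<open>
  At 1 the series and the Mellin integral are regular, so that the double pole of the first term is not
  affected by the other ones.
\<close>

lemma is_pole_G_cont_1: "is_pole G_cont 1"
proof (rule is_pole_divide_power)
  let ?U = "{z. Re z > 0} \<inter> - ((\<lambda>j. of_nat (2 * j + 3)) ` UNIV)"
  let ?f = "\<lambda>z. - (of_real pi / 2) + of_real pi / 2 * of_real (ln (pi / 2)) * (1 - z)
      + (1 - z) ^ 2 * (of_real pi / 2 * tan_series UNIV z - 1 / of_real pi * rGamma z * mellin_exp_w z)"
  show "?f holomorphic_on ?U"
    by (intro holomorphic_intros holomorphic_on_subset[OF holomorphic_tan_series]
        holomorphic_on_subset[OF holomorphic_mellin_exp_w]) auto
  show "open ?U" by (intro open_Int open_Re_greater_0 open_tan_series_domain)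
  have "1 \<noteq> complex_of_nat (2 * j + 3)" for j
    using of_nat_eq_iff[of 1 "2 * j + 3", where 'a = complex] unfolding of_nat_1 by simp
  thus "1 \<in> ?U" by auto
  fix z :: complex assume "z \<noteq> 1"
  have "(- a + a * b * d + d ^ 2 * c) / d ^ 2 = - a * (1 / d ^ 2) + a * (b / d) + c"
    if "d \<noteq> 0" for a b c d :: complex
    using that by (simp add: add_divide_distrib diff_divide_distrib power2_eq_square)
  from this[of "1 - z"] show "G_cont z = ?f z / (1 - z) ^ 2"
    using \<open>z \<noteq> 1\<close> unfolding G_cont_def by (simp only: right_minus_eq add_diff_eq)
qed auto

text \<open>
  At \<open>2j + 3\<close> exactly one fraction of the series is singular, and its coefficient \<open>tan_coeff j\<close> is positive.
\<close>

lemma is_pole_G_cont_odd: "is_pole G_cont (of_nat (2 * j + 3))"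
proof (rule is_pole_divide_power)
  let ?a = "complex_of_nat (2 * j + 3)"
  let ?U = "{z. Re z > 0} \<inter> - ((\<lambda>j. of_nat (2 * j + 3)) ` (- {j})) \<inter> - {1}"
  let ?h = "\<lambda>z. - (of_real pi / 2) * (1 / (1 - z) ^ 2) + of_real pi / 2 * (of_real (ln (pi / 2)) / (1 - z))
      + of_real pi / 2 * tan_series (- {j}) z - 1 / of_real pi * rGamma z * mellin_exp_w z"
  let ?f = "\<lambda>z. of_real pi / 2 * of_real (tan_coeff j) + (?a - z) * ?h z"
  show "?f holomorphic_on ?U"
    by (intro holomorphic_intros holomorphic_on_subset[OF holomorphic_tan_series]
        holomorphic_on_subset[OF holomorphic_mellin_exp_w]) auto
  show "open ?U" by (intro open_Int open_Re_greater_0 open_tan_series_domain open_Compl) auto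
  have "?a \<noteq> 1" using of_nat_eq_iff[of "2 * j + 3" 1, where 'a = complex] unfolding of_nat_1 by simp
  moreover have "?a \<notin> (\<lambda>j. of_nat (2 * j + 3)) ` (- {j})"
    by (auto simp only: of_nat_eq_iff image_iff)
  ultimately show "?a \<in> ?U" by simp
  show "?f ?a \<noteq> 0" using tan_coeff_pos[of j] by simp
  fix z assume z: "z \<noteq> ?a"
  hence "?f z / (?a - z) ^ 1 = of_real pi / 2 * (of_real (tan_coeff j) / (?a - z)) + ?h z"
    by (simp add: add_divide_distrib)
  also have "\<dots> = G_cont z"
    unfolding G_cont_def tan_series_split[of z j] by (simp add: ring_distribs)
  finally show "G_cont z = ?f z / (?a - z) ^ 1" ..
qed simp

text \<open>
  The integral and the formula agree on the strip, which both half-planes contain, so that they glue to one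
  holomorphic function.
\<close>

lemma G_continuation:
  "\<exists>F. F holomorphic_on (UNIV - {2 * of_nat n - 1 | n::nat. n \<ge> 1}) \<and>
       (\<forall>n::nat. n \<ge> 1 \<longrightarrow> is_pole F (2 * of_nat n - 1)) \<and>
       (\<forall>z. Re z < 1 \<longrightarrow> F z = G_fun z) \<and>
       (\<forall>z. Re z \<ge> 1 \<longrightarrow> F z = G_cont z)"
proof -
  let ?D = "{2 * of_nat n - 1 | n::nat. n \<ge> 1} :: complex set"
  define F where "F z = (if Re z < 1 then G_fun z else G_cont z)" for z
  have F_pos: "F z = G_cont z" if "Re z > 0" for z
    using G_fun_eq_G_cont[of z] that by (simp add: F_def)
  have "G_fun holomorphic_on {z. Re z < 1}"
    unfolding G_fun_eq[abs_def] by (intro holomorphic_intros holomorphic_hurwitz_logtan)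
  hence "F holomorphic_on {z. Re z < 1}"
    by (rule holomorphic_transform) (simp add: F_def)
  moreover have "F holomorphic_on {z. Re z > 0} - ?D"
    by (rule holomorphic_transform[OF holomorphic_G_cont]) (use F_pos in auto)
  moreover have "open ({z. Re z > 0} - ?D)"
  proof -
    have "closed ?D" unfolding odd_nat_set_eq
      using open_tan_series_domain[of UNIV] by (intro closed_insert) (simp only: closed_def)
    thus ?thesis by (intro open_Diff open_Re_greater_0)
  qed
  ultimately have "F holomorphic_on {z. Re z < 1} \<union> ({z. Re z > 0} - ?D)"
    by (intro holomorphic_on_Un open_Re_less_1)
  hence hol: "F holomorphic_on UNIV - ?D"
    by (rule holomorphic_on_subset) auto
  have pole: "is_pole F (2 * of_nat n - 1)" if "n \<ge> 1" for n :: nat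
  proof -
    let ?a = "2 * complex_of_nat n - 1"
    have "?a \<in> ?D" using that by blast
    hence "is_pole G_cont ?a"
      unfolding odd_nat_set_eq using is_pole_G_cont_1 is_pole_G_cont_odd
      by (elim insertE imageE) (simp_all only:)
    moreover have "\<forall>\<^sub>F z in nhds ?a. z \<in> {z. Re z > 0}"
      using that by (intro eventually_nhds_in_open open_Re_greater_0) auto
    hence "\<forall>\<^sub>F z in at ?a. F z = G_cont z"
      by (auto simp: eventually_at_filter F_pos elim: eventually_mono)
    ultimately show ?thesis using is_pole_cong by blast
  qed
  show ?thesis using hol pole by (intro exI[of _ F]) (auto simp: F_def)
qed

lemma zeta_h_eq_integral:
  assumes s: "Re s > 1" and odd: "\<not> (\<exists>m::int. odd m \<and> s = of_int m)"
  shows "zeta_h s = of_real (2 * pi) powr (s - 1) / (2 * Gamma (s - 1) * cos (of_real pi / 2 * s)) * G_fun (2 - s)"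
proof -
  have cos0: "cos (of_real pi / 2 * s) \<noteq> 0"
  proof
    assume "cos (of_real pi / 2 * s) = 0"
    then obtain n :: int where "of_real pi / 2 * s = of_int n * of_real pi + of_real pi / 2"
      by (auto simp: cos_eq_0)
    hence "of_real pi * s = of_real pi * of_int (2 * n + 1)" by (simp add: field_simps)
    hence "s = of_int (2 * n + 1)" by (subst (asm) mult_cancel_left) simp
    moreover have "odd (2 * n + 1)" by simp
    ultimately show False using odd by blast
  qed
  have Gamma0: "Gamma (s - 1) \<noteq> 0"
    using s by (subst Gamma_eq_zero_iff) (auto elim!: nonpos_Ints_cases simp: complex_eq_iff)
  have cos_refl: "cos (of_real pi / 2 * (2 - s)) = - cos (of_real pi / 2 * s)"
    by (simp add: right_diff_distrib cos_diff sin_of_real cos_of_real)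
  have "G_fun (2 - s) = of_real (pi / 2) * (- of_real (2 / pi ^ 2) *
      (- cos (of_real pi / 2 * s) * (Gamma (s - 1) * of_real (2 * pi) powr (2 - s) * zeta_h s)))"
  proof -
    have e: "1 - (2 - s) = s - 1" "2 - (2 - s) = s" by simp_all
    have "Re (2 - s) < 1" using s by simp
    from hurwitz_logtan_eq_zeta_h[OF this] show ?thesis
      unfolding G_fun_eq cos_refl e by simp
  qed
  also have "\<dots> = of_real (1 / pi) * cos (of_real pi / 2 * s) * Gamma (s - 1) * of_real (2 * pi) powr (2 - s) * zeta_h s"
    by (simp add: power2_eq_square)
  finally have G: "G_fun (2 - s) = of_real (1 / pi) * cos (of_real pi / 2 * s) * Gamma (s - 1) * of_real (2 * pi) powr (2 - s) * zeta_h s" .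
  have pw: "of_real (2 * pi) powr (s - 1) * of_real (2 * pi) powr (2 - s) = complex_of_real (2 * pi)"
    by (simp add: powr_add[symmetric])
  have "of_real (2 * pi) powr (s - 1) / (2 * Gamma (s - 1) * cos (of_real pi / 2 * s)) * G_fun (2 - s) =
      (of_real (2 * pi) powr (s - 1) * of_real (2 * pi) powr (2 - s)) / 2 * of_real (1 / pi) * zeta_h s"
    unfolding G using cos0 Gamma0 by simp
  also have "\<dots> = zeta_h s" unfolding pw by simp
  finally show ?thesis ..
qed

text \<open>
  The product rule at a zero of the cosine leaves only the term in which the cosine is differentiated.
\<close>

lemma zeta_h_odd_eq_integral:
  assumes n: "n \<ge> 1"
  shows "zeta_h (2 * of_nat n + 1) = (-1) ^ n * 2 ^ (2 * n) * of_real pi ^ (2 * n - 1) / fact (2 * n - 1) *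
    (of_real (pi / 2) * (LBINT t:{0<..<1}. hurwitz_zeta' (1 - 2 * of_nat n) t * of_real (logtan t)))"
proof -
  define z0 :: complex where "z0 = 1 - 2 * of_nat n"
  have z0: "Re z0 < 1" using n by (simp add: z0_def)
  define H where "H z = Gamma (1 - z) * of_real (2 * pi) powr z * zeta_h (2 - z)" for z
  define I where "I = (LBINT t:{0<..<1}. hurwitz_zeta' z0 t * of_real (logtan t))"
  have cos0: "cos (of_real pi / 2 * z0) = 0" and sin0: "sin (of_real pi / 2 * z0) = (-1) ^ n"
  proof -
    have e: "of_real pi / 2 * z0 = complex_of_real (pi / 2 - real n * pi)"
      by (simp add: z0_def algebra_simps)
    show "cos (of_real pi / 2 * z0) = 0"
      unfolding e cos_of_real by (simp add: cos_diff)
    show "sin (of_real pi / 2 * z0) = (-1) ^ n"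
      unfolding e sin_of_real by (simp add: sin_diff cos_npi)
  qed
  have "(zeta_h \<circ> (\<lambda>z. 2 - z)) holomorphic_on {z. Re z < 1}"
    by (rule holomorphic_on_compose_gen[OF _ holomorphic_zeta_h]) (auto intro!: holomorphic_intros)
  hence "(\<lambda>z. zeta_h (2 - z)) holomorphic_on {z. Re z < 1}" by (simp add: o_def)
  hence "H holomorphic_on {z. Re z < 1}" unfolding H_def
    by (intro holomorphic_intros) (auto elim!: nonpos_Ints_cases simp: complex_eq_iff)
  then obtain H' where H': "(H has_field_derivative H') (at z0)"
    using z0 open_Re_less_1 by (metis holomorphic_derivI mem_Collect_eq)
  have dcos: "((\<lambda>z. cos (of_real pi / 2 * z)) has_field_derivative - sin (of_real pi / 2 * z0) * (of_real pi / 2)) (at z0)"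
    by (auto intro!: derivative_eq_intros)
  have "((\<lambda>z. - of_real (2 / pi ^ 2) * (cos (of_real pi / 2 * z) * H z)) has_field_derivative
      - of_real (2 / pi ^ 2) * (- sin (of_real pi / 2 * z0) * (of_real pi / 2) * H z0 + H' * cos (of_real pi / 2 * z0))) (at z0)"
    by (intro DERIV_cmult DERIV_mult dcos H')
  moreover have "\<forall>\<^sub>F z in nhds z0. hurwitz_logtan z = - of_real (2 / pi ^ 2) * (cos (of_real pi / 2 * z) * H z)"
  proof -
    have "\<forall>\<^sub>F z in nhds z0. z \<in> {z. Re z < 1}"
      using z0 by (intro eventually_nhds_in_open open_Re_less_1) auto
    thus ?thesis by eventually_elim (simp add: hurwitz_logtan_eq_zeta_h H_def)
  qed
  ultimately have "(hurwitz_logtan has_field_derivative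
      - of_real (2 / pi ^ 2) * (- sin (of_real pi / 2 * z0) * (of_real pi / 2) * H z0 + H' * cos (of_real pi / 2 * z0))) (at z0)"
    by (subst DERIV_cong_ev[OF refl _ refl])
  with hurwitz_logtan_has_derivative[OF z0]
  have "I = - of_real (2 / pi ^ 2) * (- sin (of_real pi / 2 * z0) * (of_real pi / 2) * H z0 + H' * cos (of_real pi / 2 * z0))"
    unfolding I_def by (rule DERIV_unique)
  also have "\<dots> = of_real (1 / pi) * (-1) ^ n * H z0"
    unfolding cos0 sin0 by (simp add: power2_eq_square)
  also have "H z0 = fact (2 * n - 1) * (of_real ((2 * pi) powr (1 - 2 * real n)) * zeta_h (2 * of_nat n + 1))"
  proof -
    have "Gamma (1 - z0) = fact (2 * n - 1)"
      using n Gamma_fact[of "2 * n - 1", where 'a = complex] by (simp add: z0_def of_nat_diff)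
    moreover have "of_real (2 * pi) powr z0 = complex_of_real ((2 * pi) powr (1 - 2 * real n))"
      using powr_of_real[of "2 * pi" "1 - 2 * real n"] by (simp add: z0_def)
    ultimately show ?thesis by (simp add: H_def z0_def algebra_simps)
  qed
  finally have I: "I = of_real (1 / pi) * (-1) ^ n *
      (fact (2 * n - 1) * (of_real ((2 * pi) powr (1 - 2 * real n)) * zeta_h (2 * of_nat n + 1)))" .
  have pw: "2 ^ (2 * n) * pi ^ (2 * n - 1) * (2 * pi) powr (1 - 2 * real n) = 2"
  proof -
    have "(2 * pi) powr (1 - 2 * real n) = inverse ((2 * pi) ^ (2 * n - 1))"
      using n powr_minus[of "2 * pi" "real (2 * n - 1)"] powr_realpow[of "2 * pi" "2 * n - 1"]
      by (simp add: of_nat_diff)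
    moreover have "2 ^ (2 * n) * pi ^ (2 * n - 1) = 2 * (2 * pi) ^ (2 * n - 1)"
      using n by (cases n) (auto simp: power_mult_distrib)
    moreover have "2 * (2 * pi) ^ (2 * n - 1) * inverse ((2 * pi) ^ (2 * n - 1)) = 2"
      by (simp only: mult.assoc, subst right_inverse) auto
    ultimately show ?thesis by (simp only:)
  qed
  have "(-1) ^ n * 2 ^ (2 * n) * of_real pi ^ (2 * n - 1) / fact (2 * n - 1) * (of_real (pi / 2) * I) =
      ((-1) ^ n * (-1) ^ n) * (fact (2 * n - 1) / fact (2 * n - 1)) * (of_real (pi / 2) * of_real (1 / pi)) *
      complex_of_real (2 ^ (2 * n) * pi ^ (2 * n - 1) * (2 * pi) powr (1 - 2 * real n)) * zeta_h (2 * of_nat n + 1)"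
    unfolding I by simp
  also have "\<dots> = zeta_h (2 * of_nat n + 1)"
    unfolding pw by (simp add: power_mult_distrib[symmetric])
  finally show ?thesis unfolding I_def z0_def ..
qed

theorem mainTheorem4:
  shows
    "(\<forall>s::complex. Re s > 1 \<and> \<not> (\<exists>m::int. odd m \<and> s = of_int m) \<longrightarrow>
        set_integrable lborel {0<..<pi/2}
          (\<lambda>x. hurwitz_zeta (2 - s) (2 / pi * x) * of_real (ln (tan x))) \<and>
        zeta_h s =
          of_real (2 * pi) powr (s - 1) / (2 * Gamma (s - 1) * cos (of_real pi / 2 * s))
          * (LBINT x:{0<..<pi/2}. hurwitz_zeta (2 - s) (2 / pi * x) * of_real (ln (tan x)))) \<and>
     (\<forall>n::nat. n \<ge> 1 \<longrightarrow>
        set_integrable lborel {0<..<pi/2}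
          (\<lambda>x. hurwitz_zeta' (1 - 2 * of_nat n) (2 / pi * x) * of_real (ln (tan x))) \<and>
        zeta_h (2 * of_nat n + 1) =
          (-1) ^ n * 2 ^ (2 * n) * of_real pi ^ (2 * n - 1) / fact (2 * n - 1)
          * (LBINT x:{0<..<pi/2}.
               hurwitz_zeta' (1 - 2 * of_nat n) (2 / pi * x) * of_real (ln (tan x)))) \<and>
     (\<forall>z. Re z < 1 \<longrightarrow>
        set_integrable lborel {0<..<pi/2}
          (\<lambda>x. hurwitz_zeta z (2 / pi * x) * of_real (ln (tan x)))) \<and>
     (\<exists>F. F holomorphic_on (UNIV - {2 * of_nat n - 1 | n::nat. n \<ge> 1}) \<and>
        (\<forall>n::nat. n \<ge> 1 \<longrightarrow> is_pole F (2 * of_nat n - 1)) \<and>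
        (\<forall>z. Re z < 1 \<longrightarrow> F z = G_fun z) \<and>
        (\<forall>z. Re z \<ge> 1 \<and> z \<notin> {2 * of_nat n - 1 | n::nat. n \<ge> 1} \<longrightarrow>
           summable (\<lambda>j. let k = Suc j in
             (1 - 1 / 2 ^ (2 * k - 1)) *
             (riemann_zeta (2 * of_nat k) / (of_nat k * (2 * of_nat k + 1 - z)))) \<and>
           set_integrable lborel {0<..}
             (\<lambda>y. of_real (w_fun y) * of_real (exp (- y)) * of_real y powr (z - 1)) \<and>
           F z =
             - (of_real pi / 2) * (1 / (1 - z) ^ 2)
             + of_real pi / 2 * (of_real (ln (pi / 2)) / (1 - z))
             + of_real pi / 2 * (\<Sum>j. let k = Suc j in
                 (1 - 1 / 2 ^ (2 * k - 1)) *
                 (riemann_zeta (2 * of_nat k) / (of_nat k * (2 * of_nat k + 1 - z))))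
             - 1 / of_real pi * (1 / Gamma z) *
                 (LBINT y:{0<..}.
                    of_real (w_fun y) * of_real (exp (- y)) * of_real y powr (z - 1))))"
proof (intro conjI allI impI, goal_cases)
  case (1 s)
  thus ?case unfolding set_integrable_logtan_scale by (intro set_integrable_hurwitz_logtan) auto
next
  case (2 s)
  thus ?case using zeta_h_eq_integral[of s] unfolding G_fun_def by blast
next
  case (3 n)
  thus ?case unfolding set_integrable_logtan_scale by (intro set_integrable_hurwitz'_logtan) auto
next
  case (4 n)
  thus ?case unfolding set_integral_logtan_scale by (rule zeta_h_odd_eq_integral)
next
  case (5 z)
  thus ?case unfolding set_integrable_logtan_scale by (rule set_integrable_hurwitz_logtan)
next
  case 6
  obtain F where F: "F holomorphic_on (UNIV - {2 * of_nat n - 1 | n::nat. n \<ge> 1})"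
    "\<forall>n::nat. n \<ge> 1 \<longrightarrow> is_pole F (2 * of_nat n - 1)"
    "\<forall>z. Re z < 1 \<longrightarrow> F z = G_fun z" "\<forall>z. Re z \<ge> 1 \<longrightarrow> F z = G_cont z"
    using G_continuation by blast
  have inv: "1 / Gamma z = rGamma z" for z :: complex
    by (simp add: rGamma_inverse_Gamma inverse_eq_divide)
  show ?case
    unfolding riemann_zeta_term_eq inv tan_series_def[symmetric] mellin_exp_w_def[symmetric] G_cont_def[symmetric]
    using F by (intro exI[of _ F]) (auto intro: summable_tan_series set_integrable_mellin_exp_w)
qed

end
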